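(* Representatives of all the classes up to equivalence $\sim$ of the graded contractions of $\Gamma_{\mathfrak g_2}$ are the following. That is, every graded contraction of $\Gamma_{\mathfrak g_2}$ is equivalent to $\varepsilon_\eta$ for some $\eta$ in the list below; maps $\eta$ from different items, or distinct maps in item (i), are not equivalent; and within items (ii)-(iv) equivalence is as described: (i) $\{\eta^{T_i}: 1\le i\le 24,\ i\neq 8,14,17,20\}$; (ii) $\{(1,1,1,\lambda):\lambda\in\mathbb C^\times\}$ with support $T_{14}$, where $(1,1,1,\lambda)\sim(1,1,1,\lambda')$ if and only if $\lambda'\in\{\lambda,\frac1\lambda\}$; (iii) $\{(1,\lambda,1,1,\lambda):\lambda\in\mathbb C^\times\}$ with support $T_{17}$, where $(1,\lambda,1,1,\lambda)\sim(1,\lambda',1,1,\lambda')$ if and only if $\lambda'\in\{\pm\lambda,\pm\frac1\lambda\}$; (iv) $\{(1,\lambda,\mu,1,\lambda,\mu):\lambda,\mu\in\mathbb C^\times\}$ with support $T_{20}$, where $(1,\lambda,\mu,1,\lambda,\mu)\sim(1,\lambda',\mu',1,\lambda',\mu')$ if and only if the set $\{\pm\lambda',\pm\mu'\}$ coincides with either $\{\pm\lambda,\pm\mu\}$ or $\{\pm\frac1\lambda,\pm\frac\mu\lambda\}$ or $\{\pm\frac\lambda\mu,\pm\frac1\mu\}$.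
   Context: Let $I=\{1,\dots,7\}$ and write the elements of $G=\mathbb{Z}_2^3$ as $e=g_0=(0,0,0)$, $g_1=(1,0,0)$, $g_2=(0,1,0)$, $g_3=(0,0,1)$, $g_4=(1,1,1)$, $g_5=(1,1,0)$, $g_6=(1,0,1)$, $g_7=(0,1,1)$. For $i\ne j$ in $I$, $i\ast j\in I$ is the index with $g_{i\ast j}=g_i+g_j$. Pairwise distinct $i,j,k\in I$ are generative if $k\ne i\ast j$. Let $X=\{\{i,j\}: i,j\in I,\ i\neq j\}$. The complex octonion algebra $\mathcal O$ has basis $1,e_1,\dots,e_7$, with identity $1$, $e_i^2=-1$, and for $i\neq j$: $e_ie_j=e_{i\ast j}$ if some cyclic permutation of $(i,j,i\ast j)$ belongs to $\{(1,2,5),(5,6,7),(7,4,1),(1,3,6),(6,4,2),(2,7,3),(3,4,5)\}$, and $e_ie_j=-e_{i\ast j}$ otherwise. It is $G$-graded by $\mathcal O_{g_0}=\mathbb C1$, $\mathcal O_{g_i}=\mathbb Ce_i$. Let $\mathfrak L=\mathfrak g_2=\mathrm{Der}(\mathcal O)$, with the induced $G$-grading $\Gamma_{\mathfrak g_2}$: $\mathfrak L=\bigoplus_{g\in G}\mathfrak L_g$, $\mathfrak L_g=\{d\in\mathfrak L: d(\mathcal O_h)\subseteq\mathcal O_{g+h}\ \forall h\in G\}$. A graded contraction of $\Gamma_{\mathfrak g_2}$ is a map $\varepsilon:G\times G\to\mathbb C$ such that the vector space $\mathfrak L$ with product $[x,y]^\varepsilon:=\varepsilon(g,h)[x,y]$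 for $x\in\mathfrak L_g,y\in\mathfrak L_h$ (extended bilinearly) is a Lie algebra, denoted $\mathfrak L^\varepsilon$. Equivalence $\varepsilon\sim\varepsilon'$: there is a Lie algebra isomorphism $\varphi:\mathfrak L^\varepsilon\to\mathfrak L^{\varepsilon'}$ such that for every $g\in G$ there is $h\in G$ with $\varphi(\mathfrak L_g)=\mathfrak L_h$. For $\eta:X\to\mathbb C$ write $\eta_{ij}=\eta(\{i,j\})$ and, for $i,j,k$ generative, $\eta_{ijk}=\eta_{i\,j\ast k}\,\eta_{jk}$. Let $\mathcal A$ be the set of maps $\eta:X\to\mathbb C$ with $\eta_{ijk}=\eta_{jki}$ for all generative $i,j,k$. Each $\eta\in\mathcal A$ defines a graded contraction $\varepsilon_\eta$ of $\Gamma_{\mathfrak g_2}$ by $\varepsilon_\eta(g_i,g_j)=\eta_{ij}$ if $i\ne j$ are in $I$, and $0$ otherwise; $\eta\sim\eta'$ means $\varepsilon_\eta\sim\varepsilon_{\eta'}$. The support of $\eta$ is $\{t\in X:\eta(t)\neq0\}$. For $T\subseteq X$, $\eta^T$ is the map equal to $1$ on $T$ and $0$ on $X\setminus T$. If $\eta$ has support $T=\{\{i_1,j_1\},\dots,\{i_s,j_s\}\}$ ordered lexicographically ($i_k<j_k$), one writes $\eta=(\eta_{i_1j_1},\dots,\eta_{i_sj_s})$. For $i,j,k$ generative, $P_{\{i,j,k\}}:=\{\{i,j\},\{j,k\},\{k,i\},\{i,j\ast k\},\{j,k\ast i\},\{k,i\ast j\}\}$. The sets $T_i$ are: $T_1=\emptyset$;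 $T_2=\{\{1,2\}\}$; $T_3=\{\{1,2\},\{1,3\}\}$; $T_4=\{\{1,2\},\{1,5\}\}$; $T_5=\{\{1,2\},\{6,7\}\}$; $T_6=\{\{1,2\},\{1,5\},\{2,5\}\}$; $T_7=\{\{2,5\},\{3,6\},\{4,7\}\}$; $T_8=\{\{1,2\},\{1,3\},\{1,4\}\}$; $T_9=\{\{1,2\},\{1,3\},\{1,5\}\}$; $T_{10}=\{\{1,2\},\{1,3\},\{1,7\}\}$; $T_{11}=\{\{1,2\},\{1,6\},\{2,6\}\}$; $T_{12}=\{\{1,2\},\{1,6\},\{6,7\}\}$; $T_{13}=\{\{1,2\},\{1,3\},\{1,4\},\{1,5\}\}$; $T_{14}=\{\{1,2\},\{1,3\},\{1,5\},\{1,6\}\}$; $T_{15}=\{\{1,2\},\{1,6\},\{1,7\},\{2,6\}\}$; $T_{16}=\{\{1,2\},\{1,6\},\{2,7\},\{6,7\}\}$; $T_{17}=\{\{1,2\},\{1,3\},\{1,4\},\{1,5\},\{1,6\}\}$; $T_{18}=\{\{1,2\},\{1,6\},\{1,7\},\{2,6\},\{2,7\}\}$; $T_{19}=\{\{3,4\},\{3,6\},\{3,7\},\{4,6\},\{4,7\},\{6,7\}\}$; $T_{20}=\{\{1,j\}:2\le j\le7\}$; $T_{21}=P_{\{1,2,3\}}$; $T_{22}=P_{\{1,2,3\}}\cup P_{\{1,2,6\}}\cup P_{\{1,3,5\}}\cup P_{\{1,5,6\}}$; $T_{23}=X\setminus T_{19}$; $T_{24}=X$. *)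

theory Defs
  imports
    "HOL-Analysis.Analysis"
    "HOL-Library.Function_Algebras"
    "HOL-Library.Z2"
begin

section \<open>Lie algebras\<close>

text \<open>A Lie algebra whose underlying vector space is a subspace \<open>L\<close> of an ambient vector space;
  the values of \<open>br\<close> outside \<open>L\<close> are irrelevant.\<close>

locale lie_algebra = vector_space scale
  for scale :: "'k::field \<Rightarrow> 'v::ab_group_add \<Rightarrow> 'v" (infixr \<open>*\<^sub>V\<close> 75)
    and L :: "'v set" and br :: "'v \<Rightarrow> 'v \<Rightarrow> 'v" +
  assumes carrier_subspace: "subspace L"
    and br_closed: "\<lbrakk>x \<in> L; y \<in> L\<rbrakk> \<Longrightarrow> br x y \<in> L"
    and br_add_left: "\<lbrakk>x \<in> L; y \<in> L; z \<in> L\<rbrakk> \<Longrightarrow> br (x + y) z = br x z + br y z"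
    and br_add_right: "\<lbrakk>x \<in> L; y \<in> L; z \<in> L\<rbrakk> \<Longrightarrow> br x (y + z) = br x y + br x z"
    and br_scale_left: "\<lbrakk>x \<in> L; y \<in> L\<rbrakk> \<Longrightarrow> br (c *\<^sub>V x) y = c *\<^sub>V br x y"
    and br_scale_right: "\<lbrakk>x \<in> L; y \<in> L\<rbrakk> \<Longrightarrow> br x (c *\<^sub>V y) = c *\<^sub>V br x y"
    and br_alternating: "x \<in> L \<Longrightarrow> br x x = 0"
    and br_jacobi: "\<lbrakk>x \<in> L; y \<in> L; z \<in> L\<rbrakk> \<Longrightarrow>
      br x (br y z) + br y (br z x) + br z (br x y) = 0"

definition lie_iso ::
  "('k \<Rightarrow> 'v::ab_group_add \<Rightarrow> 'v) \<Rightarrow> 'v set \<Rightarrow> ('v \<Rightarrow> 'v \<Rightarrow> 'v) \<Rightarrow>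
   ('k \<Rightarrow> 'w::ab_group_add \<Rightarrow> 'w) \<Rightarrow> 'w set \<Rightarrow> ('w \<Rightarrow> 'w \<Rightarrow> 'w) \<Rightarrow> ('v \<Rightarrow> 'w) \<Rightarrow> bool"
  where "lie_iso s L br s' L' br' \<phi> \<longleftrightarrow>
    bij_betw \<phi> L L' \<and>
    (\<forall>x\<in>L. \<forall>y\<in>L. \<phi> (x + y) = \<phi> x + \<phi> y) \<and>
    (\<forall>c. \<forall>x\<in>L. \<phi> (s c x) = s' c (\<phi> x)) \<and>
    (\<forall>x\<in>L. \<forall>y\<in>L. \<phi> (br x y) = br' (\<phi> x) (\<phi> y))"


section \<open>The group \<open>\<int>\<^sub>2\<^sup>3\<close> and the index set\<close>

instance bit :: finite
proof
  have "(UNIV :: bit set) = {0, 1}"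
    using bit_not_one_iff by blast
  then show "finite (UNIV :: bit set)"
    by (metis finite.emptyI finite.insertI)
qed

type_synonym grp = "bit \<times> bit \<times> bit"

definition gel :: "nat \<Rightarrow> grp" where
  "gel i = [(0,0,0), (1,0,0), (0,1,0), (0,0,1), (1,1,1), (1,1,0), (1,0,1), (0,1,1)] ! i"

definition idx :: "grp \<Rightarrow> nat" where
  "idx g = (THE i. i \<le> 7 \<and> gel i = g)"

definition I7 :: "nat set" where
  "I7 = {1..7}"

definition star :: "nat \<Rightarrow> nat \<Rightarrow> nat" (infixl \<open>\<star>\<close> 70) where
  "i \<star> j = (THE k. k \<in> I7 \<and> gel k = gel i + gel j)"

definition generative :: "nat \<Rightarrow> nat \<Rightarrow> nat \<Rightarrow> bool" where
  "generative i j k \<longleftrightarrow> i \<in> I7 \<and> j \<in> I7 \<and> k \<in> I7 \<and>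
    i \<noteq> j \<and> j \<noteq> k \<and> i \<noteq> k \<and> k \<noteq> i \<star> j"

definition edges :: "nat set set" where
  "edges = {{i, j} | i j. i \<in> I7 \<and> j \<in> I7 \<and> i \<noteq> j}"


section \<open>The complex octonions\<close>

text \<open>The coordinate at \<open>gel i\<close> is the coefficient of \<open>e\<^sub>i\<close>, where \<open>e\<^sub>0 = 1\<close>;
  thus \<open>axis g 1\<close> is the basis vector of degree \<open>g\<close>.\<close>

type_synonym oct = "complex ^ grp"

definition oct_lines :: "(nat \<times> nat \<times> nat) set" where
  "oct_lines = {(1,2,5), (5,6,7), (7,4,1), (1,3,6), (6,4,2), (2,7,3), (3,4,5)}"

definition oct_sign :: "nat \<Rightarrow> nat \<Rightarrow> complex" where
  "oct_sign i j =
    (if i = 0 \<or> j = 0 then 1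
     else if i = j then - 1
     else if (i, j, i \<star> j) \<in> oct_lines \<or> (j, i \<star> j, i) \<in> oct_lines \<or> (i \<star> j, i, j) \<in> oct_lines
       then 1
     else - 1)"

definition oct_mult :: "oct \<Rightarrow> oct \<Rightarrow> oct" (infixl \<open>\<odot>\<close> 70) where
  "x \<odot> y = (\<Sum>g\<in>UNIV. \<Sum>h\<in>UNIV. (x $ g * y $ h * oct_sign (idx g) (idx h)) *s axis (g + h) 1)"

definition oct_grade :: "grp \<Rightarrow> oct set" where
  "oct_grade g = {c *s axis g 1 | c. True}"


section \<open>The algebra \<open>\<gg>\<^sub>2\<close> of derivations and its grading\<close>

definition scaleE :: "complex \<Rightarrow> (oct \<Rightarrow> oct) \<Rightarrow> oct \<Rightarrow> oct" where
  "scaleE c d = (\<lambda>x. c *s d x)"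

interpretation endo: vector_space scaleE
  by unfold_locales
    (simp_all add: scaleE_def fun_eq_iff vec.scale_right_distrib vec.scale_left_distrib)

definition Der :: "(oct \<Rightarrow> oct) set" where
  "Der = {d. Vector_Spaces.linear (*s) (*s) d \<and> (\<forall>x y. d (x \<odot> y) = d x \<odot> y + x \<odot> d y)}"

definition Der_grade :: "grp \<Rightarrow> (oct \<Rightarrow> oct) set" where
  "Der_grade g = {d \<in> Der. \<forall>h. d ` oct_grade h \<subseteq> oct_grade (g + h)}"

definition commutator :: "(oct \<Rightarrow> oct) \<Rightarrow> (oct \<Rightarrow> oct) \<Rightarrow> oct \<Rightarrow> oct" where
  "commutator d d' = (\<lambda>x. d (d' x) - d' (d x))"


section \<open>Graded contractions\<close>

definition oct_proj :: "grp \<Rightarrow> oct \<Rightarrow> oct" where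
  "oct_proj g x = x $ g *s axis g 1"

text \<open>The homogeneous component of degree \<open>g\<close> of a linear map.\<close>

definition hom_part :: "grp \<Rightarrow> (oct \<Rightarrow> oct) \<Rightarrow> oct \<Rightarrow> oct" where
  "hom_part g d = (\<lambda>x. \<Sum>h\<in>UNIV. oct_proj (g + h) (d (oct_proj h x)))"

text \<open>The bilinear extension of \<open>[x,y]\<^sup>\<epsilon> = \<epsilon>(g,h)[x,y]\<close>, for \<open>x\<close>, \<open>y\<close> homogeneous of degrees
  \<open>g\<close>, \<open>h\<close>; see \<open>contr_bracket_homogeneous\<close> below.\<close>

definition contr_bracket ::
  "(grp \<Rightarrow> grp \<Rightarrow> complex) \<Rightarrow> (oct \<Rightarrow> oct) \<Rightarrow> (oct \<Rightarrow> oct) \<Rightarrow> oct \<Rightarrow> oct" where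
  "contr_bracket \<epsilon> x y =
    (\<Sum>g\<in>UNIV. \<Sum>h\<in>UNIV. scaleE (\<epsilon> g h) (commutator (hom_part g x) (hom_part h y)))"

definition graded_contraction :: "(grp \<Rightarrow> grp \<Rightarrow> complex) \<Rightarrow> bool" where
  "graded_contraction \<epsilon> \<longleftrightarrow> lie_algebra scaleE Der (contr_bracket \<epsilon>)"

definition gc_equiv ::
  "(grp \<Rightarrow> grp \<Rightarrow> complex) \<Rightarrow> (grp \<Rightarrow> grp \<Rightarrow> complex) \<Rightarrow> bool" where
  "gc_equiv \<epsilon> \<epsilon>' \<longleftrightarrow>
    (\<exists>\<phi>. lie_iso scaleE Der (contr_bracket \<epsilon>) scaleE Der (contr_bracket \<epsilon>') \<phi> \<and>
         (\<forall>g. \<exists>h. \<phi> ` Der_grade g = Der_grade h))"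

lemma oct_eq_sum_proj: "x = (\<Sum>h\<in>UNIV. oct_proj h x)"
  by (simp add: vec_eq_iff oct_proj_def axis_def if_distrib cong: if_cong)

lemma oct_proj_grade: "oct_proj h x \<in> oct_grade h"
  by (auto simp: oct_proj_def oct_grade_def)

lemma oct_proj_on_grade: "y \<in> oct_grade k \<Longrightarrow> oct_proj h y = (if h = k then y else 0)"
  by (auto simp: oct_grade_def oct_proj_def axis_def vec_eq_iff)

lemma hom_part_Der_grade:
  assumes d: "d \<in> Der_grade g"
  shows "hom_part k d = (if k = g then d else 0)"
proof
  fix x
  interpret d: Vector_Spaces.linear "(*s)" "(*s)" d
    using d by (simp add: Der_grade_def Der_def)
  have "d (oct_proj h x) \<in> oct_grade (g + h)" for h
    using d oct_proj_grade[of h x] unfolding Der_grade_def by blast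
  then have *: "oct_proj (k + h) (d (oct_proj h x)) = (if k = g then d (oct_proj h x) else 0)" for h
    by (subst oct_proj_on_grade[of _ "g + h"]) auto
  have "d x = (\<Sum>h\<in>UNIV. d (oct_proj h x))"
    using oct_eq_sum_proj[of x] d.sum[of "\<lambda>h. oct_proj h x" UNIV] by metis
  then show "hom_part k d x = (if k = g then d else 0) x"
    by (simp add: hom_part_def *)
qed

lemma hom_part_sum:
  assumes "d \<in> Der"
  shows "(\<Sum>g\<in>UNIV. hom_part g d) = d"
proof
  fix x
  interpret d: Vector_Spaces.linear "(*s)" "(*s)" d
    using assms by (simp add: Der_def)
  have *: "(\<Sum>g\<in>UNIV. oct_proj (g + h) y) = y" for h and y :: oct
  proof -
    have "(\<Sum>g\<in>UNIV. oct_proj (g + h) y) = (\<Sum>g\<in>UNIV. oct_proj g y)"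
      by (rule sum.reindex_bij_betw[where h = "\<lambda>g. g + h"])
         (rule bij_betwI[where g = "\<lambda>g. g - h"], auto)
    then show ?thesis
      using oct_eq_sum_proj[of y] by simp
  qed
  have "(\<Sum>g\<in>UNIV. hom_part g d) x = (\<Sum>g\<in>UNIV. hom_part g d x)"
    by (induction rule: finite_induct[OF finite[of UNIV]]) auto
  also have "\<dots> = (\<Sum>h\<in>UNIV. \<Sum>g\<in>UNIV. oct_proj (g + h) (d (oct_proj h x)))"
    unfolding hom_part_def by (rule sum.swap)
  also have "\<dots> = (\<Sum>h\<in>UNIV. d (oct_proj h x))"
    by (simp add: *)
  also have "\<dots> = d x"
    using oct_eq_sum_proj[of x] d.sum[of "\<lambda>h. oct_proj h x" UNIV] by metis
  finally show "(\<Sum>g\<in>UNIV. hom_part g d) x = d x" .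
qed

lemma contr_bracket_homogeneous:
  assumes x: "x \<in> Der_grade g" and y: "y \<in> Der_grade h"
  shows "contr_bracket \<epsilon> x y = scaleE (\<epsilon> g h) (commutator x y)"
proof -
  have lin: "z 0 = 0" if "z \<in> Der_grade k" for z k
  proof -
    interpret z: Vector_Spaces.linear "(*s)" "(*s)" z
      using that by (simp add: Der_grade_def Der_def)
    show ?thesis by simp
  qed
  have *: "scaleE (\<epsilon> a b) (commutator (hom_part a x) (hom_part b y)) =
      (if a = g then if b = h then scaleE (\<epsilon> g h) (commutator x y) else 0 else 0)" for a b
    by (auto simp: hom_part_Der_grade[OF x] hom_part_Der_grade[OF y] commutator_def scaleE_def
        fun_eq_iff lin[OF x] lin[OF y])
  have "contr_bracket \<epsilon> x y =
      (\<Sum>a\<in>UNIV. if a = g then \<Sum>b\<in>UNIV. if b = h then scaleE (\<epsilon> g h) (commutator x y) else 0 else 0)"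
    unfolding contr_bracket_def * by (intro sum.cong) auto
  then show ?thesis by simp
qed


section \<open>Admissible maps\<close>

text \<open>A map \<open>\<eta>\<close> from \<open>edges\<close> to the complex numbers is represented by its extension by zero to
  all sets of naturals.\<close>

definition eta3 :: "(nat set \<Rightarrow> complex) \<Rightarrow> nat \<Rightarrow> nat \<Rightarrow> nat \<Rightarrow> complex" where
  "eta3 \<eta> i j k = \<eta> {i, j \<star> k} * \<eta> {j, k}"

definition admissible :: "(nat set \<Rightarrow> complex) set" where
  "admissible = {\<eta>. (\<forall>t. t \<notin> edges \<longrightarrow> \<eta> t = 0) \<and>
     (\<forall>i j k. generative i j k \<longrightarrow> eta3 \<eta> i j k = eta3 \<eta> j k i)}"

definition eps :: "(nat set \<Rightarrow> complex) \<Rightarrow> grp \<Rightarrow> grp \<Rightarrow> complex" where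
  "eps \<eta> g h =
    (if idx g \<in> I7 \<and> idx h \<in> I7 \<and> idx g \<noteq> idx h then \<eta> {idx g, idx h} else 0)"

definition eta_equiv :: "(nat set \<Rightarrow> complex) \<Rightarrow> (nat set \<Rightarrow> complex) \<Rightarrow> bool" where
  "eta_equiv \<eta> \<eta>' \<longleftrightarrow> gc_equiv (eps \<eta>) (eps \<eta>')"

definition eta_support :: "(nat set \<Rightarrow> complex) \<Rightarrow> nat set set" where
  "eta_support \<eta> = {t \<in> edges. \<eta> t \<noteq> 0}"

definition eta_ind :: "nat set set \<Rightarrow> nat set \<Rightarrow> complex" where
  "eta_ind T = (\<lambda>t. if t \<in> T then 1 else 0)"


section \<open>The list of representatives\<close>

definition P_set :: "nat \<Rightarrow> nat \<Rightarrow> nat \<Rightarrow> nat set set" where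
  "P_set i j k = {{i, j}, {j, k}, {k, i}, {i, j \<star> k}, {j, k \<star> i}, {k, i \<star> j}}"

definition T19 :: "nat set set" where
  "T19 = {{3,4}, {3,6}, {3,7}, {4,6}, {4,7}, {6,7}}"

definition T_set :: "nat \<Rightarrow> nat set set" where
  "T_set i =
   [ {},
     {{1,2}},
     {{1,2}, {1,3}},
     {{1,2}, {1,5}},
     {{1,2}, {6,7}},
     {{1,2}, {1,5}, {2,5}},
     {{2,5}, {3,6}, {4,7}},
     {{1,2}, {1,3}, {1,4}},
     {{1,2}, {1,3}, {1,5}},
     {{1,2}, {1,3}, {1,7}},
     {{1,2}, {1,6}, {2,6}},
     {{1,2}, {1,6}, {6,7}},
     {{1,2}, {1,3}, {1,4}, {1,5}},
     {{1,2}, {1,3}, {1,5}, {1,6}},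
     {{1,2}, {1,6}, {1,7}, {2,6}},
     {{1,2}, {1,6}, {2,7}, {6,7}},
     {{1,2}, {1,3}, {1,4}, {1,5}, {1,6}},
     {{1,2}, {1,6}, {1,7}, {2,6}, {2,7}},
     T19,
     {{1,j} | j. 2 \<le> j \<and> j \<le> 7},
     P_set 1 2 3,
     P_set 1 2 3 \<union> P_set 1 2 6 \<union> P_set 1 3 5 \<union> P_set 1 5 6,
     edges - T19,
     edges ] ! (i - 1)"

text \<open>The families supported on \<open>T\<^sub>1\<^sub>4\<close>, \<open>T\<^sub>1\<^sub>7\<close> and \<open>T\<^sub>2\<^sub>0\<close>: the tuple
  \<open>(1,1,1,\<lambda>)\<close> etc. lists the values at the elements of the support in lexicographic order.\<close>

definition eta14 :: "complex \<Rightarrow> nat set \<Rightarrow> complex" where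
  "eta14 l = (\<lambda>_. 0)({1,2} := 1, {1,3} := 1, {1,5} := 1, {1,6} := l)"

definition eta17 :: "complex \<Rightarrow> nat set \<Rightarrow> complex" where
  "eta17 l = (\<lambda>_. 0)({1,2} := 1, {1,3} := l, {1,4} := 1, {1,5} := 1, {1,6} := l)"

definition eta20 :: "complex \<Rightarrow> complex \<Rightarrow> nat set \<Rightarrow> complex" where
  "eta20 l m =
    (\<lambda>_. 0)({1,2} := 1, {1,3} := l, {1,4} := m, {1,5} := 1, {1,6} := l, {1,7} := m)"

lemma edges_mem: "i \<in> I7 \<Longrightarrow> j \<in> I7 \<Longrightarrow> i \<noteq> j \<Longrightarrow> {i, j} \<in> edges"
  by (auto simp: edges_def)

lemma eta_support_eta14: "l \<noteq> 0 \<Longrightarrow> eta_support (eta14 l) = T_set 14"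
  by (auto simp: eta_support_def eta14_def T_set_def edges_mem I7_def split: if_splits)

lemma eta_support_eta17: "l \<noteq> 0 \<Longrightarrow> eta_support (eta17 l) = T_set 17"
  by (auto simp: eta_support_def eta17_def T_set_def edges_mem I7_def split: if_splits)

lemma T_set_20: "T_set 20 = {{1,2}, {1,3}, {1,4}, {1,5}, {1,6}, {1,7}}"
proof -
  have "{{1,j} | j. 2 \<le> j \<and> j \<le> 7} = (\<lambda>j. {1,j}) ` {2..7::nat}" by auto
  also have "{2..7::nat} = {2,3,4,5,6,7}" by auto
  finally show ?thesis by (simp add: T_set_def)
qed

lemma eta_support_eta20: "l \<noteq> 0 \<Longrightarrow> m \<noteq> 0 \<Longrightarrow> eta_support (eta20 l m) = T_set 20"
  by (auto simp: eta_support_def eta20_def T_set_20 edges_mem I7_def split: if_splits)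

text \<open>\<open>rep_item n\<close> is the \<open>n\<close>-th of the four items of the classification.\<close>

definition rep_item :: "nat \<Rightarrow> (nat set \<Rightarrow> complex) set" where
  "rep_item n =
   [ {eta_ind (T_set i) | i. 1 \<le> i \<and> i \<le> 24 \<and> i \<notin> {8, 14, 17, 20}},
     {eta14 l | l. l \<noteq> 0},
     {eta17 l | l. l \<noteq> 0},
     {eta20 l m | l m. l \<noteq> 0 \<and> m \<noteq> 0} ] ! (n - 1)"

end

theory Submission
  imports Defs
begin

text \<open>
  A derivation of degree \<open>g\<close> sends \<open>e\<^sub>h\<close> to a multiple \<open>c h\<close> of \<open>e\<^bsub>g+h\<^esub>\<close>, so \<open>\<gg>\<^sub>2\<close> becomes a space of
  scalar functions \<open>c\<close>: two-dimensional in each degree \<open>g \<noteq> 0\<close> and zero in degree \<open>0\<close>. For generative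
  \<open>i, j, k\<close> two of the three terms of the Jacobi identity can be made linearly independent, which
  forces the admissibility equations, and all other entries of a graded contraction are irrelevant.

  The support of an admissible map is closed under \<open>{i,j}, {i * j,k} \<mapsto> P\<^bsub>{i,j,k}\<^esub>\<close>. Adding one edge to
  some \<open>T\<^sub>n\<close> and closing up always yields a set that contains a collineation image of a larger \<open>T\<^sub>m\<close>;
  hence every support is a collineation image of some \<open>T\<^sub>n\<close>. Collineations lift to automorphisms of the
  octonions, and rescaling each component brings the values on a fixed support to normal form.

  An equivalence permutes the components and thus preserves the supports as graphs whose edge
  \<open>{i,j}\<close> carries the label \<open>i * j\<close>; numerical invariants of these graphs separate the \<open>T\<^sub>n\<close>, apart from
  \<open>T\<^sub>8\<close> and \<open>T\<^sub>1\<^sub>0\<close>. In the three families the degree \<open>g\<^sub>1\<close> is fixed, and \<open>x \<mapsto> tr (ad x)\<^sup>2\<close> on the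
  component of degree \<open>g\<^sub>j\<close> is a multiple, by \<open>\<eta>\<^bsub>1j\<^esub> \<eta>\<^bsub>1 1*j\<^esub>\<close>, of a binary quadratic form that
  depends only on the line through \<open>1\<close> and \<open>j\<close>. The three forms have the same discriminant, and any two
  of them the same polarized discriminant, so the ratios of these multiples are invariants.
\<close>

text \<open>An equivalence is only required to send components to components. The induced
  permutation of the seven degrees need not come from a collineation, as the pair
  \<open>T_set 8\<close>, \<open>T_set 10\<close> shows, so every invariant has to be read off from
  brackets that survive the contraction. The quadratic forms come from the root system. The
  component of degree g_1 is a Cartan subalgebra, and on the two components belonging to a line
  through 1 the eigenvalues of ad x are, up to sign and a factor i, a short root and the long root
  orthogonal to it. Discriminants alone would determine the ratio of two multipliers only up to
  sign; the polarized discriminant fixes that sign, and this is what separates \<lambda> from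
  -\<lambda> on \<open>T_set 14\<close>. Instead of the 2^21 sets of edges, only the 386 pairs of a
  representative support and an edge outside it are examined.\<close>

declare split_paired_All [simp del] split_paired_Ex [simp del]

section \<open>Arithmetic of the grading group\<close>

lemma grp_add_self [simp]: "g + g = (0::grp)"
  by (cases g) (auto simp: zero_prod_def)

lemma grp_add_cancel [simp]: "g + (g + h) = (h::grp)" "(h + g) + g = (h::grp)" "(g + h) + g = (h::grp)" "g + (h + g) = (h::grp)"
proof -
  show "(g + h) + g = h" by (subst add.commute [of g]) (subst add.assoc, simp)
  then show "g + (h + g) = h" by (simp only: add.assoc)
  show "g + (g + h) = h" by (subst add.assoc [symmetric]) simp
  show "(h + g) + g = h" by (subst add.assoc) simp
qed

lemma grp_add_eq_0_iff [simp]: "g + h = 0 \<longleftrightarrow> g = (h::grp)"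
  by (metis grp_add_self grp_add_cancel(2) add_0)

lemma atMost7: "i \<le> 7 \<longleftrightarrow> i \<in> {0,1,2,3,4,5,6,7::nat}"
  by auto

lemma ball_le7: "(\<forall>i\<le>7. P i) \<longleftrightarrow> P 0 \<and> P 1 \<and> P 2 \<and> P 3 \<and> P 4 \<and> P 5 \<and> P 6 \<and> P (7::nat)"
  unfolding atMost7 by blast

lemma gel_simps [simp]:
  "gel 0 = (0,0,0)" "gel (Suc 0) = (1,0,0)" "gel 1 = (1,0,0)" "gel 2 = (0,1,0)" "gel 3 = (0,0,1)"
  "gel 4 = (1,1,1)" "gel 5 = (1,1,0)" "gel 6 = (1,0,1)" "gel 7 = (0,1,1)"
  by (simp_all add: gel_def)

lemma gel_inj: "i \<le> 7 \<Longrightarrow> j \<le> 7 \<Longrightarrow> gel i = gel j \<Longrightarrow> i = j"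
  unfolding atMost7 by auto

lemma idx_gel [simp]: "i \<le> 7 \<Longrightarrow> idx (gel i) = i"
  unfolding idx_def using gel_inj by blast

lemma gel_surj: "\<exists>i\<le>7. gel i = g"
proof -
  obtain a b c where g: "g = (a, b, c)" by (cases g)
  have "a = 0 \<or> a = 1" "b = 0 \<or> b = 1" "c = 0 \<or> c = 1"
    using bit_not_one_iff[of a] bit_not_one_iff[of b] bit_not_one_iff[of c] by blast+
  then have "g \<in> gel ` {0,1,2,3,4,5,6,7}"
    unfolding g image_insert gel_simps by (elim disjE) simp_all
  then obtain i where "i \<in> {0,1,2,3,4,5,6,7}" "g = gel i" by (elim imageE)
  then show ?thesis unfolding atMost7 by blast
qed

lemma gel_idx [simp]: "gel (idx g) = g" and idx_le: "idx g \<le> 7"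
  using gel_surj[of g] by (auto)

lemma all_grp_iff: "(\<forall>g. P g) \<longleftrightarrow> (\<forall>i\<le>7. P (gel i))"
  by (metis gel_surj)

lemma gel_0: "gel 0 = 0" unfolding gel_simps zero_prod_def by (rule refl)

lemma idx_0 [simp]: "idx 0 = 0"
  using idx_gel[of 0] unfolding gel_0 by simp

section \<open>Integer tables for the sum of degrees and for the octonion signs\<close>

text \<open>\<open>\<star>\<close> is a definite description. The table is a computable substitute,
  extended to the index 0 of the neutral element and to equal arguments, where it gives 0.\<close>

definition xtab :: "nat list list" where
  "xtab = [[0, 1, 2, 3, 4, 5, 6, 7], [1, 0, 5, 6, 7, 2, 3, 4], [2, 5, 0, 7, 6, 1, 4, 3],
    [3, 6, 7, 0, 5, 4, 1, 2], [4, 7, 6, 5, 0, 3, 2, 1], [5, 2, 1, 4, 3, 0, 7, 6],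
    [6, 3, 4, 1, 2, 7, 0, 5], [7, 4, 3, 2, 1, 6, 5, 0]]"

definition xo :: "nat \<Rightarrow> nat \<Rightarrow> nat" where "xo i j = xtab ! i ! j"

text \<open>Integer form of \<open>oct_sign\<close>: identities between signs become statements that
  evaluation can decide.\<close>

definition stab :: "int list list" where
  "stab = [[1, 1, 1, 1, 1, 1, 1, 1], [1, -1, 1, 1, -1, -1, -1, 1], [1, -1, -1, -1, -1, 1, 1, 1],
    [1, -1, 1, -1, 1, -1, 1, -1], [1, 1, 1, -1, -1, 1, -1, -1], [1, 1, -1, 1, -1, -1, 1, -1],
    [1, 1, -1, -1, 1, -1, -1, 1], [1, -1, -1, 1, 1, 1, -1, -1]]"

definition sgn8 :: "nat \<Rightarrow> nat \<Rightarrow> int" where "sgn8 i j = stab ! i ! j"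

lemma xo_le: "\<forall>i\<le>7. \<forall>j\<le>7. xo i j \<le> 7"
  unfolding ball_le7 by (simp add: xo_def xtab_def)

lemma gel_add': "\<forall>i\<le>7. \<forall>j\<le>7. gel i + gel j = gel (xo i j)"
  unfolding ball_le7 by (simp add: xo_def xtab_def zero_prod_def)

lemma gel_add: "i \<le> 7 \<Longrightarrow> j \<le> 7 \<Longrightarrow> gel i + gel j = gel (xo i j)"
  using gel_add' by blast

lemma idx_add: "idx (g + h) = xo (idx g) (idx h)"
  by (metis gel_add gel_idx idx_gel idx_le xo_le)

lemma xo_nonzero': "\<forall>i\<le>7. \<forall>j\<le>7. i \<noteq> j \<longrightarrow> xo i j \<noteq> 0"
  unfolding ball_le7 by (simp add: xo_def xtab_def)

lemma star_eq_xo: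
  assumes "i \<in> I7" "j \<in> I7" "i \<noteq> j" shows "i \<star> j = xo i j"
proof -
  have ij: "i \<le> 7" "j \<le> 7" using assms by (auto simp: I7_def)
  have "xo i j \<in> I7" using xo_le xo_nonzero' ij assms(3) by (fastforce simp: I7_def)
  then show ?thesis unfolding star_def gel_add[OF ij]
    by (intro the_equality) (auto simp: I7_def intro: gel_inj)
qed

text \<open>Turns a quantifier over the eight indices into an executable predicate on a
  list.\<close>

lemma ball_le7_list: "(\<forall>i\<le>7. P i) \<longleftrightarrow> list_all P [0,1,2,3,4,5,6,7::nat]"
  unfolding ball_le7 by simp

lemma oct_lines_sgn8: "\<forall>i\<le>7. \<forall>j\<le>7. i \<noteq> j \<and> i \<noteq> 0 \<and> j \<noteq> 0 \<longrightarrow>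
  sgn8 i j = (if (i, j, xo i j) \<in> oct_lines \<or> (j, xo i j, i) \<in> oct_lines \<or>
    (xo i j, i, j) \<in> oct_lines then 1 else - 1)"
  unfolding ball_le7_list by code_simp

lemma sgn8_diag: "\<forall>i\<le>7. sgn8 i i = (if i = 0 then 1 else -1) \<and> sgn8 0 i = 1 \<and> sgn8 i 0 = 1"
  unfolding ball_le7_list by code_simp

lemma oct_sign_sgn8:
  assumes "i \<le> 7" "j \<le> 7" shows "oct_sign i j = of_int (sgn8 i j)"
proof (cases "i = j \<or> i = 0 \<or> j = 0")
  case True
  then show ?thesis using sgn8_diag assms by (auto simp: oct_sign_def)
next
  case False
  then have s: "i \<star> j = xo i j" using assms by (intro star_eq_xo) (auto simp: I7_def)
  have "sgn8 i j = (if (i, j, xo i j) \<in> oct_lines \<or> (j, xo i j, i) \<in> oct_lines \<or>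
    (xo i j, i, j) \<in> oct_lines then 1 else - 1)"
    using oct_lines_sgn8 assms False by blast
  with False show ?thesis unfolding oct_sign_def s by auto
qed

section \<open>Homogeneous operators on the octonions and the Leibniz rule\<close>

abbreviation osg :: "grp \<Rightarrow> grp \<Rightarrow> complex" where
  "osg g h \<equiv> oct_sign (idx g) (idx h)"

lemma axis_nth_grp: "axis g c $ h = (if h = g then c else (0::complex))"
  by (simp add: axis_def)

lemma oct_mult_nth: "(x \<odot> y) $ m = (\<Sum>h\<in>UNIV. x $ h * y $ (h + m) * osg h (h + m))"
proof -
  have "g + h = m \<longleftrightarrow> h = g + m" for g h by auto
  then have "((x $ g * y $ h * osg g h) *s axis (g + h) 1) $ m =
      (if h = g + m then x $ g * y $ h * osg g h else 0)" for g h
    by (simp add: axis_nth_grp eq_commute[of m])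
  then show ?thesis by (simp add: oct_mult_def)
qed

lemma oct_mult_axis: "axis h (1::complex) \<odot> axis k 1 = osg h k *s axis (h + k) 1"
proof -
  have "(axis h 1 \<odot> axis k 1) $ m = (\<Sum>g\<in>UNIV. if g = h then (if k = h + m then osg h k else 0) else 0)" for m
    unfolding oct_mult_nth by (rule sum.cong) (auto simp: axis_def)
  moreover have "k = h + m \<longleftrightarrow> m = h + k" for m by auto
  ultimately show ?thesis by (auto simp: vec_eq_iff axis_def)
qed

text \<open>The operator that sends e_h to c h times e_{g+h}. The basis vector sent to degree k is
  the one of degree k + g, because every group element is its own negative.\<close>

definition hop :: "grp \<Rightarrow> (grp \<Rightarrow> complex) \<Rightarrow> oct \<Rightarrow> oct" where
  "hop g c x = (\<chi> k. c (k + g) * x $ (k + g))"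

text \<open>The Leibniz rule for \<open>hop g c\<close> on the product of e_h and e_k, compared in
  the one degree g + h + k where both sides live.\<close>

definition dcond :: "grp \<Rightarrow> (grp \<Rightarrow> complex) \<Rightarrow> bool" where
  "dcond g c \<longleftrightarrow> (\<forall>h k. c (h + k) * osg h k = c h * osg (g + h) k + c k * osg h (g + k))"

lemma hop_nth [simp]: "hop g c x $ k = c (k + g) * x $ (k + g)"
  by (simp add: hop_def)

lemma hop_axis: "hop g c (axis h 1) = c h *s axis (g + h) 1"
  by (auto simp: vec_eq_iff axis_def add.commute)

lemma linear_hop: "Vector_Spaces.linear (*s) (*s) (hop g c)"
  by unfold_locales (auto simp: vec_eq_iff algebra_simps)

lemma hop_eq_iff: "hop g c = hop g c' \<longleftrightarrow> c = c'"
proof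
  assume "hop g c = hop g c'"
  then have "hop g c (axis h 1) $ (g + h) = hop g c' (axis h 1) $ (g + h)" for h by simp
  then show "c = c'" unfolding hop_axis by (auto simp: axis_def)
qed simp

definition mat_coeff :: "grp \<Rightarrow> (oct \<Rightarrow> oct) \<Rightarrow> grp \<Rightarrow> complex" where
  "mat_coeff g d h = d (axis h 1) $ (g + h)"

lemma mat_coeff_hop: "mat_coeff k (hop g c) = (if k = g then c else (\<lambda>_. 0))"
  by (auto simp: fun_eq_iff mat_coeff_def hop_axis axis_def)

lemma linear_oct_scale:
  "Vector_Spaces.linear (*s) (*s) (d :: oct \<Rightarrow> oct) \<Longrightarrow> d (c *s x) = c *s d x"
proof -
  assume "Vector_Spaces.linear (*s) (*s) d"
  then interpret d: Vector_Spaces.linear "(*s)" "(*s)" d .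
  show ?thesis by (rule d.scale)
qed

lemma linear_oct_proj:
  assumes "Vector_Spaces.linear (*s) (*s) (d :: oct \<Rightarrow> oct)"
  shows "d (oct_proj h x) = x $ h *s d (axis h 1)"
  by (simp add: oct_proj_def linear_oct_scale[OF assms])

lemma hom_part_eq_hop:
  assumes "Vector_Spaces.linear (*s) (*s) (d :: oct \<Rightarrow> oct)"
  shows "hom_part g d = hop g (mat_coeff g d)"
proof
  fix x
  show "hom_part g d x = hop g (mat_coeff g d) x"
    unfolding hom_part_def linear_oct_proj[OF assms]
  proof (subst vec_eq_iff, intro allI)
    fix k
    have "k = g + h \<longleftrightarrow> h = k + g" for h by (metis add.commute grp_add_cancel(1))
    then have "oct_proj (g + h) (x $ h *s d (axis h 1)) $ k =
        (if h = k + g then x $ h * d (axis h 1) $ k else 0)" for h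
      by (simp add: oct_proj_def axis_nth_grp)
    then show "(\<Sum>h\<in>UNIV. oct_proj (g + h) (x $ h *s d (axis h 1))) $ k = hop g (mat_coeff g d) x $ k"
      by (simp add: mat_coeff_def add.commute[of g])
  qed
qed

lemma oct_mult_add: "(x + y) \<odot> z = x \<odot> z + y \<odot> z" "z \<odot> (x + y) = z \<odot> x + z \<odot> y"
  by (simp_all add: vec_eq_iff oct_mult_nth algebra_simps sum.distrib)

lemma oct_mult_scale: "(c *s x) \<odot> z = c *s (x \<odot> z)" "z \<odot> (c *s x) = c *s (z \<odot> x)"
  by (simp_all add: vec_eq_iff oct_mult_nth algebra_simps sum_distrib_left)

lemma oct_mult_sum: "(\<Sum>i\<in>A. f i) \<odot> z = (\<Sum>i\<in>A. f i \<odot> z)" "z \<odot> (\<Sum>i\<in>A. f i) = (\<Sum>i\<in>A. z \<odot> f i)"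
proof -
  have z: "0 \<odot> z = 0" "z \<odot> 0 = 0" using oct_mult_scale(1)[of 0 0 z] oct_mult_scale(2)[of z 0 0] by auto
  show "(\<Sum>i\<in>A. f i) \<odot> z = (\<Sum>i\<in>A. f i \<odot> z)" "z \<odot> (\<Sum>i\<in>A. f i) = (\<Sum>i\<in>A. z \<odot> f i)"
    by (induction A rule: infinite_finite_induct) (auto simp: oct_mult_add z)
qed

lemma Der_iff_basis:
  "d \<in> Der \<longleftrightarrow> Vector_Spaces.linear (*s) (*s) d \<and>
     (\<forall>h k. d (axis h 1 \<odot> axis k 1) = d (axis h 1) \<odot> axis k 1 + axis h 1 \<odot> d (axis k 1))"
proof (intro iffI conjI; (elim conjE)?)
  assume l: "Vector_Spaces.linear (*s) (*s) d" 
    and b: "\<forall>h k. d (axis h 1 \<odot> axis k 1) = d (axis h 1) \<odot> axis k 1 + axis h 1 \<odot> d (axis k 1)"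
  interpret d: Vector_Spaces.linear "(*s)" "(*s)" d by fact
  have "d (x \<odot> y) = d x \<odot> y + x \<odot> d y" for x y
  proof -
    define X where "X = (\<lambda>h. x $ h *s axis h (1::complex))"
    define Y where "Y = (\<lambda>h. y $ h *s axis h (1::complex))"
    have xy: "x = (\<Sum>h\<in>UNIV. X h)" "y = (\<Sum>h\<in>UNIV. Y h)"
      unfolding X_def Y_def by (simp_all add: basis_expansion)
    have "d (X h \<odot> Y k) = d (X h) \<odot> Y k + X h \<odot> d (Y k)" for h k
      unfolding X_def Y_def 
      by (simp add: oct_mult_scale d.scale b vec.scale_right_distrib)
    then show ?thesis unfolding xy
      by (simp add: oct_mult_sum d.sum sum.distrib)
  qed
  with l show "d \<in> Der" by (auto simp: Der_def)
qed (auto simp: Der_def)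

lemma Der_linear: "d \<in> Der \<Longrightarrow> Vector_Spaces.linear (*s) (*s) d"
  by (simp add: Der_def)

text \<open>For basis vectors e_h and e_k, the coordinate of degree g + h + k of the Leibniz rule
  involves only the coefficients of degree g. The rule therefore splits by degree, and every
  homogeneous part of a derivation is again a derivation.\<close>

lemma Der_iff_dcond:
  "d \<in> Der \<longleftrightarrow> Vector_Spaces.linear (*s) (*s) d \<and> (\<forall>g. dcond g (mat_coeff g d))"
proof -
  have "(d (axis h 1 \<odot> axis k 1) = d (axis h 1) \<odot> axis k 1 + axis h 1 \<odot> d (axis k 1)) \<longleftrightarrow>
    (\<forall>g. mat_coeff g d (h + k) * osg h k = mat_coeff g d h * osg (g + h) k + mat_coeff g d k * osg h (g + k))"
    (is "?L = ?R") if l: "Vector_Spaces.linear (*s) (*s) d" for h k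
  proof -
    have *: "?L \<longleftrightarrow> (\<forall>g. d (axis h 1 \<odot> axis k 1) $ (g + (h + k)) = (d (axis h 1) \<odot> axis k 1 + axis h 1 \<odot> d (axis k 1)) $ (g + (h + k)))"
    proof
      assume R: "\<forall>g. d (axis h 1 \<odot> axis k 1) $ (g + (h + k)) = (d (axis h 1) \<odot> axis k 1 + axis h 1 \<odot> d (axis k 1)) $ (g + (h + k))"
      have "d (axis h 1 \<odot> axis k 1) $ m = (d (axis h 1) \<odot> axis k 1 + axis h 1 \<odot> d (axis k 1)) $ m" for m
        using R[rule_format, of "m + (h + k)"] by (simp only: grp_add_cancel)
      then show ?L by (simp only: vec_eq_iff) blast
    qed simp
    have 1: "d (axis h 1 \<odot> axis k 1) $ (g + (h + k)) = mat_coeff g d (h + k) * osg h k" for g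
      by (simp add: oct_mult_axis linear_oct_scale[OF l] mat_coeff_def)
    have a: "(x \<odot> axis k 1) $ m = x $ (m + k) * osg (m + k) k" for x m
    proof -
      have "k = h + m \<longleftrightarrow> h = m + k" for h by (metis add.commute grp_add_cancel(1))
      then have "x $ h * axis k (1::complex) $ (h + m) * osg h (h + m) =
          (if h = m + k then x $ (m + k) * osg (m + k) k else 0)" for h
        by (simp add: axis_nth_grp eq_commute[of _ k])
      then show ?thesis by (simp add: oct_mult_nth)
    qed
    have b: "(axis h 1 \<odot> x) $ m = x $ (h + m) * osg h (h + m)" for x m
    proof -
      have "axis h (1::complex) $ l * x $ (l + m) * osg l (l + m) =
          (if l = h then x $ (h + m) * osg h (h + m) else 0)" for l
        by (simp add: axis_nth_grp)
      then show ?thesis by (simp add: oct_mult_nth)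
    qed
    have 2: "(d (axis h 1) \<odot> axis k 1) $ (g + (h + k)) = mat_coeff g d h * osg (g + h) k" for g
      unfolding a by (simp add: mat_coeff_def add.assoc)
    have 3: "(axis h 1 \<odot> d (axis k 1)) $ (g + (h + k)) = mat_coeff g d k * osg h (g + k)" for g
      unfolding b by (simp add: mat_coeff_def add.left_commute[of h])
    show ?thesis unfolding * by (simp add: 1 2 3)
  qed
  then show ?thesis unfolding Der_iff_basis dcond_def by blast
qed

lemma hop_zero [simp]: "hop g (\<lambda>_. 0) = (\<lambda>_. 0)" by (auto simp: vec_eq_iff fun_eq_iff)

lemma dcond_zero [simp]: "dcond g (\<lambda>_. 0)" by (simp add: dcond_def)

lemma hop_Der_iff: "hop g c \<in> Der \<longleftrightarrow> dcond g c"
proof -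
  have "dcond k (mat_coeff k (hop g c)) \<longleftrightarrow> (k = g \<longrightarrow> dcond g c)" for k
    by (simp add: mat_coeff_hop)
  then show ?thesis unfolding Der_iff_dcond by (simp add: linear_hop)
qed

lemma hop_maps_grade: "hop g c ` oct_grade h \<subseteq> oct_grade (g + h)"
proof
  fix y assume "y \<in> hop g c ` oct_grade h"
  then obtain a where "y = hop g c (a *s axis h 1)" by (auto simp: oct_grade_def)
  then have "y = (a * c h) *s axis (g + h) 1"
    by (simp add: linear_oct_scale[OF linear_hop] hop_axis)
  then show "y \<in> oct_grade (g + h)" unfolding oct_grade_def by blast
qed

lemma Der_grade_eq: "Der_grade g = hop g ` {c. dcond g c}"
proof (intro equalityI subsetI)
  fix d assume "d \<in> Der_grade g"
  then have d: "d \<in> Der" "d = hom_part g d" by (auto simp: Der_grade_def hom_part_Der_grade)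
  then have "d = hop g (mat_coeff g d)" using hom_part_eq_hop[OF Der_linear] by metis
  then show "d \<in> hop g ` {c. dcond g c}" using d(1) unfolding Der_iff_dcond by blast
next
  fix d assume "d \<in> hop g ` {c. dcond g c}"
  then obtain c where c: "d = hop g c" "dcond g c" by blast
  then show "d \<in> Der_grade g"
    unfolding Der_grade_def using hop_maps_grade[of g c] by (simp add: hop_Der_iff)
qed

lemma hom_part_in_Der_grade: "d \<in> Der \<Longrightarrow> hom_part g d \<in> Der_grade g"
  unfolding Der_grade_eq using hom_part_eq_hop[OF Der_linear] Der_iff_dcond by blast

section \<open>Derivations of a given degree\<close>

declare gel_simps [simp del]

lemma osg_self: "g \<noteq> 0 \<Longrightarrow> osg g g = - 1"
  by (metis gel_idx gel_0 oct_sign_def)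

lemma oct_sign_0 [simp]: "oct_sign 0 j = 1" "oct_sign i 0 = 1"
  by (simp_all add: oct_sign_def)

lemma dcond_at_0: assumes "dcond g c" shows "c 0 = 0"
  using assms[unfolded dcond_def, rule_format, of 0 0] by simp

text \<open>The scalar e_g e_g is killed, while d e_g is itself a scalar, so the Leibniz rule yields
  twice that scalar times e_g.\<close>

lemma dcond_at_deg: assumes "dcond g c" shows "c g = 0"
  using assms[unfolded dcond_def, rule_format, of g g] dcond_at_0[OF assms] by simp

text \<open>For h outside {0, g} the product of e_h and e_{g+h} is plus or minus e_g, which the
  derivation kills. The two terms of the Leibniz rule contain squares of imaginary units and are -c
  h and -c (g + h).\<close>

lemma dcond_shift:
  assumes "dcond g c" "g \<noteq> 0" shows "c (g + h) = - c h"
proof -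
  consider "h = 0" | "h = g" | "h \<noteq> 0" "h \<noteq> g" by blast
  then show ?thesis
  proof cases
    case 3
    then have "g + h \<noteq> 0" by auto
    with 3 show ?thesis
      using assms(1)[unfolded dcond_def, rule_format, of h "g + h"] dcond_at_deg[OF assms(1)] assms(2)
      by (simp add: osg_self eq_neg_iff_add_eq_0 add.commute)
  qed (simp_all add: dcond_at_0[OF assms(1)] dcond_at_deg[OF assms(1)])
qed

text \<open>Row \<open>i\<close> of \<open>utab\<close> and of \<open>vtab\<close> lists the coefficients at \<open>e\<^sub>0, \<dots>, e\<^sub>7\<close> of a derivation of degree \<open>g\<^sub>i\<close>.
  The two form the basis dual to the coefficients at \<open>fone i\<close> and \<open>ftwo i\<close>.\<close>

definition utab :: "int list list" where
  "utab = [[0,0,0,0,0,0,0,0], [0,0,1,0,1,-1,0,-1], [0,1,0,0,-1,-1,1,0], [0,1,0,0,1,-1,-1,0],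
    [0,1,0,1,0,-1,0,-1], [0,1,-1,0,0,0,-1,1], [0,1,0,-1,0,1,0,-1], [0,1,0,0,-1,1,-1,0]]"

definition vtab :: "int list list" where
  "vtab = [[0,0,0,0,0,0,0,0], [0,0,0,1,1,0,-1,-1], [0,0,0,1,-1,0,1,-1], [0,0,1,0,-1,1,0,-1],
    [0,0,1,1,0,-1,-1,0], [0,0,0,1,-1,0,-1,1], [0,0,1,0,-1,-1,0,1], [0,0,1,-1,0,1,-1,0]]"

definition dsol :: "nat \<Rightarrow> complex \<Rightarrow> complex \<Rightarrow> grp \<Rightarrow> complex" where
  "dsol i a b g = of_int (utab ! i ! idx g) * a + of_int (vtab ! i ! idx g) * b"

definition fone :: "nat \<Rightarrow> nat" where "fone i = [0,2,1,1,1,1,1,1] ! i"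
definition ftwo :: "nat \<Rightarrow> nat" where "ftwo i = [0,3,3,2,2,3,2,2] ! i"

lemma dsol_gel: "m \<le> 7 \<Longrightarrow> dsol i a b (gel m) = of_int (utab ! i ! m) * a + of_int (vtab ! i ! m) * b"
  by (simp add: dsol_def)

lemma dcond_gel: "dcond (gel i) c \<longleftrightarrow> (\<forall>h\<le>7. \<forall>k\<le>7. c (gel (xo h k)) * of_int (sgn8 h k) =
    c (gel h) * of_int (sgn8 (xo i h) k) + c (gel k) * of_int (sgn8 h (xo i k)))" if "i \<le> 7"
  unfolding dcond_def all_grp_iff using that xo_le by (simp add: gel_add oct_sign_sgn8)

lemma utab_dcond: "\<forall>i\<le>7. \<forall>h\<le>7. \<forall>k\<le>7.
   utab ! i ! xo h k * sgn8 h k = utab ! i ! h * sgn8 (xo i h) k + utab ! i ! k * sgn8 h (xo i k)"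
  unfolding ball_le7_list by code_simp

lemma vtab_dcond: "\<forall>i\<le>7. \<forall>h\<le>7. \<forall>k\<le>7.
   vtab ! i ! xo h k * sgn8 h k = vtab ! i ! h * sgn8 (xo i h) k + vtab ! i ! k * sgn8 h (xo i k)"
  unfolding ball_le7_list by code_simp

lemma dcond_dsol: assumes "i \<le> 7" shows "dcond (gel i) (dsol i a b)"
  unfolding dcond_gel[OF assms]
proof (intro allI impI)
  fix h k :: nat assume hk: "h \<le> 7" "k \<le> 7"
  then have "xo h k \<le> 7" using xo_le by blast
  have u: "of_int (utab ! i ! xo h k) * of_int (sgn8 h k) =
      (of_int (utab ! i ! h) * of_int (sgn8 (xo i h) k) + of_int (utab ! i ! k) * of_int (sgn8 h (xo i k)) :: complex)"
    using utab_dcond assms hk by (metis of_int_mult of_int_add)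
  have v: "of_int (vtab ! i ! xo h k) * of_int (sgn8 h k) =
      (of_int (vtab ! i ! h) * of_int (sgn8 (xo i h) k) + of_int (vtab ! i ! k) * of_int (sgn8 h (xo i k)) :: complex)"
    using vtab_dcond assms hk by (metis of_int_mult of_int_add)
  show "dsol i a b (gel (xo h k)) * of_int (sgn8 h k) =
    dsol i a b (gel h) * of_int (sgn8 (xo i h) k) + dsol i a b (gel k) * of_int (sgn8 h (xo i k))"
    using arg_cong2[OF u v, of "\<lambda>x y. a * x + b * y"] hk \<open>xo h k \<le> 7\<close>
    by (simp add: dsol_gel algebra_simps)
qed

lemma dcond_0_iff: "dcond 0 c \<longleftrightarrow> c = (\<lambda>_. 0)"
proof
  assume d: "dcond 0 c"
  have "c h = 0" for h
  proof (cases "h = 0")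
    case False
    then show ?thesis using d[unfolded dcond_def, rule_format, of h h] dcond_at_0[OF d]
      by (simp add: osg_self)
  qed (simp add: dcond_at_0[OF d])
  then show "c = (\<lambda>_. 0)" by blast
qed simp

text \<open>The indices \<open>fone i\<close>, \<open>ftwo i\<close> and their sum form a line
  avoiding i and represent the three pairs {h, i + h}. The Leibniz rule on that line, multiplied by
  its own sign, expresses the coefficient at the sum through the other two.\<close>

lemma rel_tab: "\<forall>i\<le>7. i \<noteq> 0 \<longrightarrow> fone i \<le> 7 \<and> ftwo i \<le> 7 \<and> sgn8 (fone i) (ftwo i) * sgn8 (fone i) (ftwo i) = 1 \<and>
   utab ! i ! xo (fone i) (ftwo i) = sgn8 (xo i (fone i)) (ftwo i) * sgn8 (fone i) (ftwo i) \<and>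
   vtab ! i ! xo (fone i) (ftwo i) = sgn8 (fone i) (xo i (ftwo i)) * sgn8 (fone i) (ftwo i)"
  unfolding ball_le7_list by code_simp

text \<open>The third parameter of a derivation of degree \<open>g\<close> is determined by one relation coming from
  a line of the Fano plane avoiding \<open>g\<close>.\<close>

lemma dcond_imp_dsol:
  assumes "1 \<le> i" "i \<le> 7" "dcond (gel i) c"
  shows "c = dsol i (c (gel (fone i))) (c (gel (ftwo i)))"
proof -
  have g0: "gel i \<noteq> 0" using assms gel_inj[of i 0] gel_0 by fastforce
  have s: "c (gel (xo i h)) = - c (gel h)" if "h \<le> 7" for h
    using dcond_shift[OF assms(3) g0, of "gel h"] that assms by (simp add: gel_add)
  have z: "c (gel 0) = 0" "c (gel i) = 0"
    using dcond_at_0[OF assms(3)] dcond_at_deg[OF assms(3)] by (simp_all add: gel_0)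
  note E = assms(3)[unfolded dcond_gel[OF assms(2)], rule_format]
  let ?j = "fone i" and ?k = "ftwo i"
  have le: "?j \<le> 7" "?k \<le> 7" and sq: "sgn8 ?j ?k * sgn8 ?j ?k = 1"
    and uv: "utab ! i ! xo ?j ?k = sgn8 (xo i ?j) ?k * sgn8 ?j ?k"
      "vtab ! i ! xo ?j ?k = sgn8 ?j (xo i ?k) * sgn8 ?j ?k"
    using rel_tab assms by auto
  have "c (gel (xo ?j ?k)) = c (gel (xo ?j ?k)) * of_int (sgn8 ?j ?k * sgn8 ?j ?k)"
    by (simp add: sq)
  also have "\<dots> = (c (gel (xo ?j ?k)) * of_int (sgn8 ?j ?k)) * of_int (sgn8 ?j ?k)"
    by simp
  also have "\<dots> = of_int (utab ! i ! xo ?j ?k) * c (gel ?j) + of_int (vtab ! i ! xo ?j ?k) * c (gel ?k)"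
    unfolding E[OF le] uv by (simp add: algebra_simps)
  finally have r: "c (gel (xo ?j ?k)) = of_int (utab ! i ! xo ?j ?k) * c (gel ?j) +
      of_int (vtab ! i ! xo ?j ?k) * c (gel ?k)" .
  \<comment> \<open>The coefficients at 0 and at i vanish, and the other six indices fall into three
    pairs {h, i + h} with opposite values; so the three values related by \<open>r\<close> determine
    all of them.\<close>
  have "i \<in> {1,2,3,4,5,6,7}" using assms by auto
  with r
  have "\<forall>m\<le>7. c (gel m) = of_int (utab ! i ! m) * c (gel (fone i)) + of_int (vtab ! i ! m) * c (gel (ftwo i))"
    unfolding ball_le7
    using z s[of "fone i"] s[of "ftwo i"] s[of "xo (fone i) (ftwo i)"]
    by (elim insertE emptyE; hypsubst)
       (simp_all add: xo_def xtab_def utab_def vtab_def fone_def ftwo_def)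
  then show ?thesis
    by (auto simp: fun_eq_iff all_grp_iff dsol_gel)
qed

section \<open>Brackets of homogeneous derivations in terms of coefficients\<close>

definition kom :: "grp \<Rightarrow> grp \<Rightarrow> (grp \<Rightarrow> complex) \<Rightarrow> (grp \<Rightarrow> complex) \<Rightarrow> grp \<Rightarrow> complex" where
  "kom g h c c' m = c (h + m) * c' m - c' (g + m) * c m"

lemma commutator_hop: "commutator (hop g c) (hop h c') = hop (g + h) (kom g h c c')"
proof -
  have "h + (g + (h + k)) = g + k" for k by (metis add.left_commute grp_add_cancel(1))
  then show ?thesis
    by (simp add: fun_eq_iff vec_eq_iff commutator_def kom_def add_ac algebra_simps)
qed

lemma kom_gel: "i \<le> 7 \<Longrightarrow> j \<le> 7 \<Longrightarrow> m \<le> 7 \<Longrightarrow> kom (gel i) (gel j) c c' (gel m) =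
    c (gel (xo j m)) * c' (gel m) - c' (gel (xo i m)) * c (gel m)"
  by (simp add: kom_def gel_add)

text \<open>In degree g both coefficient functions change sign under the shift by g, so the two
  products in the bracket cancel: each component is abelian.\<close>

lemma kom_same: assumes "dcond g c" "dcond g c'" shows "kom g g c c' = (\<lambda>_. 0)"
proof (cases "g = 0")
  case True
  then show ?thesis using assms by (simp add: dcond_0_iff fun_eq_iff kom_def)
next
  case False
  then show ?thesis using dcond_shift[OF assms(1)] dcond_shift[OF assms(2)] by (simp add: fun_eq_iff kom_def)
qed

text \<open>One test derivation per degree, with coordinates (2, 1). It is integral, so that
  brackets can be evaluated, and generic enough for all the nonvanishing statements below.\<close>

definition wit :: "nat \<Rightarrow> nat \<Rightarrow> int" where "wit i m = 2 * utab ! i ! m + vtab ! i ! m"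
definition ikom :: "nat \<Rightarrow> nat \<Rightarrow> (nat \<Rightarrow> int) \<Rightarrow> (nat \<Rightarrow> int) \<Rightarrow> nat \<Rightarrow> int" where
  "ikom i j c c' m = c (xo j m) * c' m - c' (xo i m) * c m"

definition wder :: "nat \<Rightarrow> grp \<Rightarrow> complex" where "wder i g = of_int (wit i (idx g))"

lemma wder_eq: "wder i = dsol i 2 1" by (simp add: fun_eq_iff wder_def wit_def dsol_def)

lemma dcond_wder: "i \<le> 7 \<Longrightarrow> dcond (gel i) (wder i)"
  by (simp add: wder_eq dcond_dsol)

lemma kom_of_int:
  "i \<le> 7 \<Longrightarrow> j \<le> 7 \<Longrightarrow> kom (gel i) (gel j) (\<lambda>g. of_int (u (idx g))) (\<lambda>g. of_int (v (idx g))) =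
    (\<lambda>g. of_int (ikom i j u v (idx g)))"
  by (simp add: fun_eq_iff kom_def ikom_def idx_add)

lemma ikom_nonzero:
  "\<forall>i\<le>7. \<forall>j\<le>7. i \<noteq> j \<and> i \<noteq> 0 \<and> j \<noteq> 0 \<longrightarrow> \<not> list_all (\<lambda>m. ikom i j (wit i) (wit j) m = 0) [0,1,2,3,4,5,6,7]"
  unfolding ball_le7_list by code_simp

definition jac :: "nat \<Rightarrow> nat \<Rightarrow> nat \<Rightarrow> nat \<Rightarrow> int" where
  "jac i j k = ikom i (xo j k) (wit i) (ikom j k (wit j) (wit k))"

definition gen_triples :: "(nat \<times> nat \<times> nat) list" where
  "gen_triples = [(1,2,3), (1,2,4), (1,2,6), (1,2,7), (1,3,4), (1,3,5), (1,3,7), (1,4,5),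
    (1,4,6), (1,5,6), (1,5,7), (1,6,7), (2,3,4), (2,3,5), (2,3,6), (2,4,5), (2,4,7), (2,5,6),
    (2,5,7), (2,6,7), (3,4,6), (3,4,7), (3,5,6), (3,5,7), (3,6,7), (4,5,6), (4,5,7), (4,6,7)]"

text \<open>A nonzero 2 x 2 minor, taken at two of the basis vectors e_1, e_2, e_3, proves that two
  of the three nested brackets in the Jacobi identity are linearly independent. The list holds the
  28 unordered generative triples: 35 triples minus 7 lines.\<close>

lemma jac_independent:
  "list_all (\<lambda>(i, j, k). list_ex (\<lambda>(m, n). jac i j k m * jac j k i n \<noteq> jac i j k n * jac j k i m)
      [(1,2), (1,3), (2,3)]) gen_triples"
  by code_simp

lemma gen_triples_complete:
  "\<forall>i\<le>7. \<forall>j\<le>7. \<forall>k\<le>7. i \<noteq> 0 \<and> i < j \<and> j < k \<and> k \<noteq> xo i j \<longrightarrow> (i, j, k) \<in> set gen_triples"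
  unfolding ball_le7_list by code_simp

lemma kom_wder_nonzero:
  assumes "i \<in> {1..7}" "j \<in> {1..7}" "i \<noteq> j"
  shows "kom (gel i) (gel j) (wder i) (wder j) \<noteq> (\<lambda>_. 0)"
proof
  have ij: "i \<le> 7" "j \<le> 7" using assms by auto
  assume "kom (gel i) (gel j) (wder i) (wder j) = (\<lambda>_. 0)"
  then have "ikom i j (wit i) (wit j) (idx g) = 0" for g
    unfolding wder_def[abs_def] kom_of_int[OF ij] by (metis of_int_eq_0_iff)
  from this[of "gel _"] have "ikom i j (wit i) (wit j) m = 0" if "m \<le> 7" for m
    using that by (metis idx_gel)
  then show False using ikom_nonzero[rule_format, OF ij] assms by simp
qed

lemma jac_wder:
  assumes "i \<le> 7" "j \<le> 7" "k \<le> 7"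
  shows "kom (gel i) (gel j + gel k) (wder i) (kom (gel j) (gel k) (wder j) (wder k)) =
    (\<lambda>g. of_int (jac i j k (idx g)))"
proof -
  have "xo j k \<le> 7" using assms xo_le by blast
  then show ?thesis unfolding wder_def[abs_def] jac_def
    by (simp only: gel_add[OF assms(2,3)] kom_of_int[OF assms(2,3)] kom_of_int[OF assms(1)])
qed

lemma kom_jacobi:
  "kom g (h + k) c (kom h k c' c'') m + kom h (k + g) c' (kom k g c'' c) m +
   kom k (g + h) c'' (kom g h c c') m = 0"
  by (simp add: kom_def add_ac algebra_simps)

lemma generative_scalars:
  assumes "1 \<le> i" "i < j" "j < k" "k \<le> 7" "k \<noteq> xo i j"
    and "\<And>g. \<alpha> * kom (gel i) (gel j + gel k) (wder i) (kom (gel j) (gel k) (wder j) (wder k)) g +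
         \<beta> * kom (gel j) (gel k + gel i) (wder j) (kom (gel k) (gel i) (wder k) (wder i)) g +
         \<gamma> * kom (gel k) (gel i + gel j) (wder k) (kom (gel i) (gel j) (wder i) (wder j)) g = 0"
  shows "\<alpha> = \<beta> \<and> \<beta> = \<gamma>"
proof -
  have le: "i \<le> 7" "j \<le> 7" "k \<le> 7" using assms by auto
  note J = jac_wder[OF le] jac_wder[OF le(2,3,1)] jac_wder[OF le(3,1,2)]
  define A where "A g = (of_int (jac i j k (idx g)) :: complex)" for g
  define B where "B g = (of_int (jac j k i (idx g)) :: complex)" for g
  define C where "C g = (of_int (jac k i j (idx g)) :: complex)" for g
  \<comment> \<open>The Jacobi identity of the uncontracted algebra eliminates the third term,
    leaving a relation between the two independent ones.\<close>
  have C: "C g = - A g - B g" for g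
    using kom_jacobi[of "gel i" "gel j" "gel k" "wder i" "wder j" "wder k" g]
    unfolding J A_def B_def C_def by (simp add: eq_neg_iff_add_eq_0 algebra_simps)
  have z: "(\<alpha> - \<gamma>) * A g + (\<beta> - \<gamma>) * B g = 0" for g
    using assms(6)[of g] unfolding J A_def[symmetric] B_def[symmetric] C_def[symmetric] C
    by (simp add: algebra_simps)
  have "(i, j, k) \<in> set gen_triples" using gen_triples_complete le assms by auto
  with jac_independent have "list_ex (\<lambda>(m, n). jac i j k m * jac j k i n \<noteq> jac i j k n * jac j k i m)
      [(1,2), (1,3), (2,3)]"
    unfolding list_all_iff by blast
  then obtain m n where mn: "m \<le> 7" "n \<le> 7" "jac i j k m * jac j k i n \<noteq> jac i j k n * jac j k i m"
    using that[of 1 2] that[of 1 3] that[of 2 3] by auto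
  have "of_int (jac i j k m * jac j k i n) \<noteq> (of_int (jac i j k n * jac j k i m) :: complex)"
    using mn(3) by (simp only: of_int_eq_iff not_False_eq_True)
  then have ne: "A (gel m) * B (gel n) - A (gel n) * B (gel m) \<noteq> 0"
    using mn by (simp add: A_def B_def)
  \<comment> \<open>Cramer's rule for the two equations at m and n.\<close>
  have "(\<alpha> - \<gamma>) * (A (gel m) * B (gel n) - A (gel n) * B (gel m)) = 0"
       "(\<beta> - \<gamma>) * (A (gel m) * B (gel n) - A (gel n) * B (gel m)) = 0"
    using z[of "gel m"] z[of "gel n"] by algebra+
  with ne show ?thesis by auto
qed

section \<open>The square of ad x on the components, for x of degree g_1\<close>

text \<open>\<open>trq j a b\<close> is the trace of \<open>(ad x)\<^sup>2\<close> on the component of degree \<open>g\<^sub>j\<close>, where \<open>x\<close> has degree \<open>g\<^sub>1\<close> and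
  coordinates \<open>a\<close>, \<open>b\<close>.\<close>

definition trq :: "nat \<Rightarrow> complex \<Rightarrow> complex \<Rightarrow> complex" where
  "trq j a b = (if j \<in> {2,5} then - 2 * a\<^sup>2 - 4 * a * b - 4 * b\<^sup>2
    else if j \<in> {3,6} then - 4 * a\<^sup>2 - 4 * a * b - 2 * b\<^sup>2 else - 2 * a\<^sup>2 - 2 * b\<^sup>2)"

lemma dsol_eqI:
  assumes "\<forall>m\<le>7. f (gel m) = of_int (utab ! i ! m) * a + of_int (vtab ! i ! m) * b"
  shows "f = dsol i a b"
proof
  fix g show "f g = dsol i a b g"
    using assms[rule_format, of "idx g"] idx_le[of g] by (simp add: dsol_def)
qed

text \<open>The matrix is triangular for j in 2..7: the first coordinate p is the coefficient at
  e_1, and x kills e_1, so the double bracket applied to e_1 is x x y e_1, which depends on p alone.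
  The factor m + r is the trace.\<close>

lemma ad_sq_dsol:
  assumes "j \<in> {2..7}"
  shows "\<exists>m n r. m + r = trq j a b \<and> (\<forall>p q.
    kom (gel 1) (gel (xo 1 j)) (dsol 1 a b) (kom (gel 1) (gel j) (dsol 1 a b) (dsol j p q)) =
    dsol j (m * p) (n * p + r * q))"
proof -
  have "j \<in> {2,3,4,5,6,7}" using assms by auto
  then consider "j = 2 \<or> j = 5" | "j = 3 \<or> j = 6" | "j = 4 \<or> j = 7" by blast
  then show ?thesis
  proof cases
    case 1
    show ?thesis
      \<comment> \<open>In the three cases m and r are minus the squares of a and a + 2b, of b and
        2a + b, of a + b and a - b: up to a factor i, the short and the long roots of G_2 in
        orthogonal pairs.\<close>
      by (rule exI[of _ "- a\<^sup>2"], rule exI[of _ "- 2 * a * b - 2 * b\<^sup>2"], rule exI[of _ "- a\<^sup>2 - 4 * a * b - 4 * b\<^sup>2"])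
        (insert 1; elim disjE; hypsubst; rule conjI; (rule allI, rule allI, rule dsol_eqI)?;
         simp add: trq_def ball_le7 xo_def xtab_def kom_gel dsol_gel utab_def vtab_def algebra_simps power2_eq_square)
  next
    case 2
    show ?thesis
      by (rule exI[of _ "- b\<^sup>2"], rule exI[of _ "2 * a\<^sup>2 + 2 * a * b"], rule exI[of _ "- 4 * a\<^sup>2 - 4 * a * b - b\<^sup>2"])
        (insert 2; elim disjE; hypsubst; rule conjI; (rule allI, rule allI, rule dsol_eqI)?;
         simp add: trq_def ball_le7 xo_def xtab_def kom_gel dsol_gel utab_def vtab_def algebra_simps power2_eq_square)
  next
    case 3
    show ?thesis
      by (rule exI[of _ "- a\<^sup>2 - 2 * a * b - b\<^sup>2"], rule exI[of _ "2 * a * b"], rule exI[of _ "- a\<^sup>2 + 2 * a * b - b\<^sup>2"])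
        (insert 3; elim disjE; hypsubst; rule conjI; (rule allI, rule allI, rule dsol_eqI)?;
         simp add: trq_def ball_le7 xo_def xtab_def kom_gel dsol_gel utab_def vtab_def algebra_simps power2_eq_square)
  qed
qed

section \<open>Contracted brackets\<close>

lemma commutator_in_Der:
  assumes "d \<in> Der" "d' \<in> Der" shows "commutator d d' \<in> Der"
proof -
  interpret d: Vector_Spaces.linear "(*s)" "(*s)" d using assms Der_linear by blast
  interpret d': Vector_Spaces.linear "(*s)" "(*s)" d' using assms Der_linear by blast
  have "Vector_Spaces.linear (*s) (*s) (commutator d d')"
    by unfold_locales
      (simp_all add: commutator_def d.add d'.add d.scale d'.scale vec.scale_right_diff_distrib)
  moreover have "commutator d d' (x \<odot> y) = commutator d d' x \<odot> y + x \<odot> commutator d d' y" for x y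
  proof -
    have m: "(a - b) \<odot> c = a \<odot> c - b \<odot> c" "c \<odot> (a - b) = c \<odot> a - c \<odot> b" for a b c
      using oct_mult_add(1)[of "a - b" b c] oct_mult_add(2)[of c "a - b" b] by (auto simp: algebra_simps)
    show ?thesis using assms by (simp add: commutator_def Der_def d.add d'.add m)
  qed
  ultimately show ?thesis by (simp add: Der_def)
qed

lemma Der_gradeE:
  assumes "x \<in> Der_grade g" obtains c where "x = hop g c" "dcond g c"
  using assms unfolding Der_grade_eq by blast

lemma Der_gradeD: "x \<in> Der_grade g \<Longrightarrow> x \<in> Der"
  by (simp add: Der_grade_def)

lemma hop_in_Der_grade: "dcond g c \<Longrightarrow> hop g c \<in> Der_grade g"
  unfolding Der_grade_eq by blast

lemma commutator_in_Der_grade: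
  assumes "x \<in> Der_grade g" "y \<in> Der_grade h" shows "commutator x y \<in> Der_grade (g + h)"
proof -
  obtain c c' where c: "x = hop g c" "y = hop h c'" using assms by (elim Der_gradeE)
  have "commutator x y \<in> Der" using assms by (intro commutator_in_Der Der_gradeD)
  then show ?thesis unfolding c commutator_hop by (simp add: hop_Der_iff hop_in_Der_grade)
qed

lemma commutator_same_grade:
  assumes "x \<in> Der_grade g" "y \<in> Der_grade g" shows "commutator x y = 0"
proof -
  obtain c c' where "x = hop g c" "y = hop g c'" "dcond g c" "dcond g c'"
    using assms by (elim Der_gradeE)
  then show ?thesis by (simp add: commutator_hop kom_same zero_fun_def)
qed

lemma Der_grade_0: "Der_grade 0 = {0}"
  by (auto simp: Der_grade_eq dcond_0_iff)

lemma zero_in_Der_grade: "0 \<in> Der_grade g"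
  using hop_in_Der_grade[OF dcond_zero, of g] by (simp add: zero_fun_def)

lemma scaleE_add: "scaleE c (x + y) = scaleE c x + scaleE c y"
  by (simp add: endo.scale_right_distrib)

lemma hop_add: "hop g c + hop g c' = hop g (\<lambda>h. c h + c' h)"
  by (simp add: fun_eq_iff vec_eq_iff algebra_simps)

lemma hop_scale: "scaleE a (hop g c) = hop g (\<lambda>h. a * c h)"
  by (simp add: fun_eq_iff vec_eq_iff scaleE_def algebra_simps)

lemma dcond_scale: "dcond g c \<Longrightarrow> dcond g (\<lambda>h. a * c h)"
  unfolding dcond_def by (metis (no_types, lifting) distrib_left mult.assoc)

lemma Der_grade_scale: "x \<in> Der_grade g \<Longrightarrow> scaleE a x \<in> Der_grade g"
  by (elim Der_gradeE) (simp add: hop_scale dcond_scale hop_in_Der_grade)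

lemma Der_add: "x \<in> Der \<Longrightarrow> y \<in> Der \<Longrightarrow> x + y \<in> Der"
proof -
  assume *: "x \<in> Der" "y \<in> Der"
  interpret x: Vector_Spaces.linear "(*s)" "(*s)" x using * Der_linear by blast
  interpret y: Vector_Spaces.linear "(*s)" "(*s)" y using * Der_linear by blast
  have "Vector_Spaces.linear (*s) (*s) (x + y)"
    by unfold_locales (simp_all add: x.add y.add x.scale y.scale vec.scale_right_distrib)
  with * show ?thesis by (simp add: Der_def oct_mult_add add_ac)
qed

lemma Der_scale: "x \<in> Der \<Longrightarrow> scaleE a x \<in> Der"
proof -
  assume *: "x \<in> Der"
  interpret x: Vector_Spaces.linear "(*s)" "(*s)" x using * Der_linear by blast
  have "Vector_Spaces.linear (*s) (*s) (scaleE a x)"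
    by unfold_locales (simp_all add: scaleE_def x.add x.scale vec.scale_right_distrib vec.scale_left_commute)
  with * show ?thesis by (simp add: Der_def scaleE_def oct_mult_scale vec.scale_right_distrib)
qed

lemma zero_in_Der: "0 \<in> Der"
  using zero_in_Der_grade Der_gradeD by blast

lemma Der_sum: "(\<And>i. i \<in> A \<Longrightarrow> f i \<in> Der) \<Longrightarrow> sum f A \<in> Der"
  by (induction A rule: infinite_finite_induct) (simp_all add: zero_in_Der Der_add)

lemma subspace_Der: "endo.subspace Der"
  by (intro endo.subspaceI zero_in_Der Der_add Der_scale)

lemma oct_proj_add: "oct_proj g (x + y) = oct_proj g x + oct_proj g y"
  by (simp add: oct_proj_def vec.scale_left_distrib)

lemma hom_part_add: "hom_part g (x + y) = hom_part g x + hom_part g y"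
  by (simp add: fun_eq_iff hom_part_def oct_proj_add sum.distrib)

lemma hom_part_scale: "hom_part g (scaleE a x) = scaleE a (hom_part g x)"
  by (simp add: fun_eq_iff hom_part_def oct_proj_def scaleE_def vec.scale_sum_right)

lemma commutator_add:
  assumes "z \<in> Der"
  shows "commutator (x + y) z = commutator x z + commutator y z"
    and "commutator z (x + y) = commutator z x + commutator z y"
proof -
  interpret z: Vector_Spaces.linear "(*s)" "(*s)" z using assms Der_linear by blast
  show "commutator (x + y) z = commutator x z + commutator y z"
    "commutator z (x + y) = commutator z x + commutator z y"
    by (simp_all add: fun_eq_iff commutator_def z.add algebra_simps)
qed

lemma commutator_scale:
  assumes "z \<in> Der"
  shows "commutator (scaleE a x) z = scaleE a (commutator x z)"
    and "commutator z (scaleE a x) = scaleE a (commutator z x)"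
proof -
  interpret z: Vector_Spaces.linear "(*s)" "(*s)" z using assms Der_linear by blast
  show "commutator (scaleE a x) z = scaleE a (commutator x z)"
    "commutator z (scaleE a x) = scaleE a (commutator z x)"
    by (simp_all add: fun_eq_iff commutator_def scaleE_def z.scale vec.scale_right_diff_distrib)
qed

lemma commutator_swap: "commutator x y = - commutator y x"
  by (simp add: fun_eq_iff commutator_def)

lemma hom_part_in_Der: "d \<in> Der \<Longrightarrow> hom_part g d \<in> Der"
  using hom_part_in_Der_grade Der_gradeD by blast

lemma contr_bracket_in_Der: "x \<in> Der \<Longrightarrow> y \<in> Der \<Longrightarrow> contr_bracket \<epsilon> x y \<in> Der"
  unfolding contr_bracket_def by (intro Der_sum Der_scale commutator_in_Der hom_part_in_Der)

lemma contr_bracket_add: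
  assumes "z \<in> Der"
  shows "contr_bracket \<epsilon> (x + y) z = contr_bracket \<epsilon> x z + contr_bracket \<epsilon> y z"
    and "contr_bracket \<epsilon> z (x + y) = contr_bracket \<epsilon> z x + contr_bracket \<epsilon> z y"
  using assms unfolding contr_bracket_def hom_part_add
  by (simp_all add: commutator_add hom_part_in_Der scaleE_add sum.distrib)

lemma contr_bracket_scale:
  assumes "z \<in> Der"
  shows "contr_bracket \<epsilon> (scaleE a x) z = scaleE a (contr_bracket \<epsilon> x z)"
    and "contr_bracket \<epsilon> z (scaleE a x) = scaleE a (contr_bracket \<epsilon> z x)"
  using assms unfolding contr_bracket_def hom_part_scale
  by (simp_all add: commutator_scale hom_part_in_Der endo.scale_sum_right mult.commute[of a])

text \<open>Used to extend identities from homogeneous derivations to all of them, one argument at a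
  time.\<close>

lemma Der_additive_zero:
  fixes f :: "(oct \<Rightarrow> oct) \<Rightarrow> 'v::ab_group_add"
  assumes add: "\<And>x y. x \<in> Der \<Longrightarrow> y \<in> Der \<Longrightarrow> f (x + y) = f x + f y"
    and hom: "\<And>g x. x \<in> Der_grade g \<Longrightarrow> f x = 0"
    and x: "x \<in> Der"
  shows "f x = 0"
proof -
  have f0: "f 0 = 0" using hom[OF zero_in_Der_grade] .
  have "f (sum (\<lambda>g. hom_part g x) A) = (\<Sum>g\<in>A. f (hom_part g x))" for A
    using x by (induction A rule: infinite_finite_induct) (simp_all add: f0 add hom_part_in_Der Der_sum)
  then have "f x = (\<Sum>g\<in>UNIV. f (hom_part g x))"
    using hom_part_sum[OF x] by metis
  also have "\<dots> = 0" using hom[OF hom_part_in_Der_grade[OF x]] by (simp add: sum.neutral)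
  finally show ?thesis .
qed

section \<open>Equivalence\<close>

text \<open>Glues isomorphisms between components into one map. The permutation
  \<open>\<sigma>\<close> of degrees is not assumed additive: additivity fails for the equivalence
  of \<open>T_set 8\<close> with \<open>T_set 10\<close>, which is obtained here as well.\<close>

lemma gc_equivI:
  fixes F :: "grp \<Rightarrow> (oct \<Rightarrow> oct) \<Rightarrow> (oct \<Rightarrow> oct)"
  assumes \<sigma>: "bij \<sigma>"
    and bij: "\<And>g. bij_betw (F g) (Der_grade g) (Der_grade (\<sigma> g))"
    and add: "\<And>g x y. x \<in> Der_grade g \<Longrightarrow> y \<in> Der_grade g \<Longrightarrow> F g (x + y) = F g x + F g y"
    and scale: "\<And>g c x. x \<in> Der_grade g \<Longrightarrow> F g (scaleE c x) = scaleE c (F g x)"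
    and hom: "\<And>g h x y. x \<in> Der_grade g \<Longrightarrow> y \<in> Der_grade h \<Longrightarrow>
      F (g + h) (scaleE (\<epsilon> g h) (commutator x y)) =
      scaleE (\<epsilon>' (\<sigma> g) (\<sigma> h)) (commutator (F g x) (F h y))"
  shows "gc_equiv \<epsilon> \<epsilon>'"
proof -
  define \<phi> where "\<phi> = (\<lambda>x. \<Sum>g\<in>UNIV. F g (hom_part g x))"
  have F0: "F g 0 = 0" for g using scale[OF zero_in_Der_grade, of g 0] by simp
  have Fin: "F g x \<in> Der_grade (\<sigma> g)" if "x \<in> Der_grade g" for g x
    using bij_betw_imp_surj_on[OF bij] that by blast
  have sig: "\<sigma> g = \<sigma> h \<longleftrightarrow> g = h" for g h using \<sigma> by (simp add: bij_def inj_eq)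
  have \<phi>_hom: "\<phi> x = F g x" if "x \<in> Der_grade g" for g x
  proof -
    have "\<phi> x = (\<Sum>k\<in>UNIV. if k = g then F g x else 0)"
      unfolding \<phi>_def hom_part_Der_grade[OF that] by (rule sum.cong) (simp_all add: F0)
    then show ?thesis by simp
  qed
  have \<phi>_in: "\<phi> x \<in> Der" if "x \<in> Der" for x
    unfolding \<phi>_def using that by (intro Der_sum) (metis Der_gradeD Fin hom_part_in_Der_grade)
  have \<phi>_add: "\<phi> (x + y) = \<phi> x + \<phi> y" if "x \<in> Der" "y \<in> Der" for x y
    unfolding \<phi>_def using that by (simp add: hom_part_add add hom_part_in_Der_grade sum.distrib)
  have \<phi>_scale: "\<phi> (scaleE c x) = scaleE c (\<phi> x)" if "x \<in> Der" for c x
    unfolding \<phi>_def using that by (simp add: hom_part_scale scale hom_part_in_Der_grade endo.scale_sum_right)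
  have hp0: "hom_part k 0 = 0" for k
    using hom_part_scale[of k 0 0] by (simp only: endo.scale_zero_left)
  have hp_sum: "hom_part k (sum f A) = (\<Sum>i\<in>A. hom_part k (f i))" for k A and f :: "grp \<Rightarrow> oct \<Rightarrow> oct"
  proof (induction A rule: infinite_finite_induct)
    case (infinite A)
    show ?case unfolding sum.infinite[OF infinite] by (rule hp0)
  next
    case empty
    show ?case unfolding sum.empty by (rule hp0)
  next
    case (insert a A)
    then show ?case by (simp only: sum.insert hom_part_add if_False insert.hyps)
  qed
  \<comment> \<open>Since \<open>\<sigma>\<close> is injective, the part of degree
    \<open>\<sigma> g\<close> of the image comes from the part of degree g alone; this gives
    injectivity componentwise.\<close>
  have \<phi>_part: "hom_part (\<sigma> g) (\<phi> x) = F g (hom_part g x)" if "x \<in> Der" for x g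
  proof -
    have "hom_part (\<sigma> g) (F k (hom_part k x)) = (if k = g then F g (hom_part g x) else 0)" for k
      using hom_part_Der_grade[OF Fin[OF hom_part_in_Der_grade[OF that]], of "\<sigma> g" k]
      by (simp add: sig eq_commute[of g])
    then show ?thesis unfolding \<phi>_def by (simp add: hp_sum)
  qed
  have "inj_on \<phi> Der"
  proof (rule inj_onI)
    fix x y assume xy: "x \<in> Der" "y \<in> Der" "\<phi> x = \<phi> y"
    have "hom_part g x = hom_part g y" for g
    proof (rule inj_onD[OF bij_betw_imp_inj_on[OF bij[of g]]])
      show "F g (hom_part g x) = F g (hom_part g y)"
        using \<phi>_part[OF xy(1), of g] \<phi>_part[OF xy(2), of g] xy(3) by simp
    qed (use xy hom_part_in_Der_grade in auto)
    then have "(\<Sum>g\<in>UNIV. hom_part g x) = (\<Sum>g\<in>UNIV. hom_part g y)" by (simp only:)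
    then show "x = y" unfolding hom_part_sum[OF xy(1)] hom_part_sum[OF xy(2)] .
  qed
  moreover have "y \<in> \<phi> ` Der" if y: "y \<in> Der" for y
  proof -
    have "\<forall>g. \<exists>x. x \<in> Der_grade g \<and> F g x = hom_part (\<sigma> g) y"
    proof
      fix g
      have "hom_part (\<sigma> g) y \<in> F g ` Der_grade g"
        unfolding bij_betw_imp_surj_on[OF bij] by (rule hom_part_in_Der_grade[OF y])
      then show "\<exists>x. x \<in> Der_grade g \<and> F g x = hom_part (\<sigma> g) y" by (elim imageE) auto
    qed
    from choice[OF this] obtain X where X: "X g \<in> Der_grade g" "F g (X g) = hom_part (\<sigma> g) y" for g
      by blast
    have XD: "X g \<in> Der" for g using X(1) Der_gradeD by blast
    have \<phi>0: "\<phi> 0 = 0" unfolding \<phi>_hom[OF zero_in_Der_grade[of 0]] by (rule F0)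
    have "\<phi> (sum X A) = (\<Sum>g\<in>A. F g (X g))" for A
    proof (induction A rule: infinite_finite_induct)
      case (insert a A)
      show ?case
        unfolding sum.insert[OF insert.hyps] \<phi>_add[OF XD Der_sum[OF XD]] insert.IH \<phi>_hom[OF X(1)] ..
    next
      case (infinite A)
      show ?case unfolding sum.infinite[OF infinite] by (rule \<phi>0)
    next
      case empty
      show ?case unfolding sum.empty by (rule \<phi>0)
    qed
    then have "\<phi> (sum X UNIV) = (\<Sum>g\<in>UNIV. hom_part (\<sigma> g) y)" by (simp add: X(2))
    also have "\<dots> = (\<Sum>g\<in>UNIV. hom_part g y)" by (rule sum.reindex_bij_betw[OF \<sigma>])
    also have "\<dots> = y" by (rule hom_part_sum[OF y])
    finally show ?thesis using XD by (metis Der_sum imageI)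
  qed
  ultimately have bij\<phi>: "bij_betw \<phi> Der Der"
    unfolding bij_betw_def using \<phi>_in by blast
  have \<phi>_minus: "\<phi> (x - y) = \<phi> x - \<phi> y" if "x \<in> Der" "y \<in> Der" for x y
  proof -
    have "x - y = x + scaleE (-1) y" by simp
    then show ?thesis using that by (simp only: \<phi>_add \<phi>_scale Der_scale) simp
  qed
  have hom0: "\<phi> (contr_bracket \<epsilon> x y) = contr_bracket \<epsilon>' (\<phi> x) (\<phi> y)" if "x \<in> Der_grade g" "y \<in> Der_grade h" for g h x y
  proof -
    have "scaleE (\<epsilon> g h) (commutator x y) \<in> Der_grade (g + h)"
      using that by (intro Der_grade_scale commutator_in_Der_grade)
    then show ?thesis
      unfolding contr_bracket_homogeneous[OF that] \<phi>_hom[OF that(1)] \<phi>_hom[OF that(2)]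
        contr_bracket_homogeneous[OF Fin[OF that(1)] Fin[OF that(2)]]
      using hom[OF that] \<phi>_hom by metis
  qed
  \<comment> \<open>The defect of compatibility with the brackets is additive in each argument and
    vanishes on homogeneous pairs; it is killed in the second argument and then in the
    first.\<close>
  have hom1: "\<phi> (contr_bracket \<epsilon> x y) - contr_bracket \<epsilon>' (\<phi> x) (\<phi> y) = 0"
    if x: "x \<in> Der_grade g" and y: "y \<in> Der" for g x y
    by (rule Der_additive_zero[OF _ _ y, of "\<lambda>y. \<phi> (contr_bracket \<epsilon> x y) - contr_bracket \<epsilon>' (\<phi> x) (\<phi> y)"])
       (use x hom0[OF x] in \<open>simp_all add: contr_bracket_add \<phi>_add contr_bracket_in_Der Der_gradeD \<phi>_in\<close>)
  have hom2: "\<phi> (contr_bracket \<epsilon> x y) - contr_bracket \<epsilon>' (\<phi> x) (\<phi> y) = 0"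
    if x: "x \<in> Der" and y: "y \<in> Der" for x y
  proof (rule Der_additive_zero[OF _ _ x, of "\<lambda>x. \<phi> (contr_bracket \<epsilon> x y) - contr_bracket \<epsilon>' (\<phi> x) (\<phi> y)"])
    fix u v assume uv: "u \<in> Der" "v \<in> Der"
    show "\<phi> (contr_bracket \<epsilon> (u + v) y) - contr_bracket \<epsilon>' (\<phi> (u + v)) (\<phi> y) =
      (\<phi> (contr_bracket \<epsilon> u y) - contr_bracket \<epsilon>' (\<phi> u) (\<phi> y)) +
      (\<phi> (contr_bracket \<epsilon> v y) - contr_bracket \<epsilon>' (\<phi> v) (\<phi> y))"
      using uv y by (simp add: contr_bracket_add \<phi>_add contr_bracket_in_Der \<phi>_in)
  qed (rule hom1[OF _ y])
  have "\<phi> ` Der_grade g = Der_grade (\<sigma> g)" for g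
    using bij_betw_imp_surj_on[OF bij[of g]] \<phi>_hom[of _ g] by (metis (no_types, lifting) image_cong)
  then show ?thesis
    unfolding gc_equiv_def lie_iso_def
  proof (intro exI[of _ \<phi>] conjI ballI allI)
    show "\<phi> (contr_bracket \<epsilon> x y) = contr_bracket \<epsilon>' (\<phi> x) (\<phi> y)" if "x \<in> Der" "y \<in> Der" for x y
      using hom2[OF that] by (simp only: right_minus_eq)
    show "\<exists>h. \<phi> ` Der_grade g = Der_grade h" for g
      by (rule exI, fact)
  qed (rule bij\<phi> \<phi>_add \<phi>_scale; assumption?)+
qed

lemma gc_equiv_trans:
  assumes "gc_equiv \<epsilon> \<epsilon>'" "gc_equiv \<epsilon>' \<epsilon>''" shows "gc_equiv \<epsilon> \<epsilon>''"
proof -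
  obtain \<phi> where \<phi>: "lie_iso scaleE Der (contr_bracket \<epsilon>) scaleE Der (contr_bracket \<epsilon>') \<phi>"
    "\<forall>g. \<exists>h. \<phi> ` Der_grade g = Der_grade h" using assms(1) unfolding gc_equiv_def by blast
  obtain \<psi> where \<psi>: "lie_iso scaleE Der (contr_bracket \<epsilon>') scaleE Der (contr_bracket \<epsilon>'') \<psi>"
    "\<forall>g. \<exists>h. \<psi> ` Der_grade g = Der_grade h" using assms(2) unfolding gc_equiv_def by blast
  have i: "\<phi> x \<in> Der" if "x \<in> Der" for x
    using \<phi>(1) that unfolding lie_iso_def bij_betw_def by blast
  have "lie_iso scaleE Der (contr_bracket \<epsilon>) scaleE Der (contr_bracket \<epsilon>'') (\<psi> \<circ> \<phi>)"
    using \<phi>(1) \<psi>(1) i unfolding lie_iso_def by (auto intro: bij_betw_trans)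
  moreover have "\<exists>h. (\<psi> \<circ> \<phi>) ` Der_grade g = Der_grade h" for g
    using \<phi>(2) \<psi>(2) unfolding image_comp[symmetric] by metis
  ultimately show ?thesis unfolding gc_equiv_def by blast
qed

lemma gc_equiv_cong:
  assumes "\<And>x y. x \<in> Der \<Longrightarrow> y \<in> Der \<Longrightarrow> contr_bracket \<epsilon> x y = contr_bracket \<epsilon>' x y"
  shows "gc_equiv \<epsilon> \<epsilon>'"
  unfolding gc_equiv_def lie_iso_def using assms by (intro exI[of _ id]) auto

lemma gc_equiv_refl: "gc_equiv \<epsilon> \<epsilon>" by (rule gc_equiv_cong) simp

section \<open>Graded contractions and admissible maps\<close>

lemma I7_le: "i \<in> I7 \<Longrightarrow> i \<le> 7" by (simp add: I7_def)

lemma I7_idx: "idx g \<in> I7 \<longleftrightarrow> g \<noteq> 0"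
  using idx_le[of g] by (metis I7_def atLeastAtMost_iff gel_0 gel_idx idx_0 less_one not_less)

lemma gel_nonzero: "i \<in> I7 \<Longrightarrow> gel i \<noteq> 0"
  by (metis I7_idx I7_le idx_gel)

lemma gel_eq_iff: "i \<le> 7 \<Longrightarrow> j \<le> 7 \<Longrightarrow> gel i = gel j \<longleftrightarrow> i = j"
  using gel_inj by blast

lemma star_I7: "i \<in> I7 \<Longrightarrow> j \<in> I7 \<Longrightarrow> i \<noteq> j \<Longrightarrow> i \<star> j \<in> I7"
  using xo_le xo_nonzero' I7_le by (simp add: star_eq_xo) (fastforce simp: I7_def)

lemma gel_star: "i \<in> I7 \<Longrightarrow> j \<in> I7 \<Longrightarrow> i \<noteq> j \<Longrightarrow> gel (i \<star> j) = gel i + gel j"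
  by (simp add: star_eq_xo gel_add I7_le)

lemma star_idx: "g \<noteq> 0 \<Longrightarrow> h \<noteq> 0 \<Longrightarrow> g \<noteq> h \<Longrightarrow> idx g \<star> idx h = idx (g + h)"
  by (metis I7_idx star_eq_xo idx_add gel_idx)

lemma star_commute: "i \<in> I7 \<Longrightarrow> j \<in> I7 \<Longrightarrow> i \<noteq> j \<Longrightarrow> i \<star> j = j \<star> i"
  by (simp add: star_def add.commute)

lemma eps_0 [simp]: "eps \<eta> 0 h = 0" "eps \<eta> h 0 = 0"
  by (simp_all add: eps_def I7_def)

lemma eps_same [simp]: "eps \<eta> g g = 0" by (simp add: eps_def)

lemma eps_sym: "eps \<eta> g h = eps \<eta> h g"
  by (simp add: eps_def insert_commute)

lemma eps_nz: "g \<noteq> 0 \<Longrightarrow> h \<noteq> 0 \<Longrightarrow> g \<noteq> h \<Longrightarrow> eps \<eta> g h = \<eta> {idx g, idx h}"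
  unfolding eps_def I7_idx by (metis gel_idx)

lemma eps_gel: "i \<in> I7 \<Longrightarrow> j \<in> I7 \<Longrightarrow> i \<noteq> j \<Longrightarrow> eps \<eta> (gel i) (gel j) = \<eta> {i, j}"
  by (simp add: eps_def I7_le)

lemma generative_idx:
  assumes "g \<noteq> 0" "h \<noteq> 0" "k \<noteq> 0" "g \<noteq> h" "h \<noteq> k" "g \<noteq> k" "k \<noteq> g + h"
  shows "generative (idx g) (idx h) (idx k)"
  unfolding generative_def I7_idx using assms star_idx[OF assms(1,2,4)] by (metis gel_idx)

lemma generative_iff: "generative i j k \<longleftrightarrow> i \<in> I7 \<and> j \<in> I7 \<and> k \<in> I7 \<and>
    i \<noteq> j \<and> j \<noteq> k \<and> i \<noteq> k \<and> gel k \<noteq> gel i + gel j"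
proof -
  have "k = i \<star> j \<longleftrightarrow> gel k = gel i + gel j" if "i \<in> I7" "j \<in> I7" "k \<in> I7" "i \<noteq> j"
    using that gel_inj[of k "i \<star> j"] star_I7[of i j] by (auto simp: gel_star I7_le)
  then show ?thesis unfolding generative_def by blast
qed

lemma generative_rotate: assumes "generative i j k" shows "generative j k i"
proof -
  have "gel k \<noteq> gel i + gel j" using assms generative_iff by blast
  then have "gel i \<noteq> gel j + gel k" by (metis add.commute grp_add_cancel(1))
  with assms show ?thesis unfolding generative_iff by blast
qed

lemma generative_swap: assumes "generative i j k" shows "generative i k j"
proof -
  have "gel k \<noteq> gel i + gel j" using assms generative_iff by blast
  then have "gel j \<noteq> gel i + gel k" by (metis grp_add_cancel(1))
  with assms show ?thesis unfolding generative_iff by blast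
qed

lemma eta3_eps:
  assumes "g \<noteq> 0" "h \<noteq> 0" "k \<noteq> 0" "g \<noteq> h" "h \<noteq> k" "g \<noteq> k" "k \<noteq> g + h"
  shows "eta3 \<eta> (idx g) (idx h) (idx k) = eps \<eta> g (h + k) * eps \<eta> h k"
proof -
  have "g \<noteq> h + k" using assms(7) by (metis grp_add_cancel(4))
  then show ?thesis
    unfolding eta3_def star_idx[OF assms(2,3,5)] using assms by (simp add: eps_nz)
qed

lemma commutator_jacobi:
  assumes "x \<in> Der_grade g" "y \<in> Der_grade h" "z \<in> Der_grade k"
  shows "commutator x (commutator y z) + commutator y (commutator z x) + commutator z (commutator x y) = 0"
proof -
  interpret x: Vector_Spaces.linear "(*s)" "(*s)" x using assms Der_gradeD Der_linear by blast
  interpret y: Vector_Spaces.linear "(*s)" "(*s)" y using assms Der_gradeD Der_linear by blast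
  interpret z: Vector_Spaces.linear "(*s)" "(*s)" z using assms Der_gradeD Der_linear by blast
  show ?thesis by (simp add: fun_eq_iff commutator_def x.diff y.diff z.diff)
qed

lemma contr_bracket_twice:
  assumes "x \<in> Der_grade g" "y \<in> Der_grade h" "z \<in> Der_grade k"
  shows "contr_bracket \<epsilon> x (contr_bracket \<epsilon> y z) =
    scaleE (\<epsilon> g (h + k) * \<epsilon> h k) (commutator x (commutator y z))"
  unfolding contr_bracket_homogeneous[OF assms(2,3)]
  using contr_bracket_homogeneous[OF assms(1) Der_grade_scale[OF commutator_in_Der_grade[OF assms(2,3)]]]
    commutator_scale(2)[OF Der_gradeD[OF assms(1)]] endo.scale_scale by metis

text \<open>It suffices to find one scalar c that may replace the contraction factor of each of the
  three terms, either because the factor equals c or because the term vanishes; the uncontracted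
  Jacobi identity then finishes.\<close>

lemma contr_jacobi_homogeneous:
  assumes adm: "\<eta> \<in> admissible" and xyz: "x \<in> Der_grade g" "y \<in> Der_grade h" "z \<in> Der_grade k"
  defines "B \<equiv> contr_bracket (eps \<eta>)"
  shows "B x (B y z) + B y (B z x) + B z (B x y) = 0"
proof -
  let ?E = "eps \<eta>"
  define J1 where "J1 = commutator x (commutator y z)"
  define J2 where "J2 = commutator y (commutator z x)"
  define J3 where "J3 = commutator z (commutator x y)"
  have J: "J1 + J2 + J3 = 0" using commutator_jacobi[OF xyz] by (simp only: J1_def J2_def J3_def)
  define c1 where "c1 = ?E g (h + k) * ?E h k"
  define c2 where "c2 = ?E h (k + g) * ?E k g"
  define c3 where "c3 = ?E k (g + h) * ?E g h"
  have c0: "commutator x 0 = 0" "commutator y 0 = 0" "commutator z 0 = 0"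
    using commutator_scale(2)[OF Der_gradeD[OF xyz(1)], of 0 0]
      commutator_scale(2)[OF Der_gradeD[OF xyz(2)], of 0 0] commutator_scale(2)[OF Der_gradeD[OF xyz(3)], of 0 0]
    by (simp_all only: endo.scale_zero_left)
  have "\<exists>c. (c1 = c \<or> J1 = 0) \<and> (c2 = c \<or> J2 = 0) \<and> (c3 = c \<or> J3 = 0)"
  proof (cases "g = 0 \<or> h = 0 \<or> k = 0 \<or> k = g + h")
    case True
    \<comment> \<open>If k = g + h, each outer bracket pairs a degree with itself, where
      \<open>eps\<close> is 0.\<close>
    then have "c1 = 0 \<and> c2 = 0 \<and> c3 = 0"
      unfolding c1_def c2_def c3_def by (elim disjE) (simp_all add: add.commute)
    then show ?thesis by blast
  next
    case nz: False
    show ?thesis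
    proof (cases "g = h \<or> h = k \<or> g = k")
      \<comment> \<open>When two degrees coincide, their inner bracket vanishes because components
        are abelian, and the other two factors agree by the symmetry of \<open>eps\<close>.\<close>
      case True
      then show ?thesis
      proof (elim disjE)
        assume "g = h"
        then have "J3 = 0" "c1 = c2" using xyz
          by (simp_all add: J3_def commutator_same_grade c0 c1_def c2_def eps_sym add.commute)
        then show ?thesis by blast
      next
        assume "h = k"
        then have "J1 = 0" "c3 = c2" using xyz
          by (simp_all add: J1_def commutator_same_grade c0 c3_def c2_def eps_sym add.commute)
        then show ?thesis by blast
      next
        assume "g = k"
        then have "J2 = 0" "c1 = c3" using xyz
          by (simp_all add: J2_def commutator_same_grade c0 c3_def c1_def eps_sym add.commute)
        then show ?thesis by blast
      qed
    next
      case False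
      have nn: "g \<noteq> 0" "h \<noteq> 0" "k \<noteq> 0" "g \<noteq> h" "h \<noteq> k" "g \<noteq> k" "k \<noteq> g + h" "k \<noteq> g" "h \<noteq> g"
        "g \<noteq> h + k" "h \<noteq> k + g"
        using nz False by (auto dest: sym) 
      note G = generative_idx[OF nn(1,2,3,4,5,6,7)] generative_idx[OF nn(2,3,1,5) nn(8,9,10)]
      have "c1 = c2" "c2 = c3"
        unfolding c1_def c2_def c3_def
          eta3_eps[OF nn(1,2,3,4,5,6,7), symmetric] eta3_eps[OF nn(2,3,1,5) nn(8,9,10), symmetric]
          eta3_eps[OF nn(3,1,2) nn(8,4) not_sym[OF nn(5)] nn(11), symmetric]
        using adm G unfolding admissible_def by blast+
      then show ?thesis by blast
    qed
  qed
  then obtain c where "c1 = c \<or> J1 = 0" "c2 = c \<or> J2 = 0" "c3 = c \<or> J3 = 0" by blast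
  then have "scaleE c1 J1 = scaleE c J1" "scaleE c2 J2 = scaleE c J2" "scaleE c3 J3 = scaleE c J3"
    by (auto simp del: zero_fun_apply)
  then have "scaleE c1 J1 + scaleE c2 J2 + scaleE c3 J3 = scaleE c (J1 + J2 + J3)"
    by (simp only: scaleE_add)
  also have "\<dots> = 0" unfolding J by (rule endo.scale_zero_right)
  finally show ?thesis
    unfolding B_def contr_bracket_twice[OF xyz] contr_bracket_twice[OF xyz(2,3,1)]
      contr_bracket_twice[OF xyz(3,1,2)] c1_def c2_def c3_def J1_def J2_def J3_def .
qed

lemma contr_jacobi:
  assumes adm: "\<eta> \<in> admissible" and x: "x \<in> Der" and y: "y \<in> Der" and z: "z \<in> Der"
  defines "B \<equiv> contr_bracket (eps \<eta>)"
  shows "B x (B y z) + B y (B z x) + B z (B x y) = 0"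
proof -
  have c: "B u v \<in> Der" if "u \<in> Der" "v \<in> Der" for u v unfolding B_def using that by (rule contr_bracket_in_Der)
  have a: "B (u + v) w = B u w + B v w" "B w (u + v) = B w u + B w v" if "w \<in> Der" for u v w
    unfolding B_def using contr_bracket_add[OF that] by blast+
  define J where "J x y z = B x (B y z) + B y (B z x) + B z (B x y)" for x y z
  have J: "J (u + v) y z = J u y z + J v y z" "J y (u + v) z = J y u z + J y v z" "J y z (u + v) = J y z u + J y z v"
    if "u \<in> Der" "v \<in> Der" "y \<in> Der" "z \<in> Der" for u v y z
    unfolding J_def using that by (simp_all add: a c algebra_simps)
  have 1: "J x y z = 0" if "x \<in> Der_grade g" "y \<in> Der_grade h" "z \<in> Der" for g h x y z
    by (rule Der_additive_zero[OF J(3)])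
      (use that contr_jacobi_homogeneous[OF adm that(1,2)] in \<open>auto simp: J_def B_def dest: Der_gradeD\<close>)
  have 2: "J x y z = 0" if "x \<in> Der_grade g" "y \<in> Der" "z \<in> Der" for g x y z
    by (rule Der_additive_zero[OF J(2)]) (use that 1[OF that(1)] in \<open>auto dest: Der_gradeD\<close>)
  have "J x y z = 0"
    by (rule Der_additive_zero[OF J(1)]) (use x y z 2 in auto)
  then show ?thesis unfolding J_def .
qed

lemma contr_bracket_alternating:
  assumes sym: "\<And>g h. \<epsilon> g h = \<epsilon> h g" and x: "x \<in> Der"
  shows "contr_bracket \<epsilon> x x = 0"
proof -
  define t where "t g h = scaleE (\<epsilon> g h) (commutator (hom_part g x) (hom_part h x))" for g h
  define S where "S = contr_bracket \<epsilon> x x"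
  have s: "t g h = - t h g" for g h
    unfolding t_def sym[of g h] commutator_swap[of "hom_part g x"] by (rule endo.scale_minus_right)
  have S: "S = (\<Sum>g\<in>UNIV. \<Sum>h\<in>UNIV. t g h)"
    unfolding S_def contr_bracket_def t_def ..
  also have "\<dots> = (\<Sum>g\<in>UNIV. \<Sum>h\<in>UNIV. - t h g)" by (intro sum.cong refl s)
  also have "\<dots> = - (\<Sum>g\<in>UNIV. \<Sum>h\<in>UNIV. t h g)" by (simp only: sum_negf)
  also have "(\<Sum>g\<in>UNIV. \<Sum>h\<in>UNIV. t h g) = S" unfolding S by (rule sum.swap)
  finally have "S = - S" .
  have "S y $ i = 0" for y i
    using arg_cong[OF \<open>S = - S\<close>, of "\<lambda>f. f y $ i"] by (simp only: uminus_apply vector_uminus_component) simp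
  then have "S = 0" by (intro ext) (simp add: vec_eq_iff)
  then show ?thesis unfolding S_def .
qed

lemma graded_contraction_eps:
  assumes "\<eta> \<in> admissible" shows "graded_contraction (eps \<eta>)"
  unfolding graded_contraction_def
proof (intro lie_algebra.intro lie_algebra_axioms.intro)
  show "vector_space scaleE" by (rule endo.vector_space_axioms)
  show "module.subspace scaleE Der" by (rule subspace_Der)
qed (simp_all only: contr_bracket_in_Der contr_bracket_add contr_bracket_scale
      contr_bracket_alternating[OF eps_sym] contr_jacobi[OF assms])

section \<open>From a graded contraction to an admissible map\<close>

text \<open>\<open>Min\<close> and \<open>Max\<close> only pick an order of the two ends; by
  \<open>graded_contraction_sym\<close> the opposite order gives the same value for a graded
  contraction.\<close>

definition eta_of :: "(grp \<Rightarrow> grp \<Rightarrow> complex) \<Rightarrow> nat set \<Rightarrow> complex" where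
  "eta_of \<epsilon> t = (if t \<in> edges then \<epsilon> (gel (Min t)) (gel (Max t)) else 0)"

lemma edges_iff: "{i, j} \<in> edges \<longleftrightarrow> i \<in> I7 \<and> j \<in> I7 \<and> i \<noteq> j"
  by (auto simp: edges_def doubleton_eq_iff)

lemma wder_in: "i \<le> 7 \<Longrightarrow> hop (gel i) (wder i) \<in> Der_grade (gel i)"
  by (intro hop_in_Der_grade dcond_wder)

lemma commutator_wder_nonzero:
  assumes "i \<in> I7" "j \<in> I7" "i \<noteq> j"
  shows "commutator (hop (gel i) (wder i)) (hop (gel j) (wder j)) \<noteq> 0"
proof
  assume "commutator (hop (gel i) (wder i)) (hop (gel j) (wder j)) = 0"
  then have "hop (gel i + gel j) (kom (gel i) (gel j) (wder i) (wder j)) = hop (gel i + gel j) (\<lambda>_. 0)"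
    unfolding commutator_hop hop_zero by (simp only: zero_fun_def)
  then show False unfolding hop_eq_iff using kom_wder_nonzero assms by (auto simp: I7_def)
qed

text \<open>The contracted bracket of x + y with itself is the difference of the two factors times
  [x, y], and the test derivations have nonzero bracket.\<close>

lemma graded_contraction_sym:
  assumes gc: "graded_contraction \<epsilon>" and ij: "i \<in> I7" "j \<in> I7" "i \<noteq> j"
  shows "\<epsilon> (gel i) (gel j) = \<epsilon> (gel j) (gel i)"
proof -
  interpret lie_algebra scaleE Der "contr_bracket \<epsilon>" using gc by (simp only: graded_contraction_def)
  let ?x = "hop (gel i) (wder i)" and ?y = "hop (gel j) (wder j)"
  have g: "?x \<in> Der_grade (gel i)" "?y \<in> Der_grade (gel j)" using ij by (simp_all add: wder_in I7_le)
  then have D: "?x \<in> Der" "?y \<in> Der" by (simp_all add: Der_gradeD)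
  have "contr_bracket \<epsilon> (?x + ?y) (?x + ?y) = 0" using D by (intro br_alternating Der_add)
  then have "contr_bracket \<epsilon> ?x ?y + contr_bracket \<epsilon> ?y ?x = 0"
    using D br_alternating[OF D(1)] br_alternating[OF D(2)]
    by (simp only: contr_bracket_add Der_add add_0_left add_0_right add.commute)
  then have z: "scaleE (\<epsilon> (gel i) (gel j) - \<epsilon> (gel j) (gel i)) (commutator ?x ?y) = 0"
    unfolding contr_bracket_homogeneous[OF g] contr_bracket_homogeneous[OF g(2,1)] commutator_swap[of ?y ?x]
    by (simp only: endo.scale_left_diff_distrib endo.scale_minus_right add_uminus_conv_diff)
  have "commutator ?x ?y \<noteq> 0" by (rule commutator_wder_nonzero[OF ij])
  with z show ?thesis by (simp only: endo.scale_eq_0_iff) simp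
qed

lemma eta_of_edge:
  assumes gc: "graded_contraction \<epsilon>" and ij: "i \<in> I7" "j \<in> I7" "i \<noteq> j"
  shows "eta_of \<epsilon> {i, j} = \<epsilon> (gel i) (gel j)"
proof (cases "i < j")
  case True
  then show ?thesis using ij by (simp add: eta_of_def edges_iff)
next
  case False
  then show ?thesis using ij graded_contraction_sym[OF assms] by (simp add: eta_of_def edges_iff)
qed

lemma contr_bracket_eta_of:
  assumes gc: "graded_contraction \<epsilon>" and xy: "x \<in> Der" "y \<in> Der"
  shows "contr_bracket \<epsilon> x y = contr_bracket (eps (eta_of \<epsilon>)) x y"
  unfolding contr_bracket_def
proof (intro sum.cong refl)
  fix g h
  let ?c = "commutator (hom_part g x) (hom_part h y)"
  have c: "hom_part g x \<in> Der_grade g" "hom_part h y \<in> Der_grade h" using xy hom_part_in_Der_grade by blast+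
  show "scaleE (\<epsilon> g h) ?c = scaleE (eps (eta_of \<epsilon>) g h) ?c"
  proof (cases "g = 0 \<or> h = 0 \<or> g = h")
    case True
    then have "?c = 0"
    proof (elim disjE)
      assume "g = 0"
      then have "hom_part g x = scaleE 0 0" using c by (simp add: Der_grade_0 endo.scale_zero_right del: endo.scale_zero_left)
      then show ?thesis using commutator_scale(1)[OF Der_gradeD[OF c(2)], of 0 0] by (simp only: endo.scale_zero_left)
    next
      assume "h = 0"
      then have "hom_part h y = scaleE 0 0" using c by (simp add: Der_grade_0 endo.scale_zero_right del: endo.scale_zero_left)
      then show ?thesis using commutator_scale(2)[OF Der_gradeD[OF c(1)], of 0 0] by (simp only: endo.scale_zero_left)
    next
      assume "g = h"
      then show ?thesis using c commutator_same_grade by simp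
    qed
    then show ?thesis by (simp only: endo.scale_zero_right)
  next
    case False
    then have "eps (eta_of \<epsilon>) g h = \<epsilon> g h"
      using eta_of_edge[OF gc, of "idx g" "idx h"] I7_idx by (simp add: eps_nz) (metis gel_idx)
    then show ?thesis by simp
  qed
qed

text \<open>\<open>eta3\<close> is symmetric in its last two arguments, so the equations for one
  increasing triple imply those for all its orderings.\<close>

lemma admissibleI:
  assumes out: "\<And>t. t \<notin> edges \<Longrightarrow> \<eta> t = 0"
    and eq: "\<And>i j k. (i, j, k) \<in> set gen_triples \<Longrightarrow> generative i j k \<Longrightarrow> i < j \<Longrightarrow> j < k \<Longrightarrow>
      eta3 \<eta> i j k = eta3 \<eta> j k i \<and> eta3 \<eta> j k i = eta3 \<eta> k i j"
  shows "\<eta> \<in> admissible"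
proof -
  have E_swap: "eta3 \<eta> i k j = eta3 \<eta> i j k" if "generative i j k" for i j k
    using that star_commute[of j k] by (simp add: eta3_def generative_def insert_commute)
  have sorted: "eta3 \<eta> i j k = eta3 \<eta> j k i \<and> eta3 \<eta> j k i = eta3 \<eta> k i j"
    if g: "generative i j k" and lt: "i < j" "j < k" for i j k
  proof (rule eq[OF _ g lt])
    have "i \<le> 7" "j \<le> 7" "k \<le> 7" "i \<noteq> 0" "k \<noteq> xo i j"
      using g lt star_eq_xo[of i j] by (auto simp: generative_def I7_def)
    then show "(i, j, k) \<in> set gen_triples" using gen_triples_complete lt by blast
  qed
  have "eta3 \<eta> i j k = eta3 \<eta> j k i \<and> eta3 \<eta> j k i = eta3 \<eta> k i j" if g: "generative i j k" for i j k
  proof -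
    have "i \<noteq> j" "j \<noteq> k" "i \<noteq> k" using g by (auto simp: generative_def)
    then consider "i < j" "j < k" | "i < k" "k < j" | "j < i" "i < k" | "j < k" "k < i" | "k < i" "i < j" | "k < j" "j < i"
      by linarith
    then show ?thesis
      by cases (use sorted generative_rotate generative_swap E_swap g in metis)+
  qed
  then show ?thesis unfolding admissible_def using out by blast
qed

lemma eta_of_admissible:
  assumes gc: "graded_contraction \<epsilon>" shows "eta_of \<epsilon> \<in> admissible"
proof -
  interpret lie_algebra scaleE Der "contr_bracket \<epsilon>" using gc by (simp only: graded_contraction_def)
  let ?E = "eta3 (eta_of \<epsilon>)"
  have e3: "?E i j k = \<epsilon> (gel i) (gel j + gel k) * \<epsilon> (gel j) (gel k)" if "generative i j k" for i j k
  proof -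
    have *: "i \<in> I7" "j \<in> I7" "k \<in> I7" "j \<noteq> k" "i \<noteq> j" "k \<noteq> i \<star> j" using that by (auto simp: generative_def)
    have "i \<noteq> j \<star> k" using generative_rotate[OF that] by (auto simp: generative_def)
    then show ?thesis using * by (simp add: eta3_def eta_of_edge[OF gc] star_I7 gel_star)
  qed
  have sorted: "?E i j k = ?E j k i \<and> ?E j k i = ?E k i j" if g: "generative i j k" and lt: "i < j" "j < k" for i j k
    unfolding e3[OF g] e3[OF generative_rotate[OF g]] e3[OF generative_rotate[OF generative_rotate[OF g]]]
  proof (rule generative_scalars)
    have le: "i \<in> I7" "j \<in> I7" "k \<in> I7" using g by (auto simp: generative_def)
    show "1 \<le> i" "i < j" "j < k" "k \<le> 7" using le lt by (auto simp: I7_def)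
    show "k \<noteq> xo i j" using g lt star_eq_xo[of i j] by (auto simp: generative_def)
    note W = wder_in[OF I7_le[OF le(1)]] wder_in[OF I7_le[OF le(2)]] wder_in[OF I7_le[OF le(3)]]
    have s: "gel j + (gel k + gel i) = gel i + (gel j + gel k)" "gel k + (gel i + gel j) = gel i + (gel j + gel k)"
      by (simp_all add: add_ac)
    have hz: "hop G (\<lambda>_. 0) = 0" for G by (simp only: hop_zero zero_fun_def)
    \<comment> \<open>The Jacobi identity of the contracted algebra on three test derivations,
      collected into the coefficient function of one operator so that it can be read off
      pointwise.\<close>
    have "hop (gel i + (gel j + gel k)) (\<lambda>g. \<epsilon> (gel i) (gel j + gel k) * \<epsilon> (gel j) (gel k) *
        kom (gel i) (gel j + gel k) (wder i) (kom (gel j) (gel k) (wder j) (wder k)) g +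
      \<epsilon> (gel j) (gel k + gel i) * \<epsilon> (gel k) (gel i) *
        kom (gel j) (gel k + gel i) (wder j) (kom (gel k) (gel i) (wder k) (wder i)) g +
      \<epsilon> (gel k) (gel i + gel j) * \<epsilon> (gel i) (gel j) *
        kom (gel k) (gel i + gel j) (wder k) (kom (gel i) (gel j) (wder i) (wder j)) g) = hop (gel i + (gel j + gel k)) (\<lambda>_. 0)"
      unfolding hz using br_jacobi[OF W[THEN Der_gradeD]]
      unfolding contr_bracket_twice[OF W] contr_bracket_twice[OF W(2,3,1)] contr_bracket_twice[OF W(3,1,2)]
      unfolding commutator_hop hop_scale s hop_add .
    then show "\<epsilon> (gel i) (gel j + gel k) * \<epsilon> (gel j) (gel k) *
        kom (gel i) (gel j + gel k) (wder i) (kom (gel j) (gel k) (wder j) (wder k)) g +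
      \<epsilon> (gel j) (gel k + gel i) * \<epsilon> (gel k) (gel i) *
        kom (gel j) (gel k + gel i) (wder j) (kom (gel k) (gel i) (wder k) (wder i)) g +
      \<epsilon> (gel k) (gel i + gel j) * \<epsilon> (gel i) (gel j) *
        kom (gel k) (gel i + gel j) (wder k) (kom (gel i) (gel j) (wder i) (wder j)) g = 0" for g
      unfolding hop_eq_iff by (rule fun_cong)
  qed
  show ?thesis by (rule admissibleI) (use sorted in \<open>simp_all add: eta_of_def\<close>)
qed

lemma graded_contraction_equiv_eps:
  assumes "graded_contraction \<epsilon>"
  obtains \<eta> where "\<eta> \<in> admissible" "gc_equiv \<epsilon> (eps \<eta>)"
  using eta_of_admissible[OF assms] gc_equiv_cong[OF contr_bracket_eta_of[OF assms]] by blast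

section \<open>Invariants of an equivalence\<close>

lemma Der_grade_disjoint:
  assumes "x \<in> Der_grade g" "x \<in> Der_grade h" "x \<noteq> 0" shows "g = h"
  using hom_part_Der_grade[OF assms(1), of h] hom_part_Der_grade[OF assms(2), of h] assms(3)
  by (metis (full_types))

lemma wder_nonzero: assumes "i \<in> I7" shows "hop (gel i) (wder i) \<noteq> 0"
proof
  define j where "j = (if i = 1 then 2 else 1 :: nat)"
  have j: "j \<in> I7" "i \<noteq> j" by (auto simp: j_def I7_def)
  assume "hop (gel i) (wder i) = 0"
  then have "hop (gel i) (wder i) = hop (gel i) (\<lambda>_. 0)" by (simp only: hop_zero zero_fun_def)
  then have "kom (gel i) (gel j) (wder i) (wder j) = (\<lambda>_. 0)"
    unfolding hop_eq_iff by (simp add: kom_def fun_eq_iff)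
  with kom_wder_nonzero[of i j] j assms show False by (auto simp: I7_def)
qed

text \<open>The component of degree 0 is zero and the others are nonzero with trivial pairwise
  intersections, so a bijection sending components to components permutes the seven nonzero degrees.
  No compatibility of the permutation with \<open>\<star>\<close> follows at this stage.\<close>

lemma gc_equivE:
  assumes "gc_equiv \<epsilon> \<epsilon>'"
  obtains \<pi> \<phi> where "bij_betw \<pi> I7 I7" "\<And>i. i \<in> I7 \<Longrightarrow> \<phi> ` Der_grade (gel i) = Der_grade (gel (\<pi> i))"
    "bij_betw \<phi> Der Der" "\<And>x y. x \<in> Der \<Longrightarrow> y \<in> Der \<Longrightarrow> \<phi> (x + y) = \<phi> x + \<phi> y"
    "\<And>c x. x \<in> Der \<Longrightarrow> \<phi> (scaleE c x) = scaleE c (\<phi> x)"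
    "\<And>x y. x \<in> Der \<Longrightarrow> y \<in> Der \<Longrightarrow> \<phi> (contr_bracket \<epsilon> x y) = contr_bracket \<epsilon>' (\<phi> x) (\<phi> y)"
proof -
  obtain \<phi> where iso: "lie_iso scaleE Der (contr_bracket \<epsilon>) scaleE Der (contr_bracket \<epsilon>') \<phi>"
    and gr: "\<forall>g. \<exists>h. \<phi> ` Der_grade g = Der_grade h"
    using assms unfolding gc_equiv_def by blast
  note iso = iso[unfolded lie_iso_def]
  have bij: "bij_betw \<phi> Der Der" and inj: "inj_on \<phi> Der"
    using iso by (auto dest: bij_betw_imp_inj_on)
  have \<phi>0: "\<phi> 0 = 0"
  proof -
    have "\<phi> (scaleE 0 0) = scaleE 0 (\<phi> 0)" using iso zero_in_Der by blast
    then show ?thesis by (simp only: endo.scale_zero_left)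
  qed
  obtain s where s: "\<phi> ` Der_grade g = Der_grade (s g)" for g using choice[OF gr] by blast
  define \<pi> where "\<pi> i = idx (s (gel i))" for i
  have \<pi>: "\<phi> ` Der_grade (gel i) = Der_grade (gel (\<pi> i))" for i by (simp add: \<pi>_def s)
  have in7: "\<pi> i \<in> I7" if i: "i \<in> I7" for i
  proof (rule ccontr)
    assume "\<pi> i \<notin> I7"
    then have "s (gel i) = 0" unfolding \<pi>_def I7_idx by blast
    then have "\<phi> (hop (gel i) (wder i)) \<in> {0}"
      using s[of "gel i"] wder_in[OF I7_le[OF i]] by (metis Der_grade_0 imageI)
    then have "\<phi> (hop (gel i) (wder i)) = \<phi> 0" by (simp only: \<phi>0 singleton_iff)
    then have "hop (gel i) (wder i) = 0"
      using inj_onD[OF inj] wder_in[OF I7_le[OF i]] Der_gradeD zero_in_Der by blast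
    then show False using wder_nonzero[OF i] by blast
  qed
  have inj7: "inj_on \<pi> I7"
  proof (rule inj_onI)
    fix i j assume ij: "i \<in> I7" "j \<in> I7" "\<pi> i = \<pi> j"
    then have "\<phi> ` Der_grade (gel i) = \<phi> ` Der_grade (gel j)" by (simp only: \<pi>)
    then have "Der_grade (gel i) = Der_grade (gel j)"
      using inj_on_image_eq_iff[OF inj] Der_gradeD by (metis subsetI)
    then have "gel i = gel j"
      using Der_grade_disjoint wder_in[OF I7_le[OF ij(1)]] wder_nonzero[OF ij(1)] by metis
    then show "i = j" using ij gel_inj I7_le by blast
  qed
  have "\<pi> ` I7 \<subseteq> I7" using in7 by blast
  then have "\<pi> ` I7 = I7" using endo_inj_surj[OF _ _ inj7] by (simp add: I7_def)
  then have "bij_betw \<pi> I7 I7" using inj7 by (intro bij_betw_imageI)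
  then show ?thesis
    using that[of \<pi> \<phi>] \<pi> bij iso by blast
qed

text \<open>\<open>\<pi>\<close> has to respect \<open>\<star>\<close> only along edges of the
  support: elsewhere the contracted bracket is zero and has no visible degree.\<close>

definition supp_iso :: "(nat \<Rightarrow> nat) \<Rightarrow> nat set set \<Rightarrow> nat set set \<Rightarrow> bool" where
  "supp_iso \<pi> T T' \<longleftrightarrow> bij_betw \<pi> I7 I7 \<and> (\<forall>i\<in>I7. \<forall>j\<in>I7. i \<noteq> j \<longrightarrow>
    ({i, j} \<in> T \<longleftrightarrow> {\<pi> i, \<pi> j} \<in> T') \<and> ({i, j} \<in> T \<longrightarrow> \<pi> (i \<star> j) = \<pi> i \<star> \<pi> j))"

text \<open>On an edge of the support the test derivations have nonzero contracted bracket. Its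
  image lies in the components of degrees \<open>\<pi> (i \<star> j)\<close> and
  \<open>\<pi> i \<star> \<pi> j\<close>, which must then coincide. For the converse, test
  derivations of the target are pulled back.\<close>

lemma supp_isoI:
  assumes \<pi>: "bij_betw \<pi> I7 I7" and gr: "\<And>i. i \<in> I7 \<Longrightarrow> \<phi> ` Der_grade (gel i) = Der_grade (gel (\<pi> i))"
    and bij: "bij_betw \<phi> Der Der"
    and scale: "\<And>c x. x \<in> Der \<Longrightarrow> \<phi> (scaleE c x) = scaleE c (\<phi> x)"
    and hom: "\<And>x y. x \<in> Der \<Longrightarrow> y \<in> Der \<Longrightarrow> \<phi> (contr_bracket (eps \<eta>) x y) = contr_bracket (eps \<eta>') (\<phi> x) (\<phi> y)"
  shows "supp_iso \<pi> (eta_support \<eta>) (eta_support \<eta>')"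
  unfolding supp_iso_def
proof (intro conjI \<pi> ballI impI)
  fix i j assume ij: "i \<in> I7" "j \<in> I7" "i \<noteq> j"
  have pij: "\<pi> i \<in> I7" "\<pi> j \<in> I7" "\<pi> i \<noteq> \<pi> j"
    using \<pi> ij by (auto simp: bij_betw_def inj_on_def)
  have T: "{i, j} \<in> eta_support \<eta> \<longleftrightarrow> \<eta> {i, j} \<noteq> 0" "{\<pi> i, \<pi> j} \<in> eta_support \<eta>' \<longleftrightarrow> \<eta>' {\<pi> i, \<pi> j} \<noteq> 0"
    using ij pij by (auto simp: eta_support_def edges_iff)
  have inj: "inj_on \<phi> Der" using bij by (rule bij_betw_imp_inj_on)
  have \<phi>0: "\<phi> x = 0 \<longleftrightarrow> x = 0" if "x \<in> Der" for x
  proof -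
    have "\<phi> (scaleE 0 0) = scaleE 0 (\<phi> 0)" using scale zero_in_Der by blast
    then have "\<phi> 0 = 0" by (simp only: endo.scale_zero_left)
    then show ?thesis using inj_onD[OF inj, of x 0] that zero_in_Der by metis
  qed
  have hom': "\<phi> (scaleE (\<eta> {i, j}) (commutator x y)) = scaleE (\<eta>' {\<pi> i, \<pi> j}) (commutator (\<phi> x) (\<phi> y))"
    if xy: "x \<in> Der_grade (gel i)" "y \<in> Der_grade (gel j)" for x y
  proof -
    have p: "\<phi> x \<in> Der_grade (gel (\<pi> i))" "\<phi> y \<in> Der_grade (gel (\<pi> j))"
      using xy gr[OF ij(1)] gr[OF ij(2)] by blast+
    show ?thesis using hom[OF xy[THEN Der_gradeD]]
      unfolding contr_bracket_homogeneous[OF xy] contr_bracket_homogeneous[OF p] eps_gel[OF ij] eps_gel[OF pij] .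
  qed
  have fwd: "\<eta>' {\<pi> i, \<pi> j} \<noteq> 0 \<and> \<pi> (i \<star> j) = \<pi> i \<star> \<pi> j" if nz: "\<eta> {i, j} \<noteq> 0"
  proof -
    let ?x = "hop (gel i) (wder i)" and ?y = "hop (gel j) (wder j)"
    have xy: "?x \<in> Der_grade (gel i)" "?y \<in> Der_grade (gel j)" using ij by (simp_all add: wder_in I7_le)
    let ?z = "scaleE (\<eta> {i, j}) (commutator ?x ?y)"
    have z: "?z \<in> Der_grade (gel (i \<star> j))" "?z \<noteq> 0"
      using xy nz commutator_wder_nonzero[OF ij] unfolding gel_star[OF ij] endo.scale_eq_0_iff
      by (simp_all only: Der_grade_scale commutator_in_Der_grade de_Morgan_disj not_False_eq_True simp_thms)
    then have pz: "\<phi> ?z \<noteq> 0" "\<phi> ?z \<in> Der_grade (gel (\<pi> (i \<star> j)))"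
      using \<phi>0 gr[OF star_I7[OF ij]] Der_gradeD by blast+
    have p: "\<phi> ?x \<in> Der_grade (gel (\<pi> i))" "\<phi> ?y \<in> Der_grade (gel (\<pi> j))"
      using xy gr[OF ij(1)] gr[OF ij(2)] by blast+
    have "\<phi> ?z \<in> Der_grade (gel (\<pi> i \<star> \<pi> j))"
      unfolding hom'[OF xy] gel_star[OF pij] by (intro Der_grade_scale commutator_in_Der_grade p)
    then have "gel (\<pi> (i \<star> j)) = gel (\<pi> i \<star> \<pi> j)" using Der_grade_disjoint pz by blast
    moreover have "\<pi> (i \<star> j) \<in> I7" using \<pi> star_I7[OF ij] by (auto simp: bij_betw_def)
    ultimately have "\<pi> (i \<star> j) = \<pi> i \<star> \<pi> j" using star_I7[OF pij] gel_inj I7_le by blast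
    moreover have "\<eta>' {\<pi> i, \<pi> j} \<noteq> 0"
      using pz(1) unfolding hom'[OF xy] endo.scale_eq_0_iff by blast
    ultimately show ?thesis by blast
  qed
  have bwd: "\<eta> {i, j} \<noteq> 0" if nz: "\<eta>' {\<pi> i, \<pi> j} \<noteq> 0"
  proof -
    have "hop (gel (\<pi> i)) (wder (\<pi> i)) \<in> \<phi> ` Der_grade (gel i)" "hop (gel (\<pi> j)) (wder (\<pi> j)) \<in> \<phi> ` Der_grade (gel j)"
      unfolding gr[OF ij(1)] gr[OF ij(2)] using pij by (simp_all add: wder_in I7_le)
    then obtain x y where xy: "x \<in> Der_grade (gel i)" "y \<in> Der_grade (gel j)"
      and p: "\<phi> x = hop (gel (\<pi> i)) (wder (\<pi> i))" "\<phi> y = hop (gel (\<pi> j)) (wder (\<pi> j))"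
      by (metis imageE)
    have "scaleE (\<eta>' {\<pi> i, \<pi> j}) (commutator (\<phi> x) (\<phi> y)) \<noteq> 0"
      unfolding p endo.scale_eq_0_iff using nz commutator_wder_nonzero[OF pij] by blast
    then have "scaleE (\<eta> {i, j}) (commutator x y) \<noteq> 0"
      unfolding hom'[OF xy, symmetric]
      using \<phi>0[OF Der_scale[OF commutator_in_Der[OF xy[THEN Der_gradeD]]]] by blast
    then show ?thesis unfolding endo.scale_eq_0_iff by blast
  qed
  show "({i, j} \<in> eta_support \<eta>) = ({\<pi> i, \<pi> j} \<in> eta_support \<eta>')" unfolding T using fwd bwd by blast
  show "{i, j} \<in> eta_support \<eta> \<Longrightarrow> \<pi> (i \<star> j) = \<pi> i \<star> \<pi> j" unfolding T using fwd by blast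
qed

section \<open>Normalizations and collineations\<close>

text \<open>The isomorphism multiplies the component of degree g_i by \<open>\<alpha> i\<close>; the
  hypothesis is its compatibility with the brackets.\<close>

lemma eta_equiv_normalize:
  assumes nz: "\<And>i. i \<in> I7 \<Longrightarrow> \<alpha> i \<noteq> 0"
    and eq: "\<And>i j. i \<in> I7 \<Longrightarrow> j \<in> I7 \<Longrightarrow> i \<noteq> j \<Longrightarrow> \<eta> {i, j} * \<alpha> (i \<star> j) = \<eta>' {i, j} * \<alpha> i * \<alpha> j"
  shows "eta_equiv \<eta> \<eta>'"
proof -
  \<comment> \<open>Degree 0 gets the factor 1, so that every factor is invertible.\<close>
  define a where "a g = (if g = 0 then 1 else \<alpha> (idx g))" for g
  have a: "a g \<noteq> 0" for g using nz I7_idx by (simp add: a_def)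
  show ?thesis unfolding eta_equiv_def
  proof (rule gc_equivI[where \<sigma> = id and F = "\<lambda>g. scaleE (a g)"])
    show "bij_betw (scaleE (a g)) (Der_grade g) (Der_grade (id g))" for g
      using a[of g] by (intro bij_betwI[where g = "scaleE (1 / a g)"]) (simp_all add: Der_grade_scale)
    show "scaleE (a (g + h)) (scaleE (eps \<eta> g h) (commutator x y)) =
        scaleE (eps \<eta>' (id g) (id h)) (commutator (scaleE (a g) x) (scaleE (a h) y))"
      if xy: "x \<in> Der_grade g" "y \<in> Der_grade h" for g h x y
    proof -
      have "a (g + h) * eps \<eta> g h = eps \<eta>' g h * a g * a h"
      proof (cases "g = 0 \<or> h = 0 \<or> g = h")
        case False
        then have "\<eta> {idx g, idx h} * \<alpha> (idx g \<star> idx h) = \<eta>' {idx g, idx h} * \<alpha> (idx g) * \<alpha> (idx h)"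
          by (intro eq) (simp_all add: I7_idx, metis gel_idx)
        with False show ?thesis by (simp add: a_def eps_nz star_idx mult.commute)
      qed auto
      then show ?thesis
        using xy by (simp add: commutator_scale Der_scale Der_gradeD)
    qed
  qed (simp_all add: scaleE_add mult.commute)
qed

text \<open>The assumption on signs says that A, sending e_g to s g times e_{\<open>\<sigma>\<close>
  g}, is an automorphism of the octonions. The equivalence is d -> A d A^{-1}, which turns the
  coefficients c into \<open>tr g c\<close>.\<close>

lemma gc_equiv_signed_aut:
  assumes \<sigma>: "bij \<sigma>" and \<sigma>_add: "\<And>g h. \<sigma> (g + h) = \<sigma> g + \<sigma> h"
    and s2: "\<And>g. s g * s g = (1 :: complex)"
    and sig: "\<And>g h. s g * s h * osg (\<sigma> g) (\<sigma> h) = s (g + h) * osg g h"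
    and eps: "\<And>g h. \<epsilon>' (\<sigma> g) (\<sigma> h) = \<epsilon> g h"
  shows "gc_equiv \<epsilon> \<epsilon>'"
proof -
  define \<tau> where "\<tau> = inv \<sigma>"
  have \<tau>: "\<sigma> (\<tau> g) = g" "\<tau> (\<sigma> g) = g" for g
    using \<sigma> by (simp_all add: \<tau>_def bij_def surj_f_inv_f)
  define tr where "tr g c = (\<lambda>m. c (\<tau> m) * s (g + \<tau> m) * s (\<tau> m))" for g and c :: "grp \<Rightarrow> complex"
  have tr: "tr g c (\<sigma> n) = c n * s (g + n) * s n" for g c n by (simp add: tr_def \<tau>)
  have sig': "osg (\<sigma> g) (\<sigma> h) = s g * s h * s (g + h) * osg g h" for g h
  proof -
    have "osg (\<sigma> g) (\<sigma> h) = (s g * s g) * (s h * s h) * osg (\<sigma> g) (\<sigma> h)" by (simp add: s2)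
    also have "\<dots> = s g * s h * (s g * s h * osg (\<sigma> g) (\<sigma> h))" by (simp add: mult_ac)
    finally show ?thesis unfolding sig by (simp add: mult_ac)
  qed
  have all\<sigma>: "(\<forall>m n. P m n) \<longleftrightarrow> (\<forall>h k. P (\<sigma> h) (\<sigma> k))" for P by (metis \<tau>(1))
  have sa: "x * (s g * (s g * y)) = x * y" "s g * (s g * y) = y" for x y g
    using s2[of g] by (simp_all flip: mult.assoc)
  have dtr: "dcond (\<sigma> g) (tr g c) \<longleftrightarrow> dcond g c" for g c
  proof -
    have "(tr g c (\<sigma> h + \<sigma> k) * osg (\<sigma> h) (\<sigma> k) =
        tr g c (\<sigma> h) * osg (\<sigma> g + \<sigma> h) (\<sigma> k) + tr g c (\<sigma> k) * osg (\<sigma> h) (\<sigma> g + \<sigma> k)) \<longleftrightarrow>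
      (c (h + k) * osg h k = c h * osg (g + h) k + c k * osg h (g + k))" for h k
    proof -
      \<comment> \<open>All three terms of the transported Leibniz condition acquire this same sign,
        which cancels.\<close>
      define u where "u = s h * s k * s (g + (h + k))"
      have u: "u \<noteq> 0" using s2 unfolding u_def by (metis mult_eq_0_iff zero_neq_one)
      have "tr g c (\<sigma> h + \<sigma> k) * osg (\<sigma> h) (\<sigma> k) = u * (c (h + k) * osg h k)"
        unfolding \<sigma>_add[symmetric] tr sig' u_def by (simp add: mult_ac sa)
      moreover have "tr g c (\<sigma> h) * osg (\<sigma> g + \<sigma> h) (\<sigma> k) = u * (c h * osg (g + h) k)"
        unfolding \<sigma>_add[symmetric] tr sig' u_def by (simp add: mult_ac sa add.assoc)
      moreover have "tr g c (\<sigma> k) * osg (\<sigma> h) (\<sigma> g + \<sigma> k) = u * (c k * osg h (g + k))"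
        unfolding \<sigma>_add[symmetric] tr sig' u_def by (simp add: mult_ac sa add.left_commute)
      ultimately show ?thesis using u by (simp flip: distrib_left)
    qed
    note * = this
    show ?thesis unfolding dcond_def[of "\<sigma> g"] dcond_def[of g] by (subst all\<sigma>) (simp only: *)
  qed
  have tr_surj: "tr g (\<lambda>n. c (\<sigma> n) * s (g + n) * s n) = c" for g c
  proof
    fix m show "tr g (\<lambda>n. c (\<sigma> n) * s (g + n) * s n) m = c m"
      unfolding tr_def \<tau> by (simp add: mult_ac sa s2)
  qed
  have tr_inj: "c = c'" if "tr g c = tr g c'" for g c c'
  proof
    fix n
    have "c n * s (g + n) * s n = c' n * s (g + n) * s n" using that tr by metis
    moreover have "s (g + n) \<noteq> 0" "s n \<noteq> 0" using s2 by (metis mult_eq_0_iff zero_neq_one)+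
    ultimately show "c n = c' n" by simp
  qed
  define F where "F g d = hop (\<sigma> g) (tr g (mat_coeff g d))" for g d
  have F: "F g (hop g c) = hop (\<sigma> g) (tr g c)" for g c by (simp add: F_def mat_coeff_hop)
  show ?thesis
  proof (rule gc_equivI[OF \<sigma>, where F = F])
    fix g
    show "bij_betw (F g) (Der_grade g) (Der_grade (\<sigma> g))"
    proof (rule bij_betw_imageI)
      show "inj_on (F g) (Der_grade g)"
        unfolding Der_grade_eq by (rule inj_onI) (auto simp: F hop_eq_iff dest: tr_inj)
      show "F g ` Der_grade g = Der_grade (\<sigma> g)"
      proof (intro equalityI subsetI)
        fix d assume "d \<in> F g ` Der_grade g"
        then show "d \<in> Der_grade (\<sigma> g)" unfolding Der_grade_eq by (auto simp: F dtr)
      next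
        fix d assume "d \<in> Der_grade (\<sigma> g)"
        then obtain c where c: "d = hop (\<sigma> g) c" "dcond (\<sigma> g) c" by (elim Der_gradeE)
        let ?c = "\<lambda>n. c (\<sigma> n) * s (g + n) * s n"
        have "d = F g (hop g ?c)" unfolding F tr_surj c(1) ..
        moreover have "hop g ?c \<in> Der_grade g"
          using c(2) by (intro hop_in_Der_grade) (simp only: dtr[of g ?c, symmetric] tr_surj)
        ultimately show "d \<in> F g ` Der_grade g" by blast
      qed
    qed
    show "F g (x + y) = F g x + F g y" if "x \<in> Der_grade g" "y \<in> Der_grade g" for x y
      using that by (elim Der_gradeE) (simp add: hop_add F, simp add: tr_def algebra_simps)
    show "F g (scaleE a x) = scaleE a (F g x)" if "x \<in> Der_grade g" for a x
      using that by (elim Der_gradeE) (simp add: hop_scale F, simp add: tr_def algebra_simps)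
    fix h x y assume x: "x \<in> Der_grade g" and y: "y \<in> Der_grade h"
    obtain c c' where c: "x = hop g c" "y = hop h c'" using x y by (elim Der_gradeE)
    have k: "kom (\<sigma> g) (\<sigma> h) (tr g c) (tr h c') = tr (g + h) (kom g h c c')"
    proof -
      have "kom (\<sigma> g) (\<sigma> h) (tr g c) (tr h c') (\<sigma> n) = tr (g + h) (kom g h c c') (\<sigma> n)" for n
        unfolding kom_def \<sigma>_add[symmetric] tr by (simp add: algebra_simps sa add.left_commute)
      then show ?thesis by (metis \<tau>(1) ext)
    qed
    show "F (g + h) (scaleE (\<epsilon> g h) (commutator x y)) = scaleE (\<epsilon>' (\<sigma> g) (\<sigma> h)) (commutator (F g x) (F h y))"
      unfolding c F commutator_hop k eps hop_scale by (simp only: \<sigma>_add) (simp add: tr_def algebra_simps)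
  qed
qed

section \<open>Collineations of the Fano plane and their lifts to the octonions\<close>

definition coll :: "(nat \<Rightarrow> nat) \<Rightarrow> bool" where
  "coll \<pi> \<longleftrightarrow> bij_betw \<pi> I7 I7 \<and> (\<forall>i\<in>I7. \<forall>j\<in>I7. i \<noteq> j \<longrightarrow> \<pi> (i \<star> j) = \<pi> i \<star> \<pi> j)"

text \<open>Values at 0, ..., 7 of the linear map of Z_2^3 determined by the images a, b, c of 1, 2,
  3; recall that g_4 = g_1 + g_2 + g_3.\<close>

definition col_list :: "nat \<Rightarrow> nat \<Rightarrow> nat \<Rightarrow> nat list" where
  "col_list a b c = [0, a, b, c, xo a (xo b c), xo a b, xo a c, xo b c]"

text \<open>The signs \<open>s\<^sub>i\<close> of the automorphism \<open>e\<^sub>i \<mapsto> s\<^sub>i e\<^bsub>\<pi> i\<^esub>\<close> with \<open>s\<^sub>1 = s\<^sub>2 = s\<^sub>3 = 1\<close>, read off from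
  \<open>e\<^sub>5 = e\<^sub>1 e\<^sub>2\<close>, \<open>e\<^sub>6 = e\<^sub>1 e\<^sub>3\<close>, \<open>e\<^sub>7 = - e\<^sub>2 e\<^sub>3\<close>, \<open>e\<^sub>4 = e\<^sub>1 e\<^sub>7\<close>.\<close>

definition sgn_list :: "nat \<Rightarrow> nat \<Rightarrow> nat \<Rightarrow> int list" where
  "sgn_list a b c = [1, 1, 1, 1, - sgn8 b c * sgn8 a (xo b c), sgn8 a b, sgn8 a c, - sgn8 b c]"

text \<open>The 7 * 6 * 4 = 168 ordered generative triples, one for each element of GL(3,2).\<close>

definition gen_all :: "(nat \<times> nat \<times> nat) list" where
  "gen_all = [(1,2,3), (1,2,4), (1,2,6), (1,2,7), (1,3,2), (1,3,4), (1,3,5), (1,3,7), (1,4,2),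
    (1,4,3), (1,4,5), (1,4,6), (1,5,3), (1,5,4), (1,5,6), (1,5,7), (1,6,2), (1,6,4), (1,6,5),
    (1,6,7), (1,7,2), (1,7,3), (1,7,5), (1,7,6), (2,1,3), (2,1,4), (2,1,6), (2,1,7), (2,3,1),
    (2,3,4), (2,3,5), (2,3,6), (2,4,1), (2,4,3), (2,4,5), (2,4,7), (2,5,3), (2,5,4), (2,5,6),
    (2,5,7), (2,6,1), (2,6,3), (2,6,5), (2,6,7), (2,7,1), (2,7,4), (2,7,5), (2,7,6), (3,1,2),
    (3,1,4), (3,1,5), (3,1,7), (3,2,1), (3,2,4), (3,2,5), (3,2,6), (3,4,1), (3,4,2), (3,4,6),
    (3,4,7), (3,5,1), (3,5,2), (3,5,6), (3,5,7), (3,6,2), (3,6,4), (3,6,5), (3,6,7), (3,7,1),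
    (3,7,4), (3,7,5), (3,7,6), (4,1,2), (4,1,3), (4,1,5), (4,1,6), (4,2,1), (4,2,3), (4,2,5),
    (4,2,7), (4,3,1), (4,3,2), (4,3,6), (4,3,7), (4,5,1), (4,5,2), (4,5,6), (4,5,7), (4,6,1),
    (4,6,3), (4,6,5), (4,6,7), (4,7,2), (4,7,3), (4,7,5), (4,7,6), (5,1,3), (5,1,4), (5,1,6),
    (5,1,7), (5,2,3), (5,2,4), (5,2,6), (5,2,7), (5,3,1), (5,3,2), (5,3,6), (5,3,7), (5,4,1),
    (5,4,2), (5,4,6), (5,4,7), (5,6,1), (5,6,2), (5,6,3), (5,6,4), (5,7,1), (5,7,2), (5,7,3),
    (5,7,4), (6,1,2), (6,1,4), (6,1,5), (6,1,7), (6,2,1), (6,2,3), (6,2,5), (6,2,7), (6,3,2),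
    (6,3,4), (6,3,5), (6,3,7), (6,4,1), (6,4,3), (6,4,5), (6,4,7), (6,5,1), (6,5,2), (6,5,3),
    (6,5,4), (6,7,1), (6,7,2), (6,7,3), (6,7,4), (7,1,2), (7,1,3), (7,1,5), (7,1,6), (7,2,1),
    (7,2,4), (7,2,5), (7,2,6), (7,3,1), (7,3,4), (7,3,5), (7,3,6), (7,4,2), (7,4,3), (7,4,5),
    (7,4,6), (7,5,1), (7,5,2), (7,5,3), (7,5,4), (7,6,1), (7,6,2), (7,6,3), (7,6,4)]"

lemma gen_all_complete:
  "\<forall>i\<le>7. \<forall>j\<le>7. \<forall>k\<le>7. i \<noteq> 0 \<and> j \<noteq> 0 \<and> k \<noteq> 0 \<and> i \<noteq> j \<and> j \<noteq> k \<and> i \<noteq> k \<and> k \<noteq> xo i j \<longrightarrow>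
    (i, j, k) \<in> set gen_all"
  unfolding ball_le7_list by code_simp

lemma sgn_list_aut:
  "list_all (\<lambda>(a, b, c). let P = col_list a b c; S = sgn_list a b c in
     list_all (\<lambda>i. S ! i * S ! i = 1 \<and> list_all (\<lambda>j. S ! i * S ! j * sgn8 (P ! i) (P ! j) = S ! (xo i j) * sgn8 i j)
       [0,1,2,3,4,5,6,7]) [0,1,2,3,4,5,6,7]) gen_all"
  by code_simp

lemma collD:
  assumes "coll \<pi>"
  shows "i \<in> I7 \<Longrightarrow> \<pi> i \<in> I7" "i \<in> I7 \<Longrightarrow> j \<in> I7 \<Longrightarrow> \<pi> i = \<pi> j \<longleftrightarrow> i = j"
    "i \<in> I7 \<Longrightarrow> j \<in> I7 \<Longrightarrow> i \<noteq> j \<Longrightarrow> \<pi> (i \<star> j) = \<pi> i \<star> \<pi> j"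
  using assms by (auto simp: coll_def bij_betw_def inj_on_def)

lemma coll_col_list:
  assumes "coll \<pi>"
  shows "(\<pi> 1, \<pi> 2, \<pi> 3) \<in> set gen_all"
    and "i \<in> I7 \<Longrightarrow> \<pi> i = col_list (\<pi> 1) (\<pi> 2) (\<pi> 3) ! i"
proof -
  have I: "1 \<in> I7" "2 \<in> I7" "3 \<in> I7" "4 \<in> I7" "5 \<in> I7" "6 \<in> I7" "7 \<in> I7" by (simp_all add: I7_def)
  have st: "1 \<star> 2 = 5" "1 \<star> 3 = 6" "2 \<star> 3 = 7" "1 \<star> 7 = 4"
    by (simp_all add: star_eq_xo I del: One_nat_def) (simp_all add: xo_def xtab_def)
  have x: "\<pi> (i \<star> j) = xo (\<pi> i) (\<pi> j)" if "i \<in> I7" "j \<in> I7" "i \<noteq> j" for i j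
    using collD[OF assms] that by (simp add: star_eq_xo)
  have e: "\<pi> 5 = xo (\<pi> 1) (\<pi> 2)" "\<pi> 6 = xo (\<pi> 1) (\<pi> 3)" "\<pi> 7 = xo (\<pi> 2) (\<pi> 3)" "\<pi> 4 = xo (\<pi> 1) (\<pi> 7)"
    using x[of 1 2] x[of 1 3] x[of 2 3] x[of 1 7] I by (simp_all add: st del: One_nat_def)
  have "\<pi> 1 \<noteq> \<pi> 2" "\<pi> 2 \<noteq> \<pi> 3" "\<pi> 1 \<noteq> \<pi> 3" "\<pi> 3 \<noteq> xo (\<pi> 1) (\<pi> 2)"
    unfolding e(1)[symmetric] using collD(2)[OF assms] I by simp_all
  then show "(\<pi> 1, \<pi> 2, \<pi> 3) \<in> set gen_all"
    using gen_all_complete[rule_format, of "\<pi> 1" "\<pi> 2" "\<pi> 3"]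
      collD(1)[OF assms I(1)] collD(1)[OF assms I(2)] collD(1)[OF assms I(3)]
    by (auto simp: I7_def)
  assume "i \<in> I7"
  then have "i \<in> {1,2,3,4,5,6,7}" by (auto simp: I7_def)
  then show "\<pi> i = col_list (\<pi> 1) (\<pi> 2) (\<pi> 3) ! i"
    by (elim insertE emptyE) (simp_all add: col_list_def e)
qed

lemma coll_equiv:
  assumes \<pi>: "coll \<pi>" and eq: "\<And>i j. i \<in> I7 \<Longrightarrow> j \<in> I7 \<Longrightarrow> i \<noteq> j \<Longrightarrow> \<eta>' {\<pi> i, \<pi> j} = \<eta> {i, j}"
  shows "eta_equiv \<eta> \<eta>'"
proof -
  let ?P = "col_list (\<pi> 1) (\<pi> 2) (\<pi> 3)" and ?S = "sgn_list (\<pi> 1) (\<pi> 2) (\<pi> 3)"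
  have aut: "list_all (\<lambda>i. ?S ! i * ?S ! i = 1 \<and>
      list_all (\<lambda>j. ?S ! i * ?S ! j * sgn8 (?P ! i) (?P ! j) = ?S ! (xo i j) * sgn8 i j)
       [0,1,2,3,4,5,6,7]) [0,1,2,3,4,5,6,7]"
    using sgn_list_aut coll_col_list(1)[OF \<pi>] unfolding list_all_iff Let_def by blast
  have S2: "?S ! i * ?S ! i = 1" if "i \<le> 7" for i
    using aut that unfolding ball_le7_list[symmetric] by blast
  have SS: "?S ! i * ?S ! j * sgn8 (?P ! i) (?P ! j) = ?S ! (xo i j) * sgn8 i j" if "i \<le> 7" "j \<le> 7" for i j
    using aut that unfolding ball_le7_list[symmetric] by blast
  define \<sigma> where "\<sigma> g = (if g = 0 then 0 else gel (\<pi> (idx g)))" for g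
  define s where "s g = (of_int (?S ! idx g) :: complex)" for g
  have \<pi>I: "\<pi> (idx g) \<in> I7" if "g \<noteq> 0" for g using that collD(1)[OF \<pi>] I7_idx by blast
  have \<sigma>0: "\<sigma> g = 0 \<longleftrightarrow> g = 0" for g using gel_nonzero[OF \<pi>I] by (simp add: \<sigma>_def)
  have idx\<sigma>: "idx (\<sigma> g) = ?P ! idx g" for g
  proof (cases "g = 0")
    case False
    then show ?thesis using \<pi>I[OF False] coll_col_list(2)[OF \<pi>, of "idx g"]
      by (simp add: \<sigma>_def I7_le I7_idx)
  qed (simp add: \<sigma>_def col_list_def)
  have \<sigma>_inj: "\<sigma> g = \<sigma> h \<longleftrightarrow> g = h" for g h
  proof
    assume e: "\<sigma> g = \<sigma> h"
    show "g = h"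
    proof (cases "g = 0 \<or> h = 0")
      case False
      then have "\<pi> (idx g) = \<pi> (idx h)"
        using e gel_inj \<pi>I[of g] \<pi>I[of h] I7_le unfolding \<sigma>_def by auto
      then show ?thesis using collD(2)[OF \<pi>] False I7_idx by (metis gel_idx)
    qed (use e \<sigma>0 in metis)
  qed simp
  have inj: "inj \<sigma>" by (rule injI) (simp only: \<sigma>_inj)
  have bij: "bij \<sigma>" by (rule bijI[OF inj finite_UNIV_inj_surj[OF _ inj]]) simp
  have add: "\<sigma> (g + h) = \<sigma> g + \<sigma> h" for g h
  proof (cases "g = 0 \<or> h = 0 \<or> g = h")
    case False
    then have n: "g \<noteq> 0" "h \<noteq> 0" "g \<noteq> h" "idx g \<noteq> idx h" by (auto dest: arg_cong[of _ _ gel])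
    then have "\<pi> (idx (g + h)) = \<pi> (idx g) \<star> \<pi> (idx h)"
      using collD(3)[OF \<pi>, of "idx g" "idx h"] by (simp add: I7_idx star_idx)
    moreover have "gel (\<pi> (idx g) \<star> \<pi> (idx h)) = gel (\<pi> (idx g)) + gel (\<pi> (idx h))"
      using n collD(2)[OF \<pi>, of "idx g" "idx h"] by (intro gel_star \<pi>I) (simp_all add: I7_idx)
    ultimately show ?thesis using n by (simp add: \<sigma>_def)
  qed (auto simp: \<sigma>_def)
  show ?thesis unfolding eta_equiv_def
  proof (rule gc_equiv_signed_aut[OF bij add])
    show "s g * s g = 1" for g
      unfolding s_def of_int_mult[symmetric] using S2[OF idx_le] by simp
    show "s g * s h * osg (\<sigma> g) (\<sigma> h) = s (g + h) * osg g h" for g h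
    proof -
      have "osg (\<sigma> g) (\<sigma> h) = of_int (sgn8 (?P ! idx g) (?P ! idx h))"
        unfolding idx\<sigma>[symmetric] by (intro oct_sign_sgn8 idx_le)
      then show ?thesis using SS[OF idx_le idx_le, of g h]
        unfolding s_def oct_sign_sgn8[OF idx_le idx_le] idx_add by (simp only: of_int_mult[symmetric])
    qed
    show "eps \<eta>' (\<sigma> g) (\<sigma> h) = eps \<eta> g h" for g h
    proof (cases "g = 0 \<or> h = 0 \<or> g = h")
      case False
      then have n: "g \<noteq> 0" "h \<noteq> 0" "g \<noteq> h" "idx g \<noteq> idx h" by (auto dest: arg_cong[of _ _ gel])
      have "eps \<eta>' (\<sigma> g) (\<sigma> h) = \<eta>' {\<pi> (idx g), \<pi> (idx h)}"
        using n \<sigma>0 \<sigma>_inj \<pi>I by (simp add: eps_nz) (simp add: \<sigma>_def I7_le)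
      then show ?thesis using eq[of "idx g" "idx h"] n by (simp add: eps_nz I7_idx)
    qed (auto simp: \<sigma>_def)
  qed
qed

section \<open>An equivalence that is not a collineation\<close>

lemma Der_grade_dsolE:
  assumes "x \<in> Der_grade (gel i)" "i \<in> I7"
  obtains a b where "x = hop (gel i) (dsol i a b)"
proof -
  obtain c where c: "x = hop (gel i) c" "dcond (gel i) c" using assms(1) by (elim Der_gradeE)
  have "c = dsol i (c (gel (fone i))) (c (gel (ftwo i)))"
    using assms(2) by (intro dcond_imp_dsol c(2)) (auto simp: I7_def)
  then show ?thesis using that[OF trans[OF c(1) arg_cong[of _ _ "hop (gel i)"]]] by blast
qed

lemma dsol_in: "i \<in> I7 \<Longrightarrow> hop (gel i) (dsol i a b) \<in> Der_grade (gel i)"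
  by (intro hop_in_Der_grade dcond_dsol I7_le)

text \<open>At the coordinates (2, 1) of \<open>wder 1\<close> the two roots that belong to the
  components 4 and 7, namely a + b and a - b, are 3 and 1; hence both maps are invertible.\<close>

lemma ad_wder_47:
  "commutator (hop (gel 1) (wder 1)) (hop (gel 4) (dsol 4 p q)) = hop (gel 7) (dsol 7 (- 3 * p) (2 * p + q))"
  "commutator (hop (gel 1) (wder 1)) (hop (gel 7) (dsol 7 p q)) = hop (gel 4) (dsol 4 (3 * p) (- 2 * p - q))"
proof -
  have g: "gel 1 + gel 4 = gel 7" "gel 1 + gel 7 = gel 4" by (simp_all add: gel_add xo_def xtab_def)
  have "kom (gel 1) (gel 4) (wder 1) (dsol 4 p q) = dsol 7 (- 3 * p) (2 * p + q)"
    by (rule dsol_eqI) (simp add: ball_le7 wder_eq kom_gel dsol_gel xo_def xtab_def utab_def vtab_def algebra_simps)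
  moreover have "kom (gel 1) (gel 7) (wder 1) (dsol 7 p q) = dsol 4 (3 * p) (- 2 * p - q)"
    by (rule dsol_eqI) (simp add: ball_le7 wder_eq kom_gel dsol_gel xo_def xtab_def utab_def vtab_def algebra_simps)
  ultimately show "commutator (hop (gel 1) (wder 1)) (hop (gel 4) (dsol 4 p q)) = hop (gel 7) (dsol 7 (- 3 * p) (2 * p + q))"
    "commutator (hop (gel 1) (wder 1)) (hop (gel 7) (dsol 7 p q)) = hop (gel 4) (dsol 4 (3 * p) (- 2 * p - q))"
    unfolding commutator_hop g by simp_all
qed

lemma dsol_eq_iff:
  assumes "i \<in> I7" shows "dsol i a b = dsol i a' b' \<longleftrightarrow> a = a' \<and> b = b'"
proof
  assume e: "dsol i a b = dsol i a' b'"
  have "i \<in> {1,2,3,4,5,6,7}" using assms by (auto simp: I7_def)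
  then show "a = a' \<and> b = b'"
    using fun_cong[OF e, of "gel (fone i)"] fun_cong[OF e, of "gel (ftwo i)"]
    by (elim insertE emptyE; simp add: dsol_gel fone_def ftwo_def utab_def vtab_def)
qed simp

text \<open>For generic \<open>w\<close> of degree \<open>g\<^sub>1\<close>, the map that is \<open>ad w\<close> on the components of degrees \<open>g\<^sub>4\<close>, \<open>g\<^sub>7\<close> and
  the identity elsewhere is an isomorphism which interchanges these two components.\<close>

lemma T8_equiv_T10: "eta_equiv (eta_ind (T_set 8)) (eta_ind (T_set 10))"
proof -
  define w where "w = hop (gel 1) (wder 1)"
  have w: "w \<in> Der_grade (gel 1)" "w \<in> Der" unfolding w_def using wder_in[of 1] Der_gradeD by auto
  define S where "S = {gel 4, gel 7}"
  \<comment> \<open>Not additive: g_4 + g_2 = g_6 is fixed, although g_7 + g_2 = g_3.\<close>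
  define \<sigma> where "\<sigma> g = (if g = gel 4 then gel 7 else if g = gel 7 then gel 4 else g)" for g
  define F where "F g = (if g \<in> S then commutator w else id)" for g
  have g: "gel 1 + gel 4 = gel 7" "gel 1 + gel 7 = gel 4" by (simp_all add: gel_add xo_def xtab_def)
  have I: "4 \<in> I7" "7 \<in> I7" by (simp_all add: I7_def)
  have \<sigma>\<sigma>: "\<sigma> (\<sigma> g) = g" for g by (simp add: \<sigma>_def gel_eq_iff)
  have bij4: "bij_betw (commutator w) (Der_grade (gel 4)) (Der_grade (gel 7))"
  proof (rule bij_betw_imageI)
    show "inj_on (commutator w) (Der_grade (gel 4))"
      by (rule inj_onI, elim Der_grade_dsolE[OF _ I(1)])
        (simp add: w_def ad_wder_47 hop_eq_iff dsol_eq_iff I del: One_nat_def)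
    show "commutator w ` Der_grade (gel 4) = Der_grade (gel 7)"
    proof (intro equalityI subsetI)
      fix x assume "x \<in> commutator w ` Der_grade (gel 4)"
      then show "x \<in> Der_grade (gel 7)"
        using commutator_in_Der_grade[OF w(1), of _ "gel 4"] unfolding g by blast
    next
      fix x assume "x \<in> Der_grade (gel 7)"
      then obtain a b where "x = hop (gel 7) (dsol 7 a b)" by (rule Der_grade_dsolE[OF _ I(2)])
      \<comment> \<open>The preimage inverts the triangular matrix of
        \<open>ad_wder_47\<close>.\<close>
      then have "x = commutator w (hop (gel 4) (dsol 4 (- a / 3) (b + 2 * a / 3)))"
        unfolding w_def ad_wder_47 by simp
      then show "x \<in> commutator w ` Der_grade (gel 4)" using dsol_in[OF I(1)] by blast
    qed
  qed
  have bij7: "bij_betw (commutator w) (Der_grade (gel 7)) (Der_grade (gel 4))"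
  proof (rule bij_betw_imageI)
    show "inj_on (commutator w) (Der_grade (gel 7))"
      by (rule inj_onI, elim Der_grade_dsolE[OF _ I(2)])
        (simp add: w_def ad_wder_47 hop_eq_iff dsol_eq_iff I del: One_nat_def)
    show "commutator w ` Der_grade (gel 7) = Der_grade (gel 4)"
    proof (intro equalityI subsetI)
      fix x assume "x \<in> commutator w ` Der_grade (gel 7)"
      then show "x \<in> Der_grade (gel 4)"
        using commutator_in_Der_grade[OF w(1), of _ "gel 7"] unfolding g by blast
    next
      fix x assume "x \<in> Der_grade (gel 4)"
      then obtain a b where "x = hop (gel 4) (dsol 4 a b)" by (rule Der_grade_dsolE[OF _ I(1)])
      then have "x = commutator w (hop (gel 7) (dsol 7 (a / 3) (- b - 2 * a / 3)))"
        unfolding w_def ad_wder_47 by simp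
      then show "x \<in> commutator w ` Der_grade (gel 7)" using dsol_in[OF I(2)] by blast
    qed
  qed
  let ?e = "eps (eta_ind (T_set 8))" and ?e' = "eps (eta_ind (T_set 10))"
  have tab: "\<forall>i\<le>7. \<forall>j\<le>7. ?e (gel i) (gel j) =
      (if {i, j} \<in> {{1,2}, {1,3}, {1,4}} then 1 else 0)"
    unfolding ball_le7 by (simp add: eps_def eta_ind_def T_set_def I7_def doubleton_eq_iff)
  have tab': "\<forall>i\<le>7. \<forall>j\<le>7. ?e' (\<sigma> (gel i)) (\<sigma> (gel j)) = ?e (gel i) (gel j)"
    unfolding ball_le7 by (simp add: \<sigma>_def gel_eq_iff eps_def eta_ind_def T_set_def I7_def doubleton_eq_iff)
  have F_S: "F k x = (if k \<in> S then commutator w x else x)" for k x by (simp add: F_def)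
  have lin0: "commutator w 0 = 0" using commutator_scale(2)[OF w(2), of 0 0] by (simp only: endo.scale_zero_left)
  show ?thesis unfolding eta_equiv_def
  proof (rule gc_equivI[where \<sigma> = \<sigma> and F = F])
    show "bij \<sigma>" by (rule o_bij[of \<sigma>]) (simp_all add: fun_eq_iff \<sigma>\<sigma>)
    show "bij_betw (F k) (Der_grade k) (Der_grade (\<sigma> k))" for k
      using bij4 bij7 by (simp add: F_def \<sigma>_def S_def gel_eq_iff)
    show "F k (x + y) = F k x + F k y" if "x \<in> Der_grade k" "y \<in> Der_grade k" for k x y
      using w by (simp add: F_S commutator_add)
    show "F k (scaleE c x) = scaleE c (F k x)" if "x \<in> Der_grade k" for k c x
      using w by (simp add: F_S commutator_scale)
    fix k l x y assume x: "x \<in> Der_grade k" and y: "y \<in> Der_grade l"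
    obtain i j where i: "i \<le> 7" "k = gel i" and j: "j \<le> 7" "l = gel j" by (metis gel_surj)
    \<comment> \<open>The component of degree g_1 is abelian, so w commutes with a, and ad w, being
      a derivation, commutes with ad a.\<close>
    have comm1: "commutator u v = commutator w (commutator a b)" 
      if "u = a" "v = commutator w b" "a \<in> Der_grade (gel 1)" "b \<in> Der_grade m" for u v a b m
    proof -
      have "commutator w a = 0" using commutator_same_grade[OF w(1) that(3)] .
      then have "commutator b (commutator w a) = 0"
        using commutator_scale(2)[OF Der_gradeD[OF that(4)], of 0 0] by (simp only: endo.scale_zero_left)
      moreover have "commutator a (commutator b w) = - commutator a (commutator w b)"
      proof -
        have "commutator b w = scaleE (- 1) (commutator w b)"
          unfolding commutator_swap[of b w] by (rule endo.scale_minus_left[of 1, unfolded endo.scale_one, symmetric])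
        then show ?thesis using commutator_scale(2)[OF Der_gradeD[OF that(3)], of "-1" "commutator w b"]
          by (simp only: endo.scale_minus_left endo.scale_one)
      qed
      ultimately show ?thesis using commutator_jacobi[OF w(1) that(3,4)] that(1,2) by simp
    qed
    have e': "?e' (\<sigma> k) (\<sigma> l) = ?e k l" using tab' i j by blast
    have "F (k + l) (commutator x y) = commutator (F k x) (F l y)" if nz: "?e k l \<noteq> 0"
    proof -
      have "{i, j} \<in> {{1,2}, {1,3}, {1,4}}" using nz tab i j by metis
      \<comment> \<open>The edges {1,2} and {1,3} have products of degrees 5 and 6, so nothing there
        is twisted. On {1,4} one factor and the product, of degree 7, are both twisted by ad
        w.\<close>
      then consider "i = 1 \<and> j \<in> {2,3} \<or> j = 1 \<and> i \<in> {2,3}" | "i = 1" "j = 4" | "i = 4" "j = 1"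
        by (auto simp: doubleton_eq_iff)
      then show ?thesis
      proof cases
        case 1
        then have "k \<notin> S" "l \<notin> S" "k + l \<notin> S"
          using i j by (auto simp: S_def gel_eq_iff gel_add xo_def xtab_def)
        then show ?thesis by (simp add: F_S)
      next
        case 2
        then have "k \<notin> S" "l \<in> S" "k + l \<in> S"
          using i j by (auto simp: S_def gel_eq_iff gel_add xo_def xtab_def)
        then show ?thesis using comm1[of x x _ y l] x y i 2 by (simp add: F_S)
      next
        case 3
        then have "k \<in> S" "l \<notin> S" "k + l \<in> S"
          using i j by (auto simp: S_def gel_eq_iff gel_add xo_def xtab_def)
        then show ?thesis
          using comm1[of y y _ x k] x y j 3 commutator_swap[of "commutator w x" y] commutator_swap[of x y]
            commutator_scale(2)[OF w(2), of "-1" "commutator y x"]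
          by (simp add: F_S)
      qed
    qed
    note * = this
    have sc: "F (k + l) (scaleE c z) = scaleE c (F (k + l) z)" for c z
      using w by (simp add: F_S commutator_scale)
    show "F (k + l) (scaleE (?e k l) (commutator x y)) = scaleE (?e' (\<sigma> k) (\<sigma> l)) (commutator (F k x) (F l y))"
    proof (cases "?e k l = 0")
      case True
      show ?thesis unfolding e' True endo.scale_zero_left by (simp only: F_S lin0 if_cancel)
    next
      case False
      show ?thesis unfolding e' sc *[OF False] by (rule refl)
    qed
  qed
qed

section \<open>The quadratic forms of the tori\<close>

text \<open>Equality of traces of conjugate matrices: the first four hypotheses state that the
  matrix of the P's and Q's intertwines l times one triangular matrix with l' times another.
  Multiplying by its determinant avoids writing the inverse.\<close>

lemma trace_transfer:
  fixes P1 :: complex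
  assumes "l * (m * P1 + n * P2) = l' * (m' * P1)" "l * (m * Q1 + n * Q2) = l' * (n' * P1 + r' * Q1)"
    "l * (r * P2) = l' * (m' * P2)" "l * (r * Q2) = l' * (n' * P2 + r' * Q2)"
    and D: "P1 * Q2 - P2 * Q1 \<noteq> 0"
  shows "l * (m + r) = l' * (m' + r')"
proof -
  have "(P1 * Q2 - P2 * Q1) * (l * (m + r)) = (P1 * Q2 - P2 * Q1) * (l' * (m' + r'))"
    using assms(1-4) by algebra
  with D show ?thesis by simp
qed

text \<open>Two binary quadratic forms and the forms they are transported to by a common linear
  substitution of determinant \<open>\<Delta>\<close>: the discriminant and its polarization are multiplied by \<open>\<Delta>\<^sup>2\<close>.\<close>

lemma forms_ratio:
  fixes l1 :: complex
  assumes nz: "l1 \<noteq> 0" "l1' \<noteq> 0"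
    and d: "4 * A1 * C1 - B1\<^sup>2 = 4" "4 * A1' * C1' - B1'\<^sup>2 = 4"
    and pol: "2 * (A1 * C2 + A2 * C1) - B1 * B2 = 6" "2 * (A1' * C2' + A2' * C1') - B1' * B2' = 6"
    and f1: "\<And>a b. l1 * (A1 * a\<^sup>2 + B1 * a * b + C1 * b\<^sup>2) =
      l1' * (A1' * (p * a + q * b)\<^sup>2 + B1' * (p * a + q * b) * (r * a + t * b) + C1' * (r * a + t * b)\<^sup>2)"
    and f2: "\<And>a b. l2 * (A2 * a\<^sup>2 + B2 * a * b + C2 * b\<^sup>2) =
      l2' * (A2' * (p * a + q * b)\<^sup>2 + B2' * (p * a + q * b) * (r * a + t * b) + C2' * (r * a + t * b)\<^sup>2)"
  shows "l1 * l2' = l2 * l1'"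
proof -
  \<comment> \<open>The coefficients of each form are recovered from the values at (1,0), (0,1) and
    (1,1).\<close>
  have a1: "l1 * A1 = l1' * (A1' * p\<^sup>2 + B1' * p * r + C1' * r\<^sup>2)" using f1[of 1 0] by simp
  have c1: "l1 * C1 = l1' * (A1' * q\<^sup>2 + B1' * q * t + C1' * t\<^sup>2)" using f1[of 0 1] by simp
  have b1: "l1 * B1 = l1' * (2 * A1' * p * q + B1' * (p * t + q * r) + 2 * C1' * r * t)"
    using f1[of 1 1] a1 c1 by (simp add: algebra_simps power2_eq_square)
  have a2: "l2 * A2 = l2' * (A2' * p\<^sup>2 + B2' * p * r + C2' * r\<^sup>2)" using f2[of 1 0] by simp
  have c2: "l2 * C2 = l2' * (A2' * q\<^sup>2 + B2' * q * t + C2' * t\<^sup>2)" using f2[of 0 1] by simp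
  have b2: "l2 * B2 = l2' * (2 * A2' * p * q + B2' * (p * t + q * r) + 2 * C2' * r * t)"
    using f2[of 1 1] a2 c2 by (simp add: algebra_simps power2_eq_square)
  define \<Delta> where "\<Delta> = p * t - q * r"
  have "l1\<^sup>2 * 4 = l1\<^sup>2 * (4 * A1 * C1 - B1\<^sup>2)" by (simp only: d(1))
  also have "\<dots> = 4 * (l1 * A1) * (l1 * C1) - (l1 * B1)\<^sup>2" by algebra
  also have "\<dots> = l1'\<^sup>2 * (4 * A1' * C1' - B1'\<^sup>2) * \<Delta>\<^sup>2"
    unfolding a1 b1 c1 \<Delta>_def by algebra
  finally have 1: "l1\<^sup>2 = l1'\<^sup>2 * \<Delta>\<^sup>2" unfolding d(2) by simp
  have "l1 * l2 * 6 = l1 * l2 * (2 * (A1 * C2 + A2 * C1) - B1 * B2)" by (simp only: pol(1))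
  also have "\<dots> = 2 * ((l1 * A1) * (l2 * C2) + (l2 * A2) * (l1 * C1)) - (l1 * B1) * (l2 * B2)" by algebra
  also have "\<dots> = l1' * l2' * (2 * (A1' * C2' + A2' * C1') - B1' * B2') * \<Delta>\<^sup>2"
    unfolding a1 b1 c1 a2 b2 c2 \<Delta>_def by algebra
  finally have 2: "l1 * l2 = l1' * l2' * \<Delta>\<^sup>2" unfolding pol(2) by simp
  \<comment> \<open>Both relations carry the same \<open>\<Delta>\<^sup>2\<close>, which is
    eliminated without extracting a root; no sign is lost.\<close>
  have "(l1 * l1') * (l1 * l2') = (l1 * l1') * (l2 * l1')" using 1 2 by algebra
  with nz show ?thesis by simp
qed

text \<open>Coefficients of a^2, ab, b^2 in the form -trq/2; the value depends only on the line
  through 1 and j.\<close>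

definition axq :: "nat \<Rightarrow> complex \<times> complex \<times> complex" where
  "axq j = (if j \<in> {2,5} then (1, 2, 2) else if j \<in> {3,6} then (2, 2, 1) else (1, 0, 1))"

lemma trq_axq: "trq j a b = - 2 * (fst (axq j) * a\<^sup>2 + fst (snd (axq j)) * a * b + snd (snd (axq j)) * b\<^sup>2)"
  by (simp add: trq_def axq_def algebra_simps)

lemma axq_disc: "4 * fst (axq j) * snd (snd (axq j)) - (fst (snd (axq j)))\<^sup>2 = 4"
  by (simp add: axq_def)

lemma axq_polar:
  assumes "i \<in> {2..7}" "j \<in> {2..7}" "i \<noteq> j" "j \<noteq> xo 1 i"
  shows "2 * (fst (axq i) * snd (snd (axq j)) + fst (axq j) * snd (snd (axq i))) -
    fst (snd (axq i)) * fst (snd (axq j)) = 6"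
proof -
  have "i \<in> {2,3,4,5,6,7}" "j \<in> {2,3,4,5,6,7}" using assms by auto
  then show ?thesis using assms(3,4)
    by (elim insertE emptyE) (simp_all add: axq_def xo_def xtab_def)
qed

text \<open>The contraction factor of (ad x)^2 on the component of degree g_j, for x of degree g_1:
  the path runs from j to 1 * j and back.\<close>

definition lpar :: "(nat set \<Rightarrow> complex) \<Rightarrow> nat \<Rightarrow> complex" where
  "lpar \<eta> j = \<eta> {1, j} * \<eta> {1, 1 \<star> j}"

lemma contr_ad_sq:
  assumes j: "j \<in> {2..7}"
  shows "\<exists>m n r. m + r = trq j a b \<and> (\<forall>p q.
    contr_bracket (eps \<eta>) (hop (gel 1) (dsol 1 a b)) (contr_bracket (eps \<eta>) (hop (gel 1) (dsol 1 a b)) (hop (gel j) (dsol j p q)))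
    = scaleE (lpar \<eta> j) (hop (gel j) (dsol j (m * p) (n * p + r * q))))"
proof -
  obtain m n r where mr: "m + r = trq j a b" and K: "kom (gel 1) (gel (xo 1 j)) (dsol 1 a b)
      (kom (gel 1) (gel j) (dsol 1 a b) (dsol j p q)) = dsol j (m * p) (n * p + r * q)" for p q
    using ad_sq_dsol[OF j, of a b] by blast
  have I: "1 \<in> I7" "j \<in> I7" "1 \<noteq> j" using j by (auto simp: I7_def)
  have s4: "gel (1 \<star> j) = gel 1 + gel j" by (rule gel_star[OF I])
  have s2: "1 \<noteq> 1 \<star> j"
  proof
    assume "1 = 1 \<star> j"
    then have "gel 1 = gel 1 + gel j" using s4 by (simp only:)
    then show False using gel_nonzero[OF I(2)] by simp
  qed
  have s: "1 \<star> j \<in> I7" "1 \<noteq> 1 \<star> j" "gel (xo 1 j) = gel 1 + gel j" "gel (1 \<star> j) = gel 1 + gel j"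
    using s2 s4 star_I7[OF I] gel_add[OF I7_le[OF I(1)] I7_le[OF I(2)]] by simp_all
  have "eps \<eta> (gel 1) (gel 1 + gel j) * eps \<eta> (gel 1) (gel j) = lpar \<eta> j"
    unfolding s(4)[symmetric] eps_gel[OF I] eps_gel[OF I(1) s(1,2)] lpar_def by (rule mult.commute)
  then have "contr_bracket (eps \<eta>) (hop (gel 1) (dsol 1 a b)) (contr_bracket (eps \<eta>) (hop (gel 1) (dsol 1 a b)) (hop (gel j) (dsol j p q)))
    = scaleE (lpar \<eta> j) (hop (gel j) (dsol j (m * p) (n * p + r * q)))" for p q
    unfolding contr_bracket_twice[OF dsol_in[OF I(1)] dsol_in[OF I(1)] dsol_in[OF I(2)]] commutator_hop
    using K[of p q] unfolding s(3) by simp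
  with mr show ?thesis by blast
qed

lemma dsol_scale: "scaleE c (hop g (dsol i a b)) = hop g (dsol i (c * a) (c * b))"
  unfolding hop_scale by (rule arg_cong[of _ _ "hop g"]) (simp add: fun_eq_iff dsol_def algebra_simps)

lemma dsol_add: "hop g (dsol i a b) + hop g (dsol i a' b') = hop g (dsol i (a + a') (b + b'))"
  unfolding hop_add by (rule arg_cong[of _ _ "hop g"]) (simp add: fun_eq_iff dsol_def algebra_simps)

lemma grade_map_matrix:
  assumes i: "i \<in> I7" and k: "k \<in> I7" and im: "\<phi> ` Der_grade (gel i) = Der_grade (gel k)"
    and inj: "inj_on \<phi> Der"
    and add: "\<And>x y. x \<in> Der \<Longrightarrow> y \<in> Der \<Longrightarrow> \<phi> (x + y) = \<phi> x + \<phi> y"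
    and scale: "\<And>c x. x \<in> Der \<Longrightarrow> \<phi> (scaleE c x) = scaleE c (\<phi> x)"
  obtains P1 Q1 P2 Q2 where
    "\<And>p q. \<phi> (hop (gel i) (dsol i p q)) = hop (gel k) (dsol k (p * P1 + q * P2) (p * Q1 + q * Q2))"
    "P1 * Q2 - P2 * Q1 \<noteq> 0"
proof -
  have D: "hop (gel i) (dsol i a b) \<in> Der" for a b using dsol_in[OF i] Der_gradeD by blast
  have "\<phi> (hop (gel i) (dsol i a b)) \<in> Der_grade (gel k)" for a b using im dsol_in[OF i] by blast
  then have ex: "\<exists>P Q. \<phi> (hop (gel i) (dsol i a b)) = hop (gel k) (dsol k P Q)" for a b
    by (metis Der_grade_dsolE[OF _ k])
  obtain P1 Q1 where 1: "\<phi> (hop (gel i) (dsol i 1 0)) = hop (gel k) (dsol k P1 Q1)" using ex by blast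
  obtain P2 Q2 where 2: "\<phi> (hop (gel i) (dsol i 0 1)) = hop (gel k) (dsol k P2 Q2)" using ex by blast
  have lin: "\<phi> (hop (gel i) (dsol i p q)) = hop (gel k) (dsol k (p * P1 + q * P2) (p * Q1 + q * Q2))" for p q
  proof -
    have "hop (gel i) (dsol i p q) = scaleE p (hop (gel i) (dsol i 1 0)) + scaleE q (hop (gel i) (dsol i 0 1))"
      unfolding dsol_scale dsol_add by simp
    then show ?thesis
      by (simp only: add scale Der_scale D 1 2) (simp only: dsol_scale dsol_add)
  qed
  have z: "p = 0 \<and> q = 0" if "p * P1 + q * P2 = 0" "p * Q1 + q * Q2 = 0" for p q
  proof -
    have "\<phi> (hop (gel i) (dsol i p q)) = \<phi> (hop (gel i) (dsol i 0 0))"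
      unfolding lin using that by simp
    then have "hop (gel i) (dsol i p q) = hop (gel i) (dsol i 0 0)" by (rule inj_onD[OF inj _ D D])
    then show ?thesis unfolding hop_eq_iff dsol_eq_iff[OF i] .
  qed
  have "P1 * Q2 - P2 * Q1 \<noteq> 0"
  proof
    assume d: "P1 * Q2 - P2 * Q1 = 0"
    \<comment> \<open>If the determinant were 0, the cofactor vectors (Q2, -Q1) and (P2, -P1) would
      lie in the kernel, hence vanish, and the whole matrix would be 0.\<close>
    have "Q2 * P1 + (- Q1) * P2 = 0" "Q2 * Q1 + (- Q1) * Q2 = 0" "P2 * P1 + (- P1) * P2 = 0" "P2 * Q1 + (- P1) * Q2 = 0"
      using d by (simp_all add: algebra_simps)
    then have "Q2 = 0 \<and> - Q1 = 0" "P2 = 0 \<and> - P1 = 0" using z by blast+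
    then show False using z[of 1 0] by simp
  qed
  with lin show ?thesis using that by blast
qed

text \<open>The map on the component of degree g_1 is one linear substitution, shared by i and j,
  and traces carry the form of each onto that of its image; \<open>forms_ratio\<close> then applies.
  That \<open>\<pi> i\<close> and \<open>\<pi> j\<close> lie on different lines through 1 is an
  assumption, since \<open>\<pi>\<close> need not be a collineation.\<close>

lemma torus_invariant:
  assumes \<pi>: "bij_betw \<pi> I7 I7" and gr: "\<And>i. i \<in> I7 \<Longrightarrow> \<phi> ` Der_grade (gel i) = Der_grade (gel (\<pi> i))"
    and bij: "bij_betw \<phi> Der Der"
    and add: "\<And>x y. x \<in> Der \<Longrightarrow> y \<in> Der \<Longrightarrow> \<phi> (x + y) = \<phi> x + \<phi> y"
    and scale: "\<And>c x. x \<in> Der \<Longrightarrow> \<phi> (scaleE c x) = scaleE c (\<phi> x)"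
    and hom: "\<And>x y. x \<in> Der \<Longrightarrow> y \<in> Der \<Longrightarrow> \<phi> (contr_bracket (eps \<eta>) x y) = contr_bracket (eps \<eta>') (\<phi> x) (\<phi> y)"
    and \<pi>1: "\<pi> 1 = 1"
    and ij: "i \<in> {2..7}" "j \<in> {2..7}" "i \<noteq> j" "j \<noteq> xo 1 i" "\<pi> j \<noteq> xo 1 (\<pi> i)"
    and nz: "lpar \<eta> i \<noteq> 0" "lpar \<eta>' (\<pi> i) \<noteq> 0"
  shows "lpar \<eta> i * lpar \<eta>' (\<pi> j) = lpar \<eta> j * lpar \<eta>' (\<pi> i)"
proof -
  have inj: "inj_on \<phi> Der" using bij by (rule bij_betw_imp_inj_on)
  have I: "1 \<in> I7" by (simp add: I7_def)
  have in7: "k \<in> I7 \<and> \<pi> k \<in> I7 \<and> \<pi> k \<in> {2..7}" if "k \<in> {2..7}" for k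
  proof -
    have k: "k \<in> I7" "k \<noteq> 1" using that by (auto simp: I7_def)
    have "\<pi> k \<in> I7" using bij_betwE[OF \<pi>] k(1) by blast
    moreover have "\<pi> k \<noteq> 1"
      using inj_onD[OF bij_betw_imp_inj_on[OF \<pi>] _ k(1) I] \<pi>1 k(2) by metis
    moreover have "n \<in> {2..7}" if "n \<in> I7" "n \<noteq> 1" for n using that by (auto simp: I7_def)
    ultimately show ?thesis using k(1) by blast
  qed
  obtain p r q t where S: "\<And>a b. \<phi> (hop (gel 1) (dsol 1 a b)) = hop (gel 1) (dsol 1 (a * p + b * q) (a * r + b * t))"
    using grade_map_matrix[OF I I gr[OF I, unfolded \<pi>1] inj add scale] by metis
  have main: "lpar \<eta> k * trq k a b = lpar \<eta>' (\<pi> k) * trq (\<pi> k) (p * a + q * b) (r * a + t * b)"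
    if k: "k \<in> {2..7}" for k a b
  proof -
    note kI = in7[OF k, THEN conjunct1] in7[OF k, THEN conjunct2, THEN conjunct1] in7[OF k, THEN conjunct2, THEN conjunct2]
    obtain P1 Q1 P2 Q2 where M: "\<And>p q. \<phi> (hop (gel k) (dsol k p q)) =
        hop (gel (\<pi> k)) (dsol (\<pi> k) (p * P1 + q * P2) (p * Q1 + q * Q2))" and D: "P1 * Q2 - P2 * Q1 \<noteq> 0"
      using grade_map_matrix[OF kI(1,2) gr[OF kI(1)] inj add scale] by metis
    let ?x = "hop (gel 1) (dsol 1 a b)" and ?x' = "hop (gel 1) (dsol 1 (a * p + b * q) (a * r + b * t))"
    obtain m n s where t1: "m + s = trq k a b" and c1: "\<And>p q.
      contr_bracket (eps \<eta>) ?x (contr_bracket (eps \<eta>) ?x (hop (gel k) (dsol k p q)))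
        = scaleE (lpar \<eta> k) (hop (gel k) (dsol k (m * p) (n * p + s * q)))"
      using contr_ad_sq[OF k] by blast
    obtain m' n' s' where t2: "m' + s' = trq (\<pi> k) (a * p + b * q) (a * r + b * t)" and c2: "\<And>p q.
      contr_bracket (eps \<eta>') ?x' (contr_bracket (eps \<eta>') ?x' (hop (gel (\<pi> k)) (dsol (\<pi> k) p q)))
        = scaleE (lpar \<eta>' (\<pi> k)) (hop (gel (\<pi> k)) (dsol (\<pi> k) (m' * p) (n' * p + s' * q)))"
      using contr_ad_sq[OF kI(3)] by blast
    have xD: "?x \<in> Der" and yD: "hop (gel k) (dsol k u v) \<in> Der" for u v
      using dsol_in[OF I] dsol_in[OF kI(1)] Der_gradeD by blast+
    have e: "lpar \<eta> k * (m * u * P1 + (n * u + s * v) * P2) = lpar \<eta>' (\<pi> k) * (m' * (u * P1 + v * P2)) \<and>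
        lpar \<eta> k * (m * u * Q1 + (n * u + s * v) * Q2) =
          lpar \<eta>' (\<pi> k) * (n' * (u * P1 + v * P2) + s' * (u * Q1 + v * Q2))" for u v
    proof -
      have "\<phi> (contr_bracket (eps \<eta>) ?x (contr_bracket (eps \<eta>) ?x (hop (gel k) (dsol k u v)))) =
        contr_bracket (eps \<eta>') ?x' (contr_bracket (eps \<eta>') ?x' (\<phi> (hop (gel k) (dsol k u v))))"
        by (simp only: hom xD yD contr_bracket_in_Der S)
      then show ?thesis unfolding c1 M c2 scale[OF yD] dsol_scale hop_eq_iff dsol_eq_iff[OF kI(2)]
        by (simp add: algebra_simps)
    qed
    have "lpar \<eta> k * (m + s) = lpar \<eta>' (\<pi> k) * (m' + s')"
      by (rule trace_transfer[where n = n and n' = n' and ?P1.0 = P1 and ?P2.0 = P2 and ?Q1.0 = Q1 and ?Q2.0 = Q2])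
        (use e[of 1 0] e[of 0 1] D in simp_all)
    then show ?thesis unfolding t1 t2 by (simp only: mult.commute[of a] mult.commute[of b])
  qed
  have neq: "\<pi> i \<noteq> \<pi> j" using \<pi> ij(3) in7[OF ij(1)] in7[OF ij(2)] unfolding bij_betw_def inj_on_def by blast
  have f: "lpar \<eta> k * (fst (axq k) * a\<^sup>2 + fst (snd (axq k)) * a * b + snd (snd (axq k)) * b\<^sup>2) =
      lpar \<eta>' (\<pi> k) * (fst (axq (\<pi> k)) * (p * a + q * b)\<^sup>2 +
        fst (snd (axq (\<pi> k))) * (p * a + q * b) * (r * a + t * b) + snd (snd (axq (\<pi> k))) * (r * a + t * b)\<^sup>2)"
    if "k \<in> {2..7}" for k a b
  proof -
    have "- 2 * u = - 2 * v \<Longrightarrow> u = v" for u v :: complex by simp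
    moreover have "- 2 * (lpar \<eta> k * X) = lpar \<eta> k * (- 2 * X)" "- 2 * (lpar \<eta>' (\<pi> k) * Y) = lpar \<eta>' (\<pi> k) * (- 2 * Y)" for X Y
      by simp_all
    ultimately show ?thesis using main[OF that, of a b] unfolding trq_axq by metis
  qed
  show ?thesis
    by (rule forms_ratio[OF nz axq_disc axq_disc axq_polar[OF ij(1-4)]
        axq_polar[OF in7[OF ij(1), THEN conjunct2, THEN conjunct2] in7[OF ij(2), THEN conjunct2, THEN conjunct2] neq ij(5)]
        f[OF ij(1)] f[OF ij(2)]])
qed

section \<open>Nice sets up to collineation\<close>

definition nice :: "nat set set \<Rightarrow> bool" where
  "nice T \<longleftrightarrow> T \<subseteq> edges \<and> (\<forall>i j k. generative i j k \<and> {i, j} \<in> T \<and> {i \<star> j, k} \<in> T \<longrightarrow> P_set i j k \<subseteq> T)"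

text \<open>The two given edges are the factors of \<open>eta3 \<eta> k i j\<close>. The cyclic
  rotations have the same nonzero value, and their six factors are the values on
  \<open>P_set i j k\<close>.\<close>

lemma nice_support: assumes "\<eta> \<in> admissible" shows "nice (eta_support \<eta>)"
  unfolding nice_def
proof (intro conjI allI impI)
  show "eta_support \<eta> \<subseteq> edges" by (auto simp: eta_support_def)
  fix i j k assume *: "generative i j k \<and> {i, j} \<in> eta_support \<eta> \<and> {i \<star> j, k} \<in> eta_support \<eta>"
  then have g: "generative i j k" by blast
  have r: "eta3 \<eta> k i j = eta3 \<eta> i j k" "eta3 \<eta> i j k = eta3 \<eta> j k i"
    using assms g generative_rotate[OF generative_rotate[OF g]] by (auto simp: admissible_def)
  have "eta3 \<eta> k i j \<noteq> 0" using * by (simp add: eta3_def eta_support_def insert_commute)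
  then have nz: "\<eta> {k, i \<star> j} \<noteq> 0" "\<eta> {i, j} \<noteq> 0" "\<eta> {i, j \<star> k} \<noteq> 0" "\<eta> {j, k} \<noteq> 0" "\<eta> {j, k \<star> i} \<noteq> 0" "\<eta> {k, i} \<noteq> 0"
    using r by (auto simp: eta3_def)
  have "\<eta> t \<noteq> 0 \<Longrightarrow> t \<in> eta_support \<eta>" for t
    using assms by (auto simp: admissible_def eta_support_def)
  with nz show "P_set i j k \<subseteq> eta_support \<eta>" by (simp add: P_set_def)
qed

section \<open>Edges as increasing pairs, and closure as a computation\<close>

definition ed :: "nat \<Rightarrow> nat \<Rightarrow> nat \<times> nat" where "ed i j = (if i < j then (i, j) else (j, i))"

definition un :: "nat \<times> nat \<Rightarrow> nat set" where "un p = {fst p, snd p}"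

lemma un_ed [simp]: "un (ed i j) = {i, j}" by (auto simp: un_def ed_def)

definition edge_list :: "(nat \<times> nat) list" where
  "edge_list = [(1,2), (1,3), (1,4), (1,5), (1,6), (1,7), (2,3), (2,4), (2,5), (2,6), (2,7),
    (3,4), (3,5), (3,6), (3,7), (4,5), (4,6), (4,7), (5,6), (5,7), (6,7)]"

definition T_lists :: "(nat \<times> nat) list list" where
  "T_lists = [
  [],
  [(1,2)],
  [(1,2),(1,3)],
  [(1,2),(1,5)],
  [(1,2),(6,7)],
  [(1,2),(1,5),(2,5)],
  [(2,5),(3,6),(4,7)],
  [(1,2),(1,3),(1,4)],
  [(1,2),(1,3),(1,5)],
  [(1,2),(1,3),(1,7)],
  [(1,2),(1,6),(2,6)],
  [(1,2),(1,6),(6,7)],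
  [(1,2),(1,3),(1,4),(1,5)],
  [(1,2),(1,3),(1,5),(1,6)],
  [(1,2),(1,6),(1,7),(2,6)],
  [(1,2),(1,6),(2,7),(6,7)],
  [(1,2),(1,3),(1,4),(1,5),(1,6)],
  [(1,2),(1,6),(1,7),(2,6),(2,7)],
  [(3,4),(3,6),(3,7),(4,6),(4,7),(6,7)],
  [(1,2),(1,3),(1,4),(1,5),(1,6),(1,7)],
  [(1,2),(1,3),(1,7),(2,3),(2,6),(3,5)],
  [(1,2),(1,3),(1,4),(1,5),(1,6),(1,7),(2,3),(2,6),(3,5),(5,6)],
  [(1,2),(1,3),(1,4),(1,5),(1,6),(1,7),(2,3),(2,4),(2,5),(2,6),(2,7),(3,5),(4,5),(5,6),(5,7)],
[(1,2),(1,3),(1,4),(1,5),(1,6),(1,7),(2,3),(2,4),(2,5),(2,6),(2,7),(3,4),(3,5),(3,6),(3,7),(4,5),(4,6),(4,7),(5,6),(5,7),(6,7)]]"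

definition T_list :: "nat \<Rightarrow> (nat \<times> nat) list" where "T_list n = T_lists ! (n - 1)"

lemma edges_eq: "edges = un ` set edge_list"
proof
  show "edges \<subseteq> un ` set edge_list"
  proof
    fix t assume "t \<in> edges"
    then obtain i j where t: "t = un (ed i j)" "i \<in> I7" "j \<in> I7" "i \<noteq> j" by (auto simp: edges_def)
    have "\<forall>i\<le>7. \<forall>j\<le>7. i \<noteq> 0 \<longrightarrow> j \<noteq> 0 \<longrightarrow> i \<noteq> j \<longrightarrow> ed i j \<in> set edge_list"
      unfolding ball_le7_list by code_simp
    then have "ed i j \<in> set edge_list" using t by (auto simp: I7_def)
    with t(1) show "t \<in> un ` set edge_list" by blast
  qed
  show "un ` set edge_list \<subseteq> edges"
    by (auto simp: edge_list_def un_def edges_iff I7_def)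
qed

lemma P_set_list:
  assumes "generative i j k"
  shows "P_set i j k = un ` set [ed i j, ed j k, ed k i, ed i (xo j k), ed j (xo k i), ed k (xo i j)]"
  using assms by (simp add: P_set_def generative_def star_eq_xo)

definition is_gen :: "nat \<Rightarrow> nat \<Rightarrow> nat \<Rightarrow> bool" where
  "is_gen i j k \<longleftrightarrow> list_all (\<lambda>x. x \<noteq> 0 \<and> x \<le> 7) [i, j, k] \<and> i \<noteq> j \<and> j \<noteq> k \<and> i \<noteq> k \<and> k \<noteq> xo i j"

lemma generative_list: assumes "is_gen i j k" shows "generative i j k"
  using assms star_eq_xo[of i j] by (auto simp: is_gen_def generative_def I7_def)

lemma T_set_list: assumes "n \<in> {1..24}" shows "T_set n = un ` set (T_list n)"
proof -
  have I: "i \<in> {1,2,3,4,5,6,7} \<Longrightarrow> i \<in> I7" for i by (auto simp: I7_def)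
  have T19: "T19 = un ` set [(3,4), (3,6), (3,7), (4,6), (4,7), (6,7)]" by (simp add: T19_def un_def)
  have g: "generative 1 2 3" "generative 1 2 6" "generative 1 3 5" "generative 1 5 6"
    by (rule generative_list; code_simp)+
  have inj: "inj_on un (set edge_list)" by (simp add: edge_list_def inj_on_def un_def doubleton_eq_iff)
  have 23: "edges - T19 = un ` (set edge_list - set [(3,4), (3,6), (3,7), (4,6), (4,7), (6,7)])"
    unfolding edges_eq T19 by (rule inj_on_image_set_diff[OF inj, symmetric]) (simp_all add: edge_list_def)
  have d23: "set edge_list - set [(3,4), (3,6), (3,7), (4,6), (4,7), (6,7)] = set (T_list 23)" by code_simp
  have P: "P_set 1 2 3 = un ` set [ed 1 2, ed 2 3, ed 3 1, ed 1 7, ed 2 6, ed 3 5]"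
    "P_set 1 2 6 = un ` set [ed 1 2, ed 2 6, ed 6 1, ed 1 4, ed 2 3, ed 6 5]"
    "P_set 1 3 5 = un ` set [ed 1 3, ed 3 5, ed 5 1, ed 1 4, ed 3 2, ed 5 6]"
    "P_set 1 5 6 = un ` set [ed 1 5, ed 5 6, ed 6 1, ed 1 7, ed 5 3, ed 6 2]"
    unfolding P_set_list[OF g(1)] P_set_list[OF g(2)] P_set_list[OF g(3)] P_set_list[OF g(4)]
    by (simp_all add: xo_def xtab_def)
  have 21: "set [ed 1 2, ed 2 3, ed 3 1, ed 1 7, ed 2 6, ed 3 5] = set (T_list 21)" by code_simp
  have 22: "set [ed 1 2, ed 2 3, ed 3 1, ed 1 7, ed 2 6, ed 3 5] \<union> set [ed 1 2, ed 2 6, ed 6 1, ed 1 4, ed 2 3, ed 6 5] \<union>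
    set [ed 1 3, ed 3 5, ed 5 1, ed 1 4, ed 3 2, ed 5 6] \<union> set [ed 1 5, ed 5 6, ed 6 1, ed 1 7, ed 5 3, ed 6 2]
    = set (T_list 22)" by code_simp
  have 24: "edge_list = T_list 24" by (simp add: edge_list_def T_list_def T_lists_def)
  have small: "T_set n = un ` set (T_list n)" if "n \<in> {1,2,3,4,5,6,7,8,9,10,11,12,13,14,15,16,17,18,19}"
    using that by (elim insertE emptyE) (simp_all add: T_set_def T_list_def T_lists_def un_def T19_def)
  have "T_set 20 = un ` set (T_list 20)" unfolding T_set_20 by (simp add: T_list_def T_lists_def un_def)
  moreover have "T_set 21 = un ` set (T_list 21)" unfolding 21[symmetric] P[symmetric] by (simp add: T_set_def)
  moreover have "T_set 22 = un ` set (T_list 22)"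
    unfolding 22[symmetric] image_Un P[symmetric] by (simp add: T_set_def)
  moreover have "T_set 23 = un ` set (T_list 23)" unfolding d23[symmetric] 23[symmetric] by (simp add: T_set_def)
  moreover have "T_set 24 = un ` set (T_list 24)" unfolding 24[symmetric] edges_eq[symmetric] by (simp add: T_set_def)
  ultimately have big: "T_set n = un ` set (T_list n)" if "n \<in> {20,21,22,23,24}"
    using that by (elim insertE emptyE) (simp_all only:)
  have "n \<in> {1,2,3,4,5,6,7,8,9,10,11,12,13,14,15,16,17,18,19} \<or> n \<in> {20,21,22,23,24}"
  proof -
    have "[1..<25] = [1,2,3,4,5,6,7,8,9,10,11,12,13,14,15,16,17,18,19] @ [20,21,22,23,24]" by code_simp
    moreover have "n \<in> set [1..<25]" using assms by simp
    ultimately show ?thesis by (simp only: set_append Un_iff list.set)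
  qed
  then show ?thesis using small big by (elim disjE)
qed

text \<open>A step whose premises fail leaves the list unchanged, so closing up is sound for an
  arbitrary list of triples.\<close>

definition close_step :: "nat \<times> nat \<times> nat \<Rightarrow> (nat \<times> nat) list \<Rightarrow> (nat \<times> nat) list" where
  "close_step = (\<lambda>(i, j, k) L. if is_gen i j k \<and> ed i j \<in> set L \<and> ed (xo i j) k \<in> set L
      then [ed i j, ed j k, ed k i, ed i (xo j k), ed j (xo k i), ed k (xo i j)] @ L else L)"

lemma close_step_sound:
  assumes T: "nice T" and L: "un ` set L \<subseteq> T" shows "un ` set (close_step (i, j, k) L) \<subseteq> T"
proof (cases "is_gen i j k \<and> ed i j \<in> set L \<and> ed (xo i j) k \<in> set L")
  case True
  then have g: "generative i j k" by (intro generative_list) blast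
  have "un (ed i j) \<in> T" "un (ed (xo i j) k) \<in> T" using True L by blast+
  then have "{i, j} \<in> T" "{i \<star> j, k} \<in> T"
    using g star_eq_xo[of i j] by (simp_all add: generative_def)
  then have "P_set i j k \<subseteq> T" using T g unfolding nice_def by blast
  then have "un ` set [ed i j, ed j k, ed k i, ed i (xo j k), ed j (xo k i), ed k (xo i j)] \<subseteq> T"
    unfolding P_set_list[OF g] .
  with L show ?thesis
    unfolding close_step_def prod.case if_P[OF True] set_append image_Un by (rule Un_least[rotated])
next
  case False
  show ?thesis unfolding close_step_def prod.case if_not_P[OF False] by (rule L)
qed

lemma close_steps_sound:
  assumes "nice T" "un ` set L \<subseteq> T" shows "un ` set (fold close_step c L) \<subseteq> T"
  using assms(2)
proof (induction c arbitrary: L)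
  case (Cons s c)
  obtain i j k where "s = (i, j, k)" by (cases s)
  then show ?case using Cons close_step_sound[OF assms(1)] by simp
qed simp

text \<open>For every \<open>n\<close> and every edge \<open>t\<close> outside \<open>T\<^sub>n\<close>: closing \<open>T\<^sub>n \<union> {t}\<close> under the listed generative
  triples yields a set containing the image of a larger \<open>T\<^sub>m\<close> under the collineation that sends
  \<open>1, 2, 3\<close> to the triple in the last component.\<close>

definition extension_certs ::
  "((nat \<times> nat) \<times> (nat \<times> nat \<times> nat) list \<times> nat \<times> (nat \<times> nat \<times> nat)) list list" where
  "extension_certs = [
  [((1,2),[],2,(1,2,3)), ((1,3),[],2,(1,3,2)), ((1,4),[],2,(1,4,2)), ((1,5),[],2,(1,5,3)),
    ((1,6),[],2,(1,6,2)), ((1,7),[],2,(1,7,2)), ((2,3),[],2,(2,3,1)), ((2,4),[],2,(2,4,1)),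
    ((2,5),[],2,(2,5,3)), ((2,6),[],2,(2,6,1)), ((2,7),[],2,(2,7,1)), ((3,4),[],2,(3,4,1)),
    ((3,5),[],2,(3,5,1)), ((3,6),[],2,(3,6,2)), ((3,7),[],2,(3,7,1)), ((4,5),[],2,(4,5,1)),
    ((4,6),[],2,(4,6,1)), ((4,7),[],2,(4,7,2)), ((5,6),[],2,(5,6,1)), ((5,7),[],2,(5,7,1)),
    ((6,7),[],2,(6,7,1))],
  [((1,3),[],3,(1,2,3)), ((1,4),[],3,(1,2,4)), ((1,5),[],4,(1,2,3)), ((1,6),[],3,(1,2,6)),
    ((1,7),[],3,(1,2,7)), ((2,3),[],3,(2,1,3)), ((2,4),[],3,(2,1,4)), ((2,5),[],4,(2,1,3)),
    ((2,6),[],3,(2,1,6)), ((2,7),[],3,(2,1,7)), ((3,4),[],5,(1,2,6)), ((3,5),[(1,2,3)],21,(1,2,3)),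
    ((3,6),[(3,6,2)],21,(2,3,6)), ((3,7),[(3,7,1)],21,(1,3,7)), ((4,5),[(1,2,4)],21,(1,2,4)),
    ((4,6),[(4,6,1)],21,(1,4,6)), ((4,7),[(4,7,2)],21,(2,4,7)), ((5,6),[(1,2,6)],21,(1,2,6)),
    ((5,7),[(1,2,7)],21,(1,2,7)), ((6,7),[],5,(1,2,3))],
  [((1,4),[],8,(1,2,3)), ((1,5),[],9,(1,2,3)), ((1,6),[],9,(1,3,2)), ((1,7),[],10,(1,2,3)),
    ((2,3),[],11,(1,2,6)), ((2,4),[],12,(1,3,5)), ((2,5),[(2,5,3)],7,(6,1,2)),
    ((2,6),[(1,3,2)],21,(1,2,3)), ((2,7),[(2,7,1)],21,(1,2,7)), ((3,4),[],12,(1,2,6)),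
    ((3,5),[(1,2,3)],21,(1,2,3)), ((3,6),[(3,6,2)],7,(5,1,3)), ((3,7),[(3,7,1)],21,(1,3,7)),
    ((4,5),[(1,2,4)],7,(3,1,2)), ((4,6),[(1,3,4)],7,(2,1,3)), ((4,7),[(4,7,2)],7,(5,1,3)),
    ((5,6),[(1,2,6)],7,(7,1,2)), ((5,7),[(1,2,7)],21,(1,2,7)), ((6,7),[(1,3,7)],21,(1,3,7))],
  [((1,3),[],9,(1,2,3)), ((1,4),[],9,(1,2,4)), ((1,6),[],9,(1,2,6)), ((1,7),[],9,(1,2,7)),
    ((2,3),[(1,5,3)],7,(7,1,2)), ((2,4),[(1,5,4)],7,(6,1,2)), ((2,5),[],6,(1,2,3)),
    ((2,6),[(1,5,6)],7,(4,1,2)), ((2,7),[(1,5,7)],7,(3,1,2)), ((3,4),[(3,4,1)],7,(2,1,3)),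
    ((3,5),[(1,2,3)],7,(4,1,2)), ((3,6),[(3,6,2)],7,(5,1,3)), ((3,7),[(3,7,1)],7,(5,1,3)),
    ((4,5),[(1,2,4)],7,(3,1,2)), ((4,6),[(4,6,1)],7,(5,1,3)), ((4,7),[(4,7,2)],7,(5,1,3)),
    ((5,6),[(1,2,6)],7,(7,1,2)), ((5,7),[(1,2,7)],7,(6,1,2)), ((6,7),[(6,7,1)],7,(2,1,3))],
  [((1,3),[(1,3,7)],21,(1,3,7)), ((1,4),[(1,4,6)],21,(1,4,6)), ((1,5),[(6,7,1)],7,(2,1,3)),
    ((1,6),[],12,(1,2,3)), ((1,7),[],12,(1,2,4)), ((2,3),[(2,3,6)],21,(2,3,6)),
    ((2,4),[(2,4,7)],21,(2,4,7)), ((2,5),[(6,7,2)],7,(1,2,3)), ((2,6),[],12,(2,1,4)),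
    ((2,7),[],12,(2,1,3)), ((3,4),[],7,(5,1,3)), ((3,5),[(1,2,3)],7,(4,1,2)),
    ((3,6),[(3,6,2)],21,(2,3,6)), ((3,7),[(3,7,1)],21,(1,3,7)), ((4,5),[(1,2,4)],7,(3,1,2)),
    ((4,6),[(4,6,1)],21,(1,4,6)), ((4,7),[(4,7,2)],21,(2,4,7)), ((5,6),[(1,2,6)],7,(7,1,2)),
    ((5,7),[(1,2,7)],7,(6,1,2))],
  [((1,3),[(2,5,3)],13,(2,1,3)), ((1,4),[(2,5,4)],13,(2,1,3)), ((1,6),[(2,5,6)],13,(2,1,6)),
    ((1,7),[(2,5,7)],13,(2,1,6)), ((2,3),[(1,5,3)],13,(1,2,3)), ((2,4),[(1,5,4)],13,(1,2,3)),
    ((2,6),[(1,5,6)],13,(1,2,6)), ((2,7),[(1,5,7)],13,(1,2,6)), ((3,4),[(3,4,1)],13,(1,2,3)),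
    ((3,5),[(1,2,3)],13,(1,5,3)), ((3,6),[(3,6,2)],13,(2,5,3)), ((3,7),[(3,7,1)],13,(1,5,3)),
    ((4,5),[(1,2,4)],13,(1,5,4)), ((4,6),[(4,6,1)],13,(1,5,4)), ((4,7),[(4,7,2)],13,(2,5,4)),
    ((5,6),[(1,2,6)],13,(1,5,4)), ((5,7),[(1,2,7)],13,(1,5,3)), ((6,7),[(6,7,1)],13,(1,2,6))],
  [((1,2),[(3,6,2)],13,(2,5,3)), ((1,3),[(2,5,3)],13,(3,6,2)), ((1,4),[(2,5,4)],13,(4,7,2)),
    ((1,5),[(3,6,5)],13,(5,2,3)), ((1,6),[(2,5,6)],13,(6,3,2)), ((1,7),[(2,5,7)],13,(7,4,2)),
    ((2,3),[(2,3,4)],21,(2,3,4)), ((2,4),[(2,4,3)],21,(2,3,4)), ((2,6),[(2,6,7)],21,(2,6,7)),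
    ((2,7),[(2,7,6)],21,(2,6,7)), ((3,4),[(3,4,2)],21,(2,3,4)), ((3,5),[(3,5,7)],21,(3,5,7)),
    ((3,7),[(3,7,5)],21,(3,5,7)), ((4,5),[(4,5,6)],21,(4,5,6)), ((4,6),[(4,6,5)],21,(4,5,6)),
    ((5,6),[(5,6,4)],21,(4,5,6)), ((5,7),[(5,7,3)],21,(3,5,7)), ((6,7),[(6,7,2)],21,(2,6,7))],
  [((1,5),[],13,(1,2,3)), ((1,6),[],13,(1,3,2)), ((1,7),[],13,(1,4,2)), ((2,3),[],15,(1,2,6)),
    ((2,4),[],15,(1,2,7)), ((2,5),[(2,5,3)],13,(2,1,3)), ((2,6),[(1,3,2)],13,(1,4,2)),
    ((2,7),[(1,4,2)],13,(1,3,2)), ((3,4),[],15,(1,3,7)), ((3,5),[(1,2,3)],13,(1,4,2)),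
    ((3,6),[(3,6,2)],13,(3,1,2)), ((3,7),[(1,4,3)],13,(1,2,3)), ((4,5),[(1,2,4)],13,(1,3,2)),
    ((4,6),[(1,3,4)],13,(1,2,3)), ((4,7),[(4,7,2)],13,(4,1,2)), ((5,6),[(1,2,6)],13,(1,3,2)),
    ((5,7),[(1,2,7)],13,(1,4,2)), ((6,7),[(1,3,7)],13,(1,4,2))],
  [((1,4),[],13,(1,2,3)), ((1,6),[],14,(1,2,3)), ((1,7),[],13,(1,5,3)),
    ((2,3),[(1,5,3)],13,(1,2,3)), ((2,4),[(1,5,4)],13,(1,2,3)), ((2,5),[(2,5,3)],13,(2,1,3)),
    ((2,6),[(1,3,2)],13,(1,5,3)), ((2,7),[(1,5,7)],13,(1,2,6)), ((3,4),[(3,4,1)],13,(1,2,3)),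
    ((3,5),[(1,2,3)],13,(1,5,3)), ((3,6),[(3,6,2)],13,(3,1,2)), ((3,7),[(3,7,1)],13,(1,5,3)),
    ((4,5),[(1,2,4)],13,(1,2,3)), ((4,6),[(1,3,4)],13,(1,2,3)), ((4,7),[(4,7,2)],16,(1,2,6)),
    ((5,6),[(1,2,6)],13,(1,2,3)), ((5,7),[(1,2,7)],13,(1,5,3)), ((6,7),[(1,3,7)],13,(1,5,3))],
  [((1,4),[],13,(1,4,2)), ((1,5),[],13,(1,5,3)), ((1,6),[],13,(1,6,2)),
    ((2,3),[(2,3,1)],21,(1,2,3)), ((2,4),[(1,7,2)],21,(1,2,7)), ((2,5),[(2,5,3)],13,(2,1,3)),
    ((2,6),[(1,3,2)],21,(1,2,3)), ((2,7),[(2,7,1)],21,(1,2,7)), ((3,4),[(1,7,3)],21,(1,3,7)),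
    ((3,5),[(1,2,3)],21,(1,2,3)), ((3,6),[(3,6,2)],13,(3,1,2)), ((3,7),[(3,7,1)],21,(1,3,7)),
    ((4,5),[(1,2,4)],13,(1,3,2)), ((4,6),[(1,3,4)],13,(1,2,3)), ((4,7),[(4,7,2)],13,(7,1,2)),
    ((5,6),[(1,2,6)],13,(1,3,2)), ((5,7),[(1,2,7)],21,(1,2,7)), ((6,7),[(1,3,7)],21,(1,3,7))],
  [((1,3),[(1,3,2)],13,(1,6,2)), ((1,4),[(2,6,1)],21,(1,2,6)), ((1,5),[(1,5,6)],13,(1,2,6)),
    ((1,7),[],15,(1,2,3)), ((2,3),[(1,6,2)],21,(1,2,6)), ((2,4),[(2,4,1)],13,(2,6,1)),
    ((2,5),[(2,5,6)],13,(2,1,6)), ((2,7),[],15,(2,1,4)), ((3,4),[(1,6,4)],13,(6,2,1)),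
    ((3,5),[(1,2,3)],13,(1,6,2)), ((3,6),[(3,6,2)],13,(6,1,2)), ((3,7),[(1,6,7)],13,(1,2,6)),
    ((4,5),[(1,2,4)],13,(2,6,1)), ((4,6),[(4,6,1)],13,(6,2,1)), ((4,7),[(2,6,7)],13,(2,1,6)),
    ((5,6),[(1,2,6)],21,(1,2,6)), ((5,7),[(1,2,7)],13,(1,6,2)), ((6,7),[],15,(6,1,4))],
  [((1,3),[(1,3,7)],13,(1,6,2)), ((1,4),[(1,4,6)],21,(1,4,6)), ((1,5),[(6,7,1)],13,(1,2,6)),
    ((1,7),[],15,(1,6,4)), ((2,3),[(1,6,2)],13,(6,7,1)), ((2,4),[(2,4,1)],16,(1,2,3)),
    ((2,5),[(2,5,6)],13,(2,1,6)), ((2,6),[],15,(6,1,4)), ((2,7),[],16,(1,2,3)),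
    ((3,4),[(1,6,4)],21,(1,4,6)), ((3,5),[(1,2,3)],13,(1,6,2)), ((3,6),[(3,6,2)],13,(6,1,2)),
    ((3,7),[(1,6,7)],13,(1,2,6)), ((4,5),[(1,2,4)],16,(1,2,3)), ((4,6),[(4,6,1)],21,(1,4,6)),
    ((4,7),[(4,7,2)],16,(1,2,3)), ((5,6),[(1,2,6)],13,(6,7,1)), ((5,7),[(1,2,7)],13,(1,6,2))],
  [((1,6),[],17,(1,2,3)), ((1,7),[],17,(1,2,4)), ((2,3),[(1,5,3)],21,(1,3,5)),
    ((2,4),[(1,5,4)],21,(1,4,5)), ((2,5),[(2,5,3)],18,(1,2,6)), ((2,6),[(1,3,2)],17,(1,2,4)),
    ((2,7),[(1,4,2)],17,(1,2,3)), ((3,4),[(3,4,1)],21,(1,3,4)), ((3,5),[(1,2,3)],17,(1,2,4)),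
    ((3,6),[(3,6,2)],18,(1,3,5)), ((3,7),[(1,4,3)],21,(1,3,4)), ((4,5),[(1,2,4)],17,(1,2,3)),
    ((4,6),[(1,3,4)],21,(1,3,4)), ((4,7),[(4,7,2)],18,(1,4,5)), ((5,6),[(1,2,6)],17,(1,2,3)),
    ((5,7),[(1,2,7)],17,(1,2,4)), ((6,7),[(1,3,7)],17,(1,2,4))],
  [((1,4),[],17,(1,2,3)), ((1,7),[],17,(1,2,6)), ((2,3),[(1,5,3)],17,(1,2,3)),
    ((2,4),[(1,5,4)],17,(1,2,3)), ((2,5),[(2,5,3)],21,(2,3,5)), ((2,6),[(1,3,2)],17,(1,2,6)),
    ((2,7),[(1,5,7)],17,(1,2,6)), ((3,4),[(1,6,4)],17,(1,2,3)), ((3,5),[(1,2,3)],17,(1,2,6)),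
    ((3,6),[(3,6,2)],21,(2,3,6)), ((3,7),[(1,6,7)],17,(1,2,6)), ((4,5),[(1,2,4)],17,(1,2,3)),
    ((4,6),[(1,3,4)],17,(1,2,3)), ((4,7),[(4,7,2)],21,(2,4,7)), ((5,6),[(1,2,6)],17,(1,2,3)),
    ((5,7),[(1,2,7)],17,(1,2,6)), ((6,7),[(1,3,7)],17,(1,2,6))],
  [((1,3),[(1,3,2)],21,(1,2,3)), ((1,4),[(2,6,1)],21,(1,2,6)), ((1,5),[(1,5,6)],21,(1,5,6)),
    ((2,3),[(1,6,2)],21,(1,2,6)), ((2,4),[(1,7,2)],18,(1,2,3)), ((2,5),[(2,5,6)],18,(1,2,3)),
    ((2,7),[],18,(1,2,3)), ((3,4),[(1,6,4)],18,(1,6,4)), ((3,5),[(1,2,3)],21,(1,2,3)),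
    ((3,6),[(3,6,2)],18,(1,6,4)), ((3,7),[(1,6,7)],18,(1,6,4)), ((4,5),[(1,2,4)],18,(1,2,3)),
    ((4,6),[(1,7,6)],18,(1,6,4)), ((4,7),[(2,6,7)],18,(1,2,3)), ((5,6),[(1,2,6)],21,(1,2,6)),
    ((5,7),[(1,2,7)],18,(1,2,3)), ((6,7),[],18,(1,6,4))],
  [((1,3),[(1,3,7)],18,(1,7,3)), ((1,4),[(1,4,2)],21,(1,2,4)), ((1,5),[(1,5,7)],18,(1,7,3)),
    ((1,7),[],18,(1,7,3)), ((2,3),[(1,6,2)],18,(2,6,3)), ((2,4),[(2,4,1)],21,(1,2,4)),
    ((2,5),[(2,5,6)],18,(2,6,3)), ((2,6),[],18,(2,6,3)), ((3,4),[(1,6,4)],21,(1,4,6)),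
    ((3,5),[(1,2,3)],18,(1,2,3)), ((3,6),[(2,7,6)],18,(2,6,3)), ((3,7),[(1,6,7)],18,(1,7,3)),
    ((4,5),[(1,2,4)],21,(1,2,4)), ((4,6),[(4,6,1)],21,(1,4,6)), ((4,7),[(4,7,2)],21,(2,4,7)),
    ((5,6),[(1,2,6)],18,(2,6,3)), ((5,7),[(1,2,7)],18,(1,7,3))],
  [((1,7),[],20,(1,2,3)), ((2,3),[(1,5,3)],21,(1,3,5)), ((2,4),[(1,5,4)],21,(1,4,5)),
    ((2,5),[(2,5,3)],21,(2,3,5)), ((2,6),[(1,3,2)],20,(1,2,3)), ((2,7),[(1,4,2)],21,(1,2,4)),
    ((3,4),[(1,6,4)],21,(1,4,6)), ((3,5),[(1,2,3)],20,(1,2,3)), ((3,6),[(3,6,2)],21,(2,3,6)),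
    ((3,7),[(1,4,3)],21,(1,3,4)), ((4,5),[(1,2,4)],21,(1,2,4)), ((4,6),[(1,3,4)],21,(1,3,4)),
    ((4,7),[(4,7,2)],21,(2,4,7)), ((5,6),[(1,2,6)],21,(1,2,6)), ((5,7),[(1,2,7)],20,(1,2,3)),
    ((6,7),[(1,3,7)],20,(1,2,3))],
  [((1,3),[(1,3,2)],21,(1,2,3)), ((1,4),[(1,4,2)],21,(1,2,4)), ((1,5),[(1,5,6)],21,(1,5,6)),
    ((2,3),[(1,6,2)],21,(1,2,6)), ((2,4),[(1,7,2)],21,(1,2,7)), ((2,5),[(2,5,6)],21,(2,5,6)),
    ((3,4),[(1,6,4)],19,(3,4,1)), ((3,5),[(1,2,3)],21,(1,2,3)), ((3,6),[(2,7,6)],19,(3,4,1)),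
    ((3,7),[(1,6,7)],19,(3,4,1)), ((4,5),[(1,2,4)],21,(1,2,4)), ((4,6),[(1,7,6)],19,(3,4,1)),
    ((4,7),[(2,6,7)],19,(3,4,1)), ((5,6),[(1,2,6)],21,(1,2,6)), ((5,7),[(1,2,7)],21,(1,2,7)),
    ((6,7),[],19,(3,4,1))],
  [((1,2),[(3,6,2),(2,3,4),(2,4,7)],22,(2,3,4)), ((1,3),[(1,3,4),(1,3,7),(1,4,6)],22,(1,3,4)),
    ((1,4),[(1,4,3),(1,3,7),(1,4,6)],22,(1,3,4)), ((1,5),[(3,4,1),(1,3,7),(1,4,6)],22,(1,3,4)),
    ((1,6),[(1,6,4),(1,4,3),(1,3,7)],22,(1,3,4)), ((1,7),[(1,7,3),(1,3,4),(1,4,6)],22,(1,3,4)),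
    ((2,3),[(2,3,4),(2,3,6),(2,4,7)],22,(2,3,4)), ((2,4),[(2,4,3),(2,3,6),(2,4,7)],22,(2,3,4)),
    ((2,5),[(3,4,2),(2,3,6),(2,4,7)],22,(2,3,4)), ((2,6),[(2,6,3),(2,3,4),(2,4,7)],22,(2,3,4)),
    ((2,7),[(2,7,4),(2,4,3),(2,3,6)],22,(2,3,4)), ((3,5),[(3,5,6),(3,4,1),(1,3,5)],22,(3,1,4)),
    ((4,5),[(4,5,6),(3,4,2),(2,4,5)],22,(4,2,3)), ((5,6),[(3,4,6),(1,4,3),(1,3,5)],22,(3,1,4)),
    ((5,7),[(3,4,7),(1,3,4),(1,4,5)],22,(4,1,3))],
  [((2,3),[(1,5,3),(1,2,3)],22,(1,2,3)), ((2,4),[(1,5,4),(1,2,4)],22,(1,2,4)),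
    ((2,5),[(2,5,3),(1,6,2)],22,(1,2,3)), ((2,6),[(1,3,2),(1,5,3)],22,(1,2,3)),
    ((2,7),[(1,4,2),(1,5,4)],22,(1,2,4)), ((3,4),[(1,6,4),(1,3,4)],22,(1,3,4)),
    ((3,5),[(1,2,3),(1,5,3)],22,(1,2,3)), ((3,6),[(3,6,2),(1,5,3)],22,(1,2,3)),
    ((3,7),[(1,4,3),(1,6,4)],22,(1,3,4)), ((4,5),[(1,2,4),(1,5,4)],22,(1,2,4)),
    ((4,6),[(1,3,4),(1,6,4)],22,(1,3,4)), ((4,7),[(4,7,2),(1,5,4)],22,(1,2,4)),
    ((5,6),[(1,2,6),(1,3,2)],22,(1,2,3)), ((5,7),[(1,2,7),(1,4,2)],22,(1,2,4)),
    ((6,7),[(1,3,7),(1,4,3)],22,(1,3,4))],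
  [((1,4),[(2,6,1),(1,3,5)],22,(1,2,3)), ((1,5),[(1,5,3),(1,2,6)],22,(1,2,3)),
    ((1,6),[(1,6,2),(1,3,5)],22,(1,2,3)), ((2,4),[(1,7,2),(2,3,5)],22,(2,1,3)),
    ((2,5),[(2,5,3),(1,2,7)],22,(2,1,3)), ((2,7),[(2,7,1),(2,3,5)],22,(2,1,3)),
    ((3,4),[(1,7,3),(2,3,6)],22,(3,1,2)), ((3,6),[(3,6,2),(1,3,7)],22,(3,1,2)),
    ((3,7),[(3,7,1),(2,3,6)],22,(3,1,2)), ((4,5),[(1,2,4),(1,6,5)],22,(1,2,3)),
    ((4,6),[(1,3,4),(1,5,6)],22,(1,2,3)), ((4,7),[(2,3,4),(1,7,2)],22,(2,1,3)),
    ((5,6),[(1,2,6),(1,3,5)],22,(1,2,3)), ((5,7),[(1,2,7),(2,3,5)],22,(2,1,3)),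
    ((6,7),[(1,3,7),(2,3,6)],22,(3,1,2))],
  [((2,4),[(1,5,4),(2,6,5)],23,(1,2,3)), ((2,5),[(2,5,3),(2,4,1)],23,(1,2,3)),
    ((2,7),[(1,4,2),(2,7,5)],23,(1,2,3)), ((3,4),[(1,6,4),(3,5,6)],23,(1,3,2)),
    ((3,6),[(3,6,2),(3,4,1)],23,(1,3,2)), ((3,7),[(1,4,3),(2,6,3)],23,(1,3,2)),
    ((4,5),[(1,2,4),(2,7,5)],23,(1,2,3)), ((4,6),[(1,3,4),(2,6,3)],23,(1,3,2)),
    ((4,7),[(2,3,4),(4,7,5)],23,(3,4,1)), ((5,7),[(1,2,7),(2,4,5)],23,(1,2,3)),
    ((6,7),[(1,3,7),(3,4,6)],23,(1,3,2))],
  [((3,4),[(1,6,4),(1,3,4),(3,4,2)],24,(1,2,3)), ((3,6),[(2,4,3),(1,6,4),(1,3,4)],24,(1,2,3)),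
    ((3,7),[(1,4,3),(1,6,4),(3,4,2)],24,(1,2,3)), ((4,6),[(1,3,4),(1,6,4),(3,4,2)],24,(1,2,3)),
    ((4,7),[(2,3,4),(1,6,4),(1,3,4)],24,(1,2,3)), ((6,7),[(1,3,7),(1,4,3),(3,4,2)],24,(1,2,3))],
  []]"

definition cert_ok :: "(nat \<times> nat) list \<Rightarrow> (nat \<times> nat) \<times> (nat \<times> nat \<times> nat) list \<times> nat \<times> (nat \<times> nat \<times> nat) \<Rightarrow> bool" where
  "cert_ok T = (\<lambda>(t, c, m, (p, q, r)). m \<noteq> 0 \<and> m \<le> 24 \<and> is_gen p q r \<and>
    (let L = fold close_step c (t # T); C = col_list p q r; T' = T_list m in
      length T < length T' \<and> list_all (\<lambda>(u, v). ed (C ! u) (C ! v) \<in> set L) T'))"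

text \<open>Besides checking each certificate, the equation with the filtered
  \<open>edge_list\<close> guarantees that no edge outside a representative support has been
  omitted.\<close>

lemma extension_certs_correct:
  "list_all2 (\<lambda>T cs. list_all (cert_ok T) cs \<and> filter (\<lambda>t. t \<notin> set T) edge_list = map fst cs)
    T_lists extension_certs"
  by code_simp

section \<open>Classification of the closed sets of edges\<close>

definition col_fun :: "nat \<Rightarrow> nat \<Rightarrow> nat \<Rightarrow> nat \<Rightarrow> nat" where
  "col_fun p q r i = col_list p q r ! i"

lemma coll_col_fun: assumes "is_gen p q r" shows "coll (col_fun p q r)"
proof -
  let ?C = "col_fun p q r"
  have le: "p \<le> 7" "q \<le> 7" "r \<le> 7" and I: "p \<in> I7" "q \<in> I7" "r \<in> I7" and ne: "p \<noteq> q" "q \<noteq> r" "p \<noteq> r" "r \<noteq> xo p q"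
    using assms by (auto simp: is_gen_def I7_def)
  have x7: "i \<le> 7 \<Longrightarrow> j \<le> 7 \<Longrightarrow> xo i j \<le> 7" for i j using xo_le by blast
  define a b c where "a = gel p" and "b = gel q" and "c = gel r"
  have n0: "a \<noteq> 0" "b \<noteq> 0" "c \<noteq> 0" "a \<noteq> b" "b \<noteq> c" "a \<noteq> c" "c \<noteq> a + b"
    using I ne le x7 by (simp_all add: a_def b_def c_def gel_nonzero gel_eq_iff gel_add)
  have n1: "a + (b + c) \<noteq> 0"
  proof
    assume "a + (b + c) = 0"
    then have "c = a + b" by (metis add.assoc grp_add_eq_0_iff)
    with n0 show False by blast
  qed
  have gC: "\<forall>i\<le>7. gel (?C i) = [0, a, b, c, a + (b + c), a + b, a + c, b + c] ! i"
    unfolding ball_le7 using le x7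
    by (simp add: col_fun_def col_list_def a_def b_def c_def gel_add [symmetric] gel_0)
  have C7: "\<forall>i\<le>7. ?C i \<le> 7"
    unfolding ball_le7 using le x7 by (simp add: col_fun_def col_list_def)
  have add: "\<forall>i\<le>7. \<forall>j\<le>7. gel (?C (xo i j)) = gel (?C i) + gel (?C j)"
  proof -
    define f where "f = (\<lambda>i. [0, a, b, c, a + (b + c), a + b, a + c, b + c] ! i)"
    have "\<forall>i\<le>7. \<forall>j\<le>7. f (xo i j) = f i + f j"
      unfolding ball_le7 by (simp add: f_def xo_def xtab_def add_ac)
    moreover have "\<forall>i\<le>7. gel (?C i) = f i" using gC by (simp add: f_def)
    ultimately show ?thesis using x7 by simp
  qed
  have nz: "\<forall>i\<le>7. i \<noteq> 0 \<longrightarrow> gel (?C i) \<noteq> 0"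
  proof -
    have "\<forall>i\<le>7. i \<noteq> 0 \<longrightarrow> [0, a, b, c, a + (b + c), a + b, a + c, b + c] ! i \<noteq> 0"
      unfolding ball_le7 using n0 n1 by (simp del: add_eq_0_iff)
    with gC show ?thesis by simp
  qed
  have CI: "?C i \<in> I7" if "i \<in> I7" for i
  proof -
    have "i \<le> 7" "i \<noteq> 0" using that by (auto simp: I7_def)
    then have "gel (?C i) \<noteq> 0" "?C i \<le> 7" using nz C7 by blast+
    then show ?thesis using gel_0 by (cases "?C i = 0") (auto simp: I7_def)
  qed
  have inj: "inj_on ?C I7"
  proof (rule inj_onI, rule ccontr)
    fix i j assume ij: "i \<in> I7" "j \<in> I7" "?C i = ?C j" "i \<noteq> j"
    \<comment> \<open>By additivity, two equal values would give a nonzero degree with image 0,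
      which \<open>nz\<close> excludes.\<close>
    then have "gel (?C (xo i j)) = 0" using add I7_le by simp
    moreover have "xo i j \<le> 7" "xo i j \<noteq> 0" using ij x7 xo_nonzero' I7_le by blast+
    ultimately show False using nz by blast
  qed
  have "?C ` I7 \<subseteq> I7" using CI by blast
  then have "?C ` I7 = I7" by (rule endo_inj_surj[OF _ _ inj, rotated]) (simp add: I7_def)
  then have bij: "bij_betw ?C I7 I7" using inj by (intro bij_betw_imageI)
  have "?C (i \<star> j) = ?C i \<star> ?C j" if "i \<in> I7" "j \<in> I7" "i \<noteq> j" for i j
  proof -
    have d: "?C i \<noteq> ?C j" using inj_onD[OF inj _ that(1,2)] that(3) by blast
    have "gel (?C (i \<star> j)) = gel (?C i \<star> ?C j)"
      unfolding star_eq_xo[OF that] gel_star[OF CI[OF that(1)] CI[OF that(2)] d]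
      using add that I7_le by blast
    then show ?thesis using gel_inj I7_le CI star_I7[OF that] star_I7[OF CI[OF that(1)] CI[OF that(2)] d] by blast
  qed
  with bij show ?thesis unfolding coll_def by blast
qed

lemma coll_comp: assumes "coll \<pi>" "coll \<rho>" shows "coll (\<pi> \<circ> \<rho>)"
  using assms collD[OF assms(1)] collD[OF assms(2)] unfolding coll_def by (auto intro: bij_betw_trans)

lemma coll_image_edge: assumes "coll \<pi>" "t \<in> edges" shows "\<pi> ` t \<in> edges"
proof -
  obtain i j where t: "t = {i, j}" "i \<in> I7" "j \<in> I7" "i \<noteq> j" using assms(2) by (auto simp: edges_def)
  then have "\<pi> ` t = {\<pi> i, \<pi> j}" by simp
  then show ?thesis using t collD[OF assms(1)] by (simp add: edges_iff)
qed

lemma coll_inv: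
  assumes "coll \<pi>" shows "coll (inv_into I7 \<pi>)" "\<And>i. i \<in> I7 \<Longrightarrow> inv_into I7 \<pi> (\<pi> i) = i" "\<And>i. i \<in> I7 \<Longrightarrow> \<pi> (inv_into I7 \<pi> i) = i"
proof -
  let ?\<rho> = "inv_into I7 \<pi>"
  have bij: "bij_betw \<pi> I7 I7" using assms by (simp add: coll_def)
  show l: "?\<rho> (\<pi> i) = i" if "i \<in> I7" for i using bij_betw_inv_into_left[OF bij that] .
  show r: "\<pi> (?\<rho> i) = i" if "i \<in> I7" for i using bij_betw_inv_into_right[OF bij that] .
  have b: "bij_betw ?\<rho> I7 I7" by (rule bij_betw_inv_into[OF bij])
  have "?\<rho> (i \<star> j) = ?\<rho> i \<star> ?\<rho> j" if ij: "i \<in> I7" "j \<in> I7" "i \<noteq> j" for i j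
  proof -
    have \<rho>: "?\<rho> i \<in> I7" "?\<rho> j \<in> I7" using b ij by (auto simp: bij_betw_def)
    moreover have ne: "?\<rho> i \<noteq> ?\<rho> j" using r ij by metis
    ultimately have "\<pi> (?\<rho> i \<star> ?\<rho> j) = i \<star> j" using collD(3)[OF assms \<rho> ne] r ij by simp
    then show ?thesis using l[OF star_I7[OF \<rho> ne]] by simp
  qed
  with b show "coll ?\<rho>" unfolding coll_def by blast
qed

lemma generative_coll: assumes "coll \<pi>" "generative i j k" shows "generative (\<pi> i) (\<pi> j) (\<pi> k)"
  using assms(2) collD[OF assms(1)] star_I7[of i j] unfolding generative_def by metis

lemma nice_preimage:
  assumes \<pi>: "coll \<pi>" and T: "nice T" shows "nice {t \<in> edges. \<pi> ` t \<in> T}"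
  unfolding nice_def
proof (intro conjI allI impI subsetI)
  fix i j k t
  assume *: "generative i j k \<and> {i, j} \<in> {t \<in> edges. \<pi> ` t \<in> T} \<and> {i \<star> j, k} \<in> {t \<in> edges. \<pi> ` t \<in> T}"
    and t: "t \<in> P_set i j k"
  then have g: "generative i j k" "generative j k i" "generative k i j" using generative_rotate by blast+
  have st: "\<pi> (i \<star> j) = \<pi> i \<star> \<pi> j" "\<pi> (j \<star> k) = \<pi> j \<star> \<pi> k" "\<pi> (k \<star> i) = \<pi> k \<star> \<pi> i"
    using g collD(3)[OF \<pi>] unfolding generative_def by blast+
  have "\<pi> ` t \<in> P_set (\<pi> i) (\<pi> j) (\<pi> k)"
    using t unfolding P_set_def by (elim insertE emptyE) (simp_all add: st)
  moreover have "P_set (\<pi> i) (\<pi> j) (\<pi> k) \<subseteq> T"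
    using T * generative_coll[OF \<pi> g(1)] st(1) unfolding nice_def by simp
  moreover have "P_set i j k \<subseteq> edges"
    using g star_I7 unfolding P_set_def generative_def by (simp add: edges_iff)
  ultimately show "t \<in> {t \<in> edges. \<pi> ` t \<in> T}" using t by blast
qed simp

lemma T_lists_nth: "n \<in> {1..24} \<Longrightarrow> T_list n = T_lists ! (n - 1) \<and> n - 1 < length T_lists"
  by (auto simp: T_list_def T_lists_def)

lemma T_set_edges: "n \<in> {1..24} \<Longrightarrow> T_set n \<subseteq> edges"
proof -
  assume n: "n \<in> {1..24}"
  have "list_all (\<lambda>T. list_all (\<lambda>t. t \<in> set edge_list) T) T_lists" by code_simp
  then have "set (T_list n) \<subseteq> set edge_list"
    using T_lists_nth[OF n] unfolding list_all_iff by (metis nth_mem subsetI)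
  then show ?thesis unfolding T_set_list[OF n] edges_eq by blast
qed

lemma nice_extension:
  assumes n: "n \<in> {1..24}" and T: "nice T" "T_set n \<subset> T"
  obtains m \<pi> where "m \<in> {1..24}" "coll \<pi>" "(\<lambda>t. \<pi> ` t) ` T_set m \<subseteq> T" "length (T_list n) < length (T_list m)"
proof -
  obtain t where t: "t \<in> T" "t \<notin> T_set n" using T by blast
  then have "t \<in> un ` set edge_list" using T(1) unfolding nice_def edges_eq by blast
  then obtain p where p: "t = un p" "p \<in> set edge_list" by blast
  have pn: "p \<notin> set (T_list n)" using t(2) p(1) unfolding T_set_list[OF n] by blast
  have len: "n - 1 < length T_lists" and Tn: "T_list n = T_lists ! (n - 1)" using T_lists_nth[OF n] by blast+
  let ?cs = "extension_certs ! (n - 1)"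
  have ok: "list_all (cert_ok (T_list n)) ?cs" "filter (\<lambda>t. t \<notin> set (T_list n)) edge_list = map fst ?cs"
    using list_all2_nthD[OF extension_certs_correct len] unfolding Tn by blast+
  have "p \<in> set (map fst ?cs)" unfolding ok(2)[symmetric] using p(2) pn by simp
  then obtain c m a b d where c: "(p, c, m, (a, b, d)) \<in> set ?cs" by (auto simp: image_iff)
  then have "cert_ok (T_list n) (p, c, m, (a, b, d))" using ok(1) unfolding list_all_iff by blast
  then have m: "m \<noteq> 0" "m \<le> 24" "is_gen a b d" "length (T_list n) < length (T_list m)"
    and sub: "list_all (\<lambda>(u, v). ed (col_list a b d ! u) (col_list a b d ! v) \<in> set (fold close_step c (p # T_list n))) (T_list m)"
    unfolding cert_ok_def prod.case Let_def by blast+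
  have m24: "m \<in> {1..24}" using m by simp
  have "un ` set (p # T_list n) \<subseteq> T" using T t p(1) unfolding T_set_list[OF n] by auto
  then have L: "un ` set (fold close_step c (p # T_list n)) \<subseteq> T" by (rule close_steps_sound[OF T(1)])
  have "(\<lambda>t. col_fun a b d ` t) ` T_set m \<subseteq> T"
  proof
    fix s assume "s \<in> (\<lambda>t. col_fun a b d ` t) ` T_set m"
    then obtain u v where uv: "(u, v) \<in> set (T_list m)" "s = un (ed (col_fun a b d u) (col_fun a b d v))"
      unfolding T_set_list[OF m24] by (auto simp: un_def[of "(_, _)"])
    then have "ed (col_fun a b d u) (col_fun a b d v) \<in> set (fold close_step c (p # T_list n))"
      using sub unfolding list_all_iff col_fun_def by blast
    then show "s \<in> T" using L uv(2) by blast
  qed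
  then show ?thesis using that[OF m24 coll_col_fun[OF m(3)]] m(4) by blast
qed

text \<open>A collineation that maps some \<open>T_set n\<close> into T is improved step by step: as
  long as the preimage of T is strictly larger, \<open>nice_extension\<close> provides a longer
  list. Lengths are bounded by 21, the number of edges, and the process starts with the empty set
  and the identity.\<close>

theorem nice_classification:
  assumes T: "nice T"
  obtains n \<pi> where "n \<in> {1..24}" "coll \<pi>" "T_set n = {t \<in> edges. \<pi> ` t \<in> T}"
proof -
  have bound: "length (T_list n) \<le> 21" if "n \<in> {1..24}" for n
  proof -
    have "list_all (\<lambda>T. length T \<le> 21) T_lists" by code_simp
    then show ?thesis using T_lists_nth[OF that] unfolding list_all_iff by (metis nth_mem)
  qed
  have step: "\<exists>n \<pi>. n \<in> {1..24} \<and> coll \<pi> \<and> T_set n = {t \<in> edges. \<pi> ` t \<in> T}"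
    if "n \<in> {1..24}" "coll \<pi>" "T_set n \<subseteq> {t \<in> edges. \<pi> ` t \<in> T}" for n \<pi>
    using that
  proof (induction "21 - length (T_list n)" arbitrary: n \<pi> rule: less_induct)
    case less
    let ?T = "{t \<in> edges. \<pi> ` t \<in> T}"
    show ?case
    proof (cases "T_set n = ?T")
      case True
      with less.prems show ?thesis by blast
    next
      case False
      then have "T_set n \<subset> ?T" using less.prems(3) by blast
      then obtain m \<rho> where m: "m \<in> {1..24}" "coll \<rho>" "(\<lambda>t. \<rho> ` t) ` T_set m \<subseteq> ?T" "length (T_list n) < length (T_list m)"
        by (rule nice_extension[OF less.prems(1) nice_preimage[OF less.prems(2) T]])
      have "T_set m \<subseteq> {t \<in> edges. (\<pi> \<circ> \<rho>) ` t \<in> T}"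
      proof
        fix t assume t: "t \<in> T_set m"
        then have "\<rho> ` t \<in> ?T" using m(3) by blast
        then have "\<pi> ` \<rho> ` t \<in> T" by blast
        moreover have "(\<pi> \<circ> \<rho>) ` t = \<pi> ` \<rho> ` t" by (rule image_comp[symmetric])
        ultimately show "t \<in> {t \<in> edges. (\<pi> \<circ> \<rho>) ` t \<in> T}" using t T_set_edges[OF m(1)] by (simp only: mem_Collect_eq) blast
      qed
      moreover have "21 - length (T_list m) < 21 - length (T_list n)" using m(4) bound[OF m(1)] by simp
      ultimately show ?thesis using less.hyps m(1) coll_comp[OF less.prems(2) m(2)] by blast
    qed
  qed
  have "coll id" by (simp add: coll_def)
  moreover have "T_set 1 = {}" by (simp add: T_set_def)
  ultimately show ?thesis using step[of 1 id] that by auto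
qed

section \<open>Normal forms\<close>

lemma ball_I7: "(\<forall>i\<in>I7. P i) \<longleftrightarrow> P 1 \<and> P 2 \<and> P 3 \<and> P 4 \<and> P 5 \<and> P 6 \<and> P (7::nat)"
proof -
  have I: "I7 = {1,2,3,4,5,6,7}" by (auto simp: I7_def)
  show ?thesis unfolding I by simp
qed

lemma admissible_outside: "\<eta> \<in> admissible \<Longrightarrow> t \<notin> eta_support \<eta> \<Longrightarrow> \<eta> t = 0"
  by (auto simp: admissible_def eta_support_def)

text \<open>The map is pulled back along the collineation of \<open>nice_classification\<close>; the
  inverse collineation provides the equivalence.\<close>

lemma exact_support:
  assumes \<eta>: "\<eta> \<in> admissible"
  obtains n \<eta>' where "n \<in> {1..24}" "\<eta>' \<in> admissible" "eta_equiv \<eta> \<eta>'" "eta_support \<eta>' = T_set n"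
proof -
  obtain n \<pi> where n: "n \<in> {1..24}" "coll \<pi>" "T_set n = {t \<in> edges. \<pi> ` t \<in> eta_support \<eta>}"
    by (rule nice_classification[OF nice_support[OF \<eta>]])
  define \<eta>' where "\<eta>' t = (if t \<in> edges then \<eta> (\<pi> ` t) else 0)" for t
  have e: "\<eta>' {i, j} = \<eta> {\<pi> i, \<pi> j}" if "i \<in> I7" "j \<in> I7" "i \<noteq> j" for i j
    using that by (simp add: \<eta>'_def edges_iff)
  have e3: "eta3 \<eta>' i j k = eta3 \<eta> (\<pi> i) (\<pi> j) (\<pi> k)" if g: "generative i j k" for i j k
  proof -
    have g': "i \<in> I7" "j \<in> I7" "k \<in> I7" "j \<noteq> k" "i \<noteq> j \<star> k"
      using g generative_rotate[OF g] by (auto simp: generative_def)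
    show ?thesis unfolding eta3_def e[OF g'(1) star_I7[OF g'(2-4)] g'(5)] e[OF g'(2-4)] collD(3)[OF n(2) g'(2-4)] ..
  qed
  have "\<eta>' \<in> admissible"
    unfolding admissible_def
  proof (intro CollectI conjI allI impI)
    fix i j k assume g: "generative i j k"
    show "eta3 \<eta>' i j k = eta3 \<eta>' j k i"
      unfolding e3[OF g] e3[OF generative_rotate[OF g]]
      using \<eta> generative_coll[OF n(2) g] unfolding admissible_def by blast
  qed (simp add: \<eta>'_def)
  moreover have "eta_equiv \<eta> \<eta>'"
  proof (rule coll_equiv[OF coll_inv(1)[OF n(2)]])
    fix i j assume ij: "i \<in> I7" "j \<in> I7" "i \<noteq> j"
    let ?\<rho> = "inv_into I7 \<pi>"
    have "?\<rho> i \<in> I7" "?\<rho> j \<in> I7" using collD(1)[OF coll_inv(1)[OF n(2)]] ij by blast+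
    moreover have "?\<rho> i \<noteq> ?\<rho> j" using coll_inv(3)[OF n(2)] ij by metis
    ultimately show "\<eta>' {?\<rho> i, ?\<rho> j} = \<eta> {i, j}" using coll_inv(3)[OF n(2)] ij by (simp add: e)
  qed
  moreover have "eta_support \<eta>' = T_set n"
    unfolding n(3) eta_support_def \<eta>'_def using coll_image_edge[OF n(2)] by auto
  ultimately show ?thesis using that n(1) by blast
qed

text \<open>Rescaling multiplies \<open>eta3\<close> by a quantity symmetric in i, j, k, since the
  factor of the intermediate degree j * k cancels. Admissibility is therefore preserved.\<close>

lemma normalize:
  assumes \<eta>: "\<eta> \<in> admissible" and nz: "\<And>i. i \<in> I7 \<Longrightarrow> \<alpha> i \<noteq> (0::complex)"
  obtains \<eta>' where "\<eta>' \<in> admissible" "eta_equiv \<eta> \<eta>'" "eta_support \<eta>' = eta_support \<eta>"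
    "\<And>i j. i \<in> I7 \<Longrightarrow> j \<in> I7 \<Longrightarrow> i \<noteq> j \<Longrightarrow> \<eta>' {i, j} = \<eta> {i, j} * \<alpha> (i \<star> j) / (\<alpha> i * \<alpha> j)"
proof -
  define \<eta>' where "\<eta>' t = \<eta> t * (\<alpha> (Min t \<star> Max t) / (\<alpha> (Min t) * \<alpha> (Max t)))" for t
  have e: "\<eta>' {i, j} = \<eta> {i, j} * \<alpha> (i \<star> j) / (\<alpha> i * \<alpha> j)" if ij: "i \<in> I7" "j \<in> I7" "i \<noteq> j" for i j
  proof (cases "i < j")
    case True
    then show ?thesis by (simp add: \<eta>'_def)
  next
    case False
    then show ?thesis using ij star_commute[OF ij] by (simp add: \<eta>'_def mult.commute)
  qed
  have e3: "eta3 \<eta>' i j k = eta3 \<eta> i j k * (\<alpha> (idx (gel i + (gel j + gel k))) / (\<alpha> i * \<alpha> j * \<alpha> k))"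
    if g: "generative i j k" for i j k
  proof -
    have g': "i \<in> I7" "j \<in> I7" "k \<in> I7" "j \<noteq> k" "i \<noteq> j \<star> k"
      using g generative_rotate[OF g] by (auto simp: generative_def)
    have "i \<star> (j \<star> k) = idx (gel i + (gel j + gel k))"
      unfolding gel_star[OF g'(2-4), symmetric] gel_star[OF g'(1) star_I7[OF g'(2-4)] g'(5), symmetric]
      using star_I7[OF g'(1) star_I7[OF g'(2-4)] g'(5)] by (simp add: I7_le)
    then show ?thesis unfolding eta3_def e[OF g'(1) star_I7[OF g'(2-4)] g'(5)] e[OF g'(2-4)]
      using nz[OF star_I7[OF g'(2-4)]] by (simp add: mult_ac)
  qed
  have "\<eta>' \<in> admissible"
    unfolding admissible_def
  proof (intro CollectI conjI allI impI)
    fix i j k assume g: "generative i j k"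
    have s: "gel j + (gel k + gel i) = gel i + (gel j + gel k)" by (simp add: add_ac)
    have r: "eta3 \<eta> i j k = eta3 \<eta> j k i" using \<eta> g unfolding admissible_def by blast
    show "eta3 \<eta>' i j k = eta3 \<eta>' j k i"
      unfolding e3[OF g] e3[OF generative_rotate[OF g]] s r by (simp add: mult_ac)
  qed (use \<eta> in \<open>simp add: \<eta>'_def admissible_def\<close>)
  moreover have "eta_equiv \<eta> \<eta>'"
    by (rule eta_equiv_normalize[where \<alpha> = \<alpha>]) (use nz in \<open>simp_all add: e\<close>)
  moreover have "eta_support \<eta>' = eta_support \<eta>"
  proof -
    have "\<eta>' t = 0 \<longleftrightarrow> \<eta> t = 0" if te: "t \<in> edges" for t
    proof -
      obtain i j where t: "t = {i, j}" "i \<in> I7" "j \<in> I7" "i \<noteq> j" using te by (auto simp: edges_def)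
      show ?thesis unfolding t(1) e[OF t(2-4)] using nz t(2-4) star_I7[OF t(2-4)] by simp
    qed
    then show ?thesis by (auto simp: eta_support_def)
  qed
  ultimately show ?thesis using that e by blast
qed

lemma normalize_list:
  assumes \<eta>: "\<eta> \<in> admissible" and nz: "\<forall>i\<in>I7. \<alpha> i \<noteq> (0::complex)"
    and B: "\<forall>(i, j)\<in>set B. i \<in> I7 \<and> j \<in> I7 \<and> i \<noteq> j \<and> \<eta> {i, j} * \<alpha> (xo i j) = \<alpha> i * \<alpha> j"
  obtains \<eta>' where "\<eta>' \<in> admissible" "eta_equiv \<eta> \<eta>'" "eta_support \<eta>' = eta_support \<eta>"
    "\<forall>(i, j)\<in>set B. \<eta>' {i, j} = 1"
proof -
  obtain \<eta>' where \<eta>': "\<eta>' \<in> admissible" "eta_equiv \<eta> \<eta>'" "eta_support \<eta>' = eta_support \<eta>"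
    "\<And>i j. i \<in> I7 \<Longrightarrow> j \<in> I7 \<Longrightarrow> i \<noteq> j \<Longrightarrow> \<eta>' {i, j} = \<eta> {i, j} * \<alpha> (i \<star> j) / (\<alpha> i * \<alpha> j)"
    using normalize[OF \<eta>, of \<alpha>] nz by blast
  have "\<eta>' {i, j} = 1" if "(i, j) \<in> set B" for i j
  proof -
    have ij: "i \<in> I7" "j \<in> I7" "i \<noteq> j" "\<eta> {i, j} * \<alpha> (xo i j) = \<alpha> i * \<alpha> j" using B that by blast+
    show ?thesis unfolding \<eta>'(4)[OF ij(1-3)] star_eq_xo[OF ij(1-3)] ij(4) using nz ij(1,2) by simp
  qed
  then show ?thesis using that \<eta>'(1-3) by blast
qed

lemma square_root_nonzero: "(c::complex) \<noteq> 0 \<Longrightarrow> \<exists>r. c = r * r \<and> r \<noteq> 0"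
  by (rule exI[of _ "csqrt c"]) (simp flip: power2_eq_square)

lemma eq_on_T_list:
  assumes n: "n \<in> {1..24}" and f: "f \<in> admissible" "eta_support f = T_set n"
    and g: "g \<in> admissible" "eta_support g = T_set n" and eq: "\<forall>p\<in>set (T_list n). f (un p) = g (un p)"
  shows "f = g"
proof
  fix t
  show "f t = g t"
  proof (cases "t \<in> T_set n")
    case True
    then show ?thesis using eq unfolding T_set_list[OF n] by blast
  next
    case False
    then show ?thesis using admissible_outside[OF f(1)] admissible_outside[OF g(1)] f(2) g(2) by simp
  qed
qed

lemma support_nonzero:
  assumes "n \<in> {1..24}" "eta_support \<eta> = T_set n"
  shows "\<forall>p\<in>set (T_list n). \<eta> (un p) \<noteq> 0"
  using assms(2) unfolding T_set_list[OF assms(1)] eta_support_def by blast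

lemma T_lists_admissible:
  "list_all (\<lambda>T. list_all (\<lambda>(i, j, k).
      let a = ed i (xo j k) \<in> set T \<and> ed j k \<in> set T; b = ed j (xo k i) \<in> set T \<and> ed k i \<in> set T;
        c = ed k (xo i j) \<in> set T \<and> ed i j \<in> set T in (a = b) \<and> (b = c)) gen_triples) T_lists"
  by code_simp

lemma inj_un: "un (ed i j) \<in> un ` set (T_list n) \<longleftrightarrow> ed i j \<in> set (T_list n)"
  if "n \<in> {1..24}" for i j n
proof -
  have "list_all (\<lambda>T. list_all (\<lambda>t. fst t < snd t) T) T_lists" by code_simp
  then have s: "fst p < snd p" if "p \<in> set (T_list n)" for p
    using T_lists_nth[OF \<open>n \<in> {1..24}\<close>] that unfolding list_all_iff by (metis nth_mem)
  have "p = ed i j" if "p \<in> set (T_list n)" "un p = {i, j}" for p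
    using s[OF that(1)] that(2) by (cases p) (auto simp: un_def ed_def doubleton_eq_iff)
  then show ?thesis by auto (metis imageI un_ed)
qed

text \<open>For a map with values 0 and 1 the admissibility equations are Boolean conditions on
  membership, decided by \<open>T_lists_admissible\<close>.\<close>

lemma eta_ind_admissible: assumes n: "n \<in> {1..24}" shows "eta_ind (T_set n) \<in> admissible"
proof (rule admissibleI)
  show "t \<notin> edges \<Longrightarrow> eta_ind (T_set n) t = 0" for t using T_set_edges[OF n] by (auto simp: eta_ind_def)
  fix i j k assume t: "(i, j, k) \<in> set gen_triples" and g: "generative i j k"
  have m: "{a, b} \<in> T_set n \<longleftrightarrow> ed a b \<in> set (T_list n)" for a b
    unfolding T_set_list[OF n] using inj_un[OF n, of a b] by simp
  have st: "j \<star> k = xo j k" "k \<star> i = xo k i" "i \<star> j = xo i j"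
    using g by (simp_all add: generative_def star_eq_xo)
  have "T_list n \<in> set T_lists" using T_lists_nth[OF n] by (metis nth_mem)
  then have "(ed i (xo j k) \<in> set (T_list n) \<and> ed j k \<in> set (T_list n)) =
      (ed j (xo k i) \<in> set (T_list n) \<and> ed k i \<in> set (T_list n)) \<and>
    (ed j (xo k i) \<in> set (T_list n) \<and> ed k i \<in> set (T_list n)) =
      (ed k (xo i j) \<in> set (T_list n) \<and> ed i j \<in> set (T_list n))"
    using T_lists_admissible t unfolding list_all_iff Let_def by blast
  then show "eta3 (eta_ind (T_set n)) i j k = eta3 (eta_ind (T_set n)) j k i \<and>
      eta3 (eta_ind (T_set n)) j k i = eta3 (eta_ind (T_set n)) k i j"
    unfolding eta3_def eta_ind_def m st by auto
qed

lemma eta_ind_support: "n \<in> {1..24} \<Longrightarrow> eta_support (eta_ind (T_set n)) = T_set n"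
  using T_set_edges[of n] by (auto simp: eta_support_def eta_ind_def)

lemma eq_eta_ind:
  assumes n: "n \<in> {1..24}" and f: "f \<in> admissible" "eta_support f = T_set n"
    and eq: "\<forall>p\<in>set (T_list n). f (un p) = 1"
  shows "f = eta_ind (T_set n)"
proof (rule eq_on_T_list[OF n f eta_ind_admissible[OF n] eta_ind_support[OF n]])
  show "\<forall>p\<in>set (T_list n). f (un p) = eta_ind (T_set n) (un p)"
    using eq unfolding T_set_list[OF n] by (simp add: eta_ind_def)
qed

lemma eta_equiv_trans: "eta_equiv \<eta> \<eta>' \<Longrightarrow> eta_equiv \<eta>' \<eta>'' \<Longrightarrow> eta_equiv \<eta> \<eta>''"
  unfolding eta_equiv_def by (rule gc_equiv_trans)

text \<open>All \<open>eta3\<close> vanish. A nonzero one would have 1 in both of its edges, hence 1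
  = j * k with 1 in {j, k}, which is impossible. Values on the star at 1 can thus be chosen
  freely.\<close>

lemma star_admissible:
  assumes "\<And>t. t \<notin> T_set 20 \<Longrightarrow> \<eta> t = 0" shows "\<eta> \<in> admissible"
  unfolding admissible_def
proof (intro CollectI conjI allI impI)
  fix t :: "nat set" assume "t \<notin> edges"
  then show "\<eta> t = 0" using assms T_set_edges[of 20] by auto
next
  fix i j k assume g: "generative i j k"
  have one: "1 \<in> {a, b}" if "\<eta> {a, b} \<noteq> 0" for a b using assms[of "{a, b}"] that unfolding T_set_20 by auto
  have z: "eta3 \<eta> i j k = 0" if g: "generative i j k" for i j k
  proof (rule ccontr)
    assume "eta3 \<eta> i j k \<noteq> 0"
    then have a: "1 \<in> {i, j \<star> k}" "1 \<in> {j, k}" unfolding eta3_def using one by auto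
    have I: "i \<in> I7" "j \<in> I7" "k \<in> I7" "i \<noteq> j" "i \<noteq> k" "j \<noteq> k" using g by (auto simp: generative_def)
    then have "1 = j \<star> k" using a by auto
    then have "gel 1 = gel j + gel k" using gel_star[OF I(2,3,6)] by (simp only:)
    moreover have "gel 1 = gel j \<or> gel 1 = gel k" using a(2) by auto
    ultimately have "gel k = 0 \<or> gel j = 0" by (metis grp_add_cancel(1) grp_add_cancel(4) grp_add_self)
    then show False using gel_nonzero I by blast
  qed
  show "eta3 \<eta> i j k = eta3 \<eta> j k i" using z[OF g] z[OF generative_rotate[OF g]] by simp
qed

lemma eta_star_admissible: "eta14 l \<in> admissible" "eta17 l \<in> admissible" "eta20 l m \<in> admissible"
  by (rule star_admissible; simp add: T_set_20 eta14_def eta17_def eta20_def)+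

lemma admissible_relation:
  assumes \<eta>: "\<eta> \<in> admissible" and "is_gen i j k"
  shows "\<eta> {i, xo j k} * \<eta> {j, k} = \<eta> {j, xo k i} * \<eta> {k, i}"
proof -
  have g: "generative i j k" by (rule generative_list) fact
  then have "eta3 \<eta> i j k = eta3 \<eta> j k i" using \<eta> unfolding admissible_def by blast
  then show ?thesis using g by (simp add: eta3_def generative_def star_eq_xo)
qed

section \<open>Normalization by monomials in square roots\<close>

text \<open>For each \<open>n\<close>: edges \<open>b\<^sub>1, b\<^sub>2, \<dots>\<close> of \<open>T\<^sub>n\<close>; exponents \<open>M\<close> such that \<open>\<alpha>\<^sub>i = \<Prod>\<^sub>k r\<^sub>k powi M\<^sub>i\<^sub>k\<close> with
  \<open>r\<^sub>k\<^sup>2 = \<eta> b\<^sub>k\<close> normalizes \<open>\<eta>\<close> to \<open>1\<close> on these edges (the list index \<open>0\<close> is not used); and generative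
  triples whose admissibility equations force the value \<open>1\<close> on the remaining edges. In the three
  families \<open>n = 14, 17, 20\<close> only part of the support is normalized.\<close>

definition normal_certs :: "((nat \<times> nat) list \<times> int list list \<times> (nat \<times> nat \<times> nat) list) list" where
  "normal_certs = [
    ([], [], []),
    ([(1,2)], [[0], [2], [0], [0], [0], [0], [0], [0]], []),
    ([(1,2), (1,3)], [[0,0], [0,0], [2,0], [0,2], [0,0], [0,0], [0,0], [0,0]], []),
    ([(1,2), (1,5)], [[0,0], [1,1], [1,-1], [0,0], [0,0], [0,0], [0,0], [0,0]], []),
    ([(1,2), (6,7)], [[0,0], [2,0], [0,0], [0,0], [0,0], [0,0], [0,2], [0,0]], []),
    ([(1,2), (1,5), (2,5)], [[0,0,0], [1,1,0], [1,0,1], [0,0,0], [0,0,0], [0,1,1], [0,0,0],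
      [0,0,0]], []),
    ([(2,5), (3,6), (4,7)], [[0,0,0], [0,0,0], [2,0,0], [0,2,0], [0,0,2], [0,0,0], [0,0,0],
      [0,0,0]], []),
    ([(1,2), (1,3), (1,4)], [[0,0,0], [0,0,0], [2,0,0], [0,2,0], [0,0,2], [0,0,0], [0,0,0],
      [0,0,0]], []),
    ([(1,2), (1,3), (1,5)], [[0,0,0], [1,0,1], [1,0,-1], [-1,2,-1], [0,0,0], [0,0,0], [0,0,0],
      [0,0,0]], []),
    ([(1,2), (1,3), (1,7)], [[0,0,0], [0,0,0], [2,0,0], [0,2,0], [0,0,-2], [0,0,0], [0,0,0],
      [0,0,0]], []),
    ([(1,2), (1,6), (2,6)], [[0,0,0], [0,0,0], [0,0,0], [0,-2,0], [0,0,-2], [-2,0,0], [0,0,0],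
      [0,0,0]], []),
    ([(1,2), (1,6), (6,7)], [[0,0,0], [0,0,0], [2,0,0], [0,-2,0], [0,0,0], [0,0,0], [0,0,0],
      [0,0,2]], []),
    ([(1,2), (1,3), (1,4), (1,5)], [[0,0,0,0], [1,0,0,1], [1,0,0,-1], [-1,2,0,-1], [-1,0,2,-1],
      [0,0,0,0], [0,0,0,0], [0,0,0,0]], []),
    ([(1,2), (1,3), (1,5)], [[0,0,0], [1,0,1], [1,0,-1], [-1,2,-1], [0,0,0], [0,0,0], [0,0,0],
      [0,0,0]], []),
    ([(1,2), (1,6), (1,7), (2,6)], [[0,0,0,0], [0,0,0,0], [0,0,0,2], [0,-2,0,0], [0,0,0,0],
      [-2,0,0,2], [0,0,0,0], [0,0,2,0]], []),
    ([(1,2), (1,6), (2,7), (6,7)], [[0,0,0,0], [1,1,-1,-1], [1,-1,1,-1], [1,-1,-1,-1], [0,0,0,0],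
      [0,0,0,-2], [0,0,0,0], [0,0,0,0]], []),
    ([(1,2), (1,3), (1,4), (1,5)], [[0,0,0,0], [1,0,0,1], [1,0,0,-1], [-1,2,0,-1], [-1,0,2,-1],
      [0,0,0,0], [0,0,0,0], [0,0,0,0]], []),
    ([(1,2), (1,6), (1,7), (2,6), (2,7)], [[0,0,0,0,0], [0,1,1,-1,-1], [0,0,0,0,0], [0,0,0,0,-2],
      [0,1,-1,-1,-1], [-2,1,1,-1,-1], [0,1,-1,1,-1], [0,0,0,0,0]], []),
    ([(3,4), (3,6), (3,7), (4,6), (4,7), (6,7)], [[0,0,0,0,0,0], [1,0,-1,1,-2,-1],
      [1,1,-2,0,-1,-1], [1,1,0,0,-1,-1], [1,0,-1,1,0,-1], [0,1,-1,1,-1,-2], [0,1,-1,1,-1,0],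
      [0,0,0,0,0,0]], []),
    ([(1,2), (1,3), (1,4), (1,5)], [[0,0,0,0], [1,0,0,1], [1,0,0,-1], [-1,2,0,-1], [-1,0,2,-1],
      [0,0,0,0], [0,0,0,0], [0,0,0,0]], []),
    ([(1,7), (2,3), (2,6), (3,5)], [[0,0,0,0], [2,0,0,0], [0,2,0,0], [0,0,0,0], [0,0,0,0],
      [0,0,0,2], [0,-2,2,0], [0,0,0,0]], [(2,1,3), (3,1,2)]),
    ([(1,2), (1,3), (1,6), (2,3), (2,6)], [[0,0,0,0,0], [0,1,1,0,0], [0,0,0,0,0], [0,1,-1,0,0],
      [0,0,0,0,-2], [-2,1,1,0,0], [0,0,0,0,0], [0,1,-1,-2,0]], [(1,2,3), (1,2,6), (3,1,2), (3,1,5),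
      (5,1,3)]),
    ([(1,2), (1,5), (1,6), (2,3), (2,5), (4,5)], [[0,0,0,0,0,0], [1,1,0,0,0,0], [1,0,0,0,1,0],
      [0,0,0,0,0,0], [0,-1,0,0,-1,2], [0,1,0,0,1,0], [-1,-1,2,0,0,0], [1,0,0,-2,1,0]], [(1,4,2),
      (1,4,5), (2,3,5), (4,2,5), (5,2,3), (5,2,4), (2,6,5), (2,7,1), (2,7,5)]),
    ([(1,3), (1,6), (2,4), (2,7), (3,5), (3,6), (4,6)], [[0,0,0,0,0,0,0], [1,1,0,0,0,0,0],
      [0,1,1,0,0,1,-1], [1,0,0,0,0,1,0], [0,0,1,0,0,0,1], [-1,0,1,0,2,-1,1], [0,1,0,0,0,1,0],
      [1,-1,-1,2,0,0,1]], [(2,1,4), (2,1,7), (5,1,3), (3,2,5), (2,6,7), (2,3,4), (3,4,1), (3,4,6),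
      (3,4,7), (3,5,1), (5,3,2), (3,6,2), (1,4,5), (1,4,6)])]"

text \<open>Compares the exponents of r_k on the two sides of \<alpha>_i \<alpha>_j = \<alpha>_{i*j}
  r_q^2, the normalization equation of the q-th edge {i, j}.\<close>

definition exponents_ok :: "(nat \<times> nat) list \<Rightarrow> int list list \<Rightarrow> bool" where
  "exponents_ok B M \<longleftrightarrow> list_all (\<lambda>q. let i = fst (B ! q); j = snd (B ! q) in list_all (\<lambda>k.
     M ! i ! k + M ! j ! k = M ! xo i j ! k + (if k = q then 2 else 0)) [0..<length B]) [0..<length B]"

text \<open>An admissibility equation equates two products of two values; once three of the four are
  1, so is the fourth.\<close>

definition force_step :: "nat \<times> nat \<times> nat \<Rightarrow> (nat \<times> nat) list \<Rightarrow> (nat \<times> nat) list" where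
  "force_step = (\<lambda>(i, j, k) L. if is_gen i j k \<and> ed j (xo k i) \<in> set L \<and> ed k i \<in> set L
     then if ed j k \<in> set L then ed i (xo j k) # L else if ed i (xo j k) \<in> set L then ed j k # L else L
     else L)"

lemma normal_certs_correct:
  "list_all (\<lambda>n. case normal_certs ! (n - 1) of (B, M, c) \<Rightarrow> exponents_ok B M \<and>
     list_all (\<lambda>p. p \<in> set (T_list n)) B \<and>
     (n \<in> set [14, 17, 20] \<or> list_all (\<lambda>p. p \<in> set (fold force_step c B)) (T_list n))) [1..<25]"
  by code_simp

lemma normal_certs_nth:
  assumes n: "n \<in> {1..24}" and c: "normal_certs ! (n - 1) = (B, M, c)"
  shows "exponents_ok B M" "set B \<subseteq> set (T_list n)"
    "n \<notin> {14, 17, 20} \<Longrightarrow> set (T_list n) \<subseteq> set (fold force_step c B)"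
proof -
  have "n \<in> set [1..<25]" using n by simp
  from bspec[OF normal_certs_correct[unfolded list_all_iff] this]
  have "exponents_ok B M \<and> (\<forall>p\<in>set B. p \<in> set (T_list n)) \<and>
     (n \<in> set [14, 17, 20] \<or> (\<forall>p\<in>set (T_list n). p \<in> set (fold force_step c B)))"
    unfolding c prod.case .
  then show "exponents_ok B M" "set B \<subseteq> set (T_list n)"
    "n \<notin> {14, 17, 20} \<Longrightarrow> set (T_list n) \<subseteq> set (fold force_step c B)" by auto
qed

lemma force_step_sound:
  assumes \<eta>: "\<eta> \<in> admissible" and L: "\<forall>p\<in>set L. \<eta> (un p) = 1"
  shows "\<forall>p\<in>set (force_step s L). \<eta> (un p) = 1"
proof -
  obtain i j k where s: "s = (i, j, k)" by (cases s)
  have 1: "\<eta> {a, b} = 1" if "ed a b \<in> set L" for a b using L that un_ed by metis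
  show ?thesis
  proof (cases "is_gen i j k \<and> ed j (xo k i) \<in> set L \<and> ed k i \<in> set L")
    case True
    then have "\<eta> {i, xo j k} * \<eta> {j, k} = 1" using admissible_relation[OF \<eta>, of i j k] 1 by simp
    then show ?thesis using True L 1[of j k] 1[of i "xo j k"] unfolding s force_step_def
      by (cases "ed j k \<in> set L"; cases "ed i (xo j k) \<in> set L") simp_all
  next
    case False
    then have "force_step s L = L" unfolding s force_step_def prod.case by (rule if_not_P)
    then show ?thesis using L by simp
  qed
qed

lemma force_steps_sound:
  assumes \<eta>: "\<eta> \<in> admissible" shows "\<forall>p\<in>set L. \<eta> (un p) = 1 \<Longrightarrow> \<forall>p\<in>set (fold force_step c L). \<eta> (un p) = 1"
proof (induction c arbitrary: L)
  case (Cons s c)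
  show ?case using Cons.IH[OF force_step_sound[OF \<eta> Cons.prems]] by simp
qed simp

lemma normalize_cert:
  assumes n: "n \<in> {1..24}" and \<eta>: "\<eta> \<in> admissible" "eta_support \<eta> = T_set n"
    and c: "normal_certs ! (n - 1) = (B, M, c)"
  obtains \<eta>' where "\<eta>' \<in> admissible" "eta_equiv \<eta> \<eta>'" "eta_support \<eta>' = T_set n"
    "\<forall>p\<in>set B. \<eta>' (un p) = 1"
proof -
  note ok = normal_certs_nth(1)[OF n c] and BT = normal_certs_nth(2)[OF n c]
  \<comment> \<open>The normalization equations may have solutions with half-integral exponents
    only; passing to square roots makes them integral.\<close>
  have "\<forall>p\<in>set B. \<exists>r. \<eta> (un p) = r * r \<and> r \<noteq> 0"
    using support_nonzero[OF n \<eta>(2)] BT square_root_nonzero by blast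
  then obtain \<rho> where \<rho>: "\<And>p. p \<in> set B \<Longrightarrow> \<eta> (un p) = \<rho> p * \<rho> p \<and> \<rho> p \<noteq> 0" by metis
  define r where "r k = \<rho> (B ! k)" for k
  have r: "r k \<noteq> 0" if "k < length B" for k using \<rho> that unfolding r_def by simp
  define \<alpha> where "\<alpha> i = (\<Prod>k<length B. r k powi (M ! i ! k))" for i
  have nz: "\<forall>i\<in>I7. \<alpha> i \<noteq> 0" unfolding \<alpha>_def using r by (simp add: power_int_eq_0_iff)
  have "\<forall>(i, j)\<in>set B. i \<in> I7 \<and> j \<in> I7 \<and> i \<noteq> j \<and> \<eta> {i, j} * \<alpha> (xo i j) = \<alpha> i * \<alpha> j"
  proof (intro ballI, clarify)
    fix i j assume ij: "(i, j) \<in> set B"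
    then obtain q where q: "q < length B" "B ! q = (i, j)" by (metis in_set_conv_nth)
    have "{i, j} \<in> edges"
      using ij BT T_set_edges[OF n] unfolding T_set_list[OF n] un_def by force
    moreover have "\<eta> {i, j} * \<alpha> (xo i j) = \<alpha> i * \<alpha> j"
    proof -
      have ex: "M ! i ! k + M ! j ! k = M ! xo i j ! k + (if k = q then 2 else 0)" if "k < length B" for k
        using ok q that unfolding exponents_ok_def list_all_iff Let_def by force
      have "\<alpha> i * \<alpha> j = (\<Prod>k<length B. r k powi (M ! i ! k + M ! j ! k))"
        unfolding \<alpha>_def prod.distrib[symmetric] using r by (intro prod.cong) (simp_all add: power_int_add)
      also have "\<dots> = (\<Prod>k<length B. r k powi (M ! xo i j ! k) * (if k = q then r k * r k else 1))"
        using r by (intro prod.cong) (auto simp: ex power_int_add power2_eq_square)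
      also have "\<dots> = \<alpha> (xo i j) * (r q * r q)"
        unfolding prod.distrib \<alpha>_def using q by simp
      also have "r q * r q = \<eta> {i, j}" using \<rho>[OF ij] q unfolding r_def un_def by simp
      finally show ?thesis by (simp add: mult.commute)
    qed
    ultimately show "i \<in> I7 \<and> j \<in> I7 \<and> i \<noteq> j \<and> \<eta> {i, j} * \<alpha> (xo i j) = \<alpha> i * \<alpha> j"
      by (simp add: edges_iff)
  qed
  then obtain \<eta>' where \<eta>': "\<eta>' \<in> admissible" "eta_equiv \<eta> \<eta>'" "eta_support \<eta>' = eta_support \<eta>"
    and B: "\<forall>(i, j)\<in>set B. \<eta>' {i, j} = 1"
    by (rule normalize_list[OF \<eta>(1) nz])
  have "\<forall>p\<in>set B. \<eta>' (un p) = 1" using B by (auto simp: un_def)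
  then show ?thesis using that \<eta>' \<eta>(2) by metis
qed

lemma normal_form_ind:
  assumes n: "n \<in> {1..24}" "n \<notin> {14, 17, 20}" and \<eta>: "\<eta> \<in> admissible" "eta_support \<eta> = T_set n"
  shows "eta_equiv \<eta> (eta_ind (T_set n))"
proof -
  obtain B M c where c: "normal_certs ! (n - 1) = (B, M, c)" by (metis prod_cases3)
  obtain \<eta>' where \<eta>': "\<eta>' \<in> admissible" "eta_equiv \<eta> \<eta>'" "eta_support \<eta>' = T_set n"
    and B: "\<forall>p\<in>set B. \<eta>' (un p) = 1" by (rule normalize_cert[OF n(1) \<eta> c])
  have "set (T_list n) \<subseteq> set (fold force_step c B)" by (rule normal_certs_nth(3)[OF n(1) c n(2)])
  then have "\<forall>p\<in>set (T_list n). \<eta>' (un p) = 1" using force_steps_sound[OF \<eta>'(1) B] by blast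
  then have "\<eta>' = eta_ind (T_set n)" by (rule eq_eta_ind[OF n(1) \<eta>'(1,3)])
  with \<eta>'(2) show ?thesis by simp
qed

lemma normal_form_14:
  assumes \<eta>: "\<eta> \<in> admissible" "eta_support \<eta> = T_set 14"
  shows "\<exists>l. l \<noteq> 0 \<and> eta_equiv \<eta> (eta14 l)"
proof -
  have n: "14 \<in> {1..24::nat}" by simp
  obtain M c where c: "normal_certs ! (14 - 1) = ([(1,2),(1,3),(1,5)], M, c)" by (simp add: normal_certs_def)
  obtain \<eta>' where \<eta>': "\<eta>' \<in> admissible" "eta_equiv \<eta> \<eta>'" "eta_support \<eta>' = T_set 14"
    and B: "\<forall>p\<in>set [(1,2),(1,3),(1,5)]. \<eta>' (un p) = 1" by (rule normalize_cert[OF n \<eta> c])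
  have B: "\<eta>' {1,2} = 1" "\<eta>' {1,3} = 1" "\<eta>' {1,5} = 1" using B by (simp_all add: un_def)
  have l: "\<eta>' {1,6} \<noteq> 0"
    using support_nonzero[OF n] \<eta>'(3) \<eta>(2) by (simp add: T_list_def T_lists_def un_def)
  have "\<eta>' = eta14 (\<eta>' {1,6})"
  proof (rule eq_on_T_list[OF n \<eta>'(1) _ eta_star_admissible(1) eta_support_eta14[OF l]])
    show "eta_support \<eta>' = T_set 14" using \<eta>'(3) \<eta>(2) by simp
    show "\<forall>p\<in>set (T_list 14). \<eta>' (un p) = eta14 (\<eta>' {1,6}) (un p)"
      using B by (simp add: T_list_def T_lists_def un_def eta14_def doubleton_eq_iff)
  qed
  with \<eta>'(2) l show ?thesis by metis
qed

lemma normal_form_17: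
  assumes \<eta>: "\<eta> \<in> admissible" "eta_support \<eta> = T_set 17"
  shows "\<exists>l. l \<noteq> 0 \<and> eta_equiv \<eta> (eta17 l)"
proof -
  have n: "17 \<in> {1..24::nat}" by simp
  obtain M c where c: "normal_certs ! (17 - 1) = ([(1,2),(1,3),(1,4),(1,5)], M, c)" by (simp add: normal_certs_def)
  obtain \<eta>' where \<eta>': "\<eta>' \<in> admissible" "eta_equiv \<eta> \<eta>'" "eta_support \<eta>' = T_set 17"
    and B: "\<forall>p\<in>set [(1,2),(1,3),(1,4),(1,5)]. \<eta>' (un p) = 1" by (rule normalize_cert[OF n \<eta> c])
  have B: "\<eta>' {1,2} = 1" "\<eta>' {1,3} = 1" "\<eta>' {1,4} = 1" "\<eta>' {1,5} = 1" using B by (simp_all add: un_def)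
  obtain l where l: "\<eta>' {1,6} = l * l" "l \<noteq> 0"
    using square_root_nonzero support_nonzero[OF n] \<eta>'(3) \<eta>(2) by (simp add: T_list_def T_lists_def un_def) metis
  \<comment> \<open>Scaling the component of degree g_6 by l distributes the parameter evenly: the
    values (1, l^2) on {1,3}, {1,6} become (l, l). The list index 0 is a placeholder.\<close>
  define \<beta> where "\<beta> = (\<lambda>i::nat. [1, 1, 1, 1, 1, 1, l, 1] ! i)"
  have "\<And>i. i \<in> I7 \<Longrightarrow> \<beta> i \<noteq> 0" using ball_I7[of "\<lambda>i. \<beta> i \<noteq> 0"] l by (simp add: \<beta>_def)
  then obtain \<eta>'' where \<eta>'': "\<eta>'' \<in> admissible" "eta_equiv \<eta>' \<eta>''" "eta_support \<eta>'' = eta_support \<eta>'"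
    "\<And>i j. i \<in> I7 \<Longrightarrow> j \<in> I7 \<Longrightarrow> i \<noteq> j \<Longrightarrow> \<eta>'' {i, j} = \<eta>' {i, j} * \<beta> (i \<star> j) / (\<beta> i * \<beta> j)"
    using normalize[OF \<eta>'(1), of \<beta>] by blast
  have "\<eta>'' = eta17 l"
  proof (rule eq_on_T_list[OF n \<eta>''(1) _ eta_star_admissible(2) eta_support_eta17])
    show "eta_support \<eta>'' = T_set 17" using \<eta>''(3) \<eta>'(3) \<eta>(2) by simp
    show "\<forall>p\<in>set (T_list 17). \<eta>'' (un p) = eta17 l (un p)"
      using B l by (simp add: T_list_def T_lists_def un_def eta17_def doubleton_eq_iff \<eta>''(4) star_eq_xo I7_def xo_def xtab_def \<beta>_def)
  qed (use l in simp_all)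
  with eta_equiv_trans[OF \<eta>'(2) \<eta>''(2)] l show ?thesis by metis
qed

lemma normal_form_20:
  assumes \<eta>: "\<eta> \<in> admissible" "eta_support \<eta> = T_set 20"
  shows "\<exists>l m. l \<noteq> 0 \<and> m \<noteq> 0 \<and> eta_equiv \<eta> (eta20 l m)"
proof -
  have n: "20 \<in> {1..24::nat}" by simp
  obtain M c where c: "normal_certs ! (20 - 1) = ([(1,2),(1,3),(1,4),(1,5)], M, c)" by (simp add: normal_certs_def)
  obtain \<eta>' where \<eta>': "\<eta>' \<in> admissible" "eta_equiv \<eta> \<eta>'" "eta_support \<eta>' = T_set 20"
    and B: "\<forall>p\<in>set [(1,2),(1,3),(1,4),(1,5)]. \<eta>' (un p) = 1" by (rule normalize_cert[OF n \<eta> c])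
  have B: "\<eta>' {1,2} = 1" "\<eta>' {1,3} = 1" "\<eta>' {1,4} = 1" "\<eta>' {1,5} = 1" using B by (simp_all add: un_def)
  obtain l where l: "\<eta>' {1,6} = l * l" "l \<noteq> 0"
    using square_root_nonzero support_nonzero[OF n] \<eta>'(3) \<eta>(2) by (simp add: T_list_def T_lists_def un_def) metis
  obtain m where m: "\<eta>' {1,7} = m * m" "m \<noteq> 0"
    using square_root_nonzero support_nonzero[OF n] \<eta>'(3) \<eta>(2) by (simp add: T_list_def T_lists_def un_def) metis
  \<comment> \<open>The pairs of values (1, l^2) on {1,3}, {1,6} and (1, m^2) on {1,4}, {1,7} become
    (l, l) and (m, m).\<close>
  define \<beta> where "\<beta> = (\<lambda>i::nat. [1, 1, 1, 1, 1, 1, l, m] ! i)"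
  have "\<And>i. i \<in> I7 \<Longrightarrow> \<beta> i \<noteq> 0" using ball_I7[of "\<lambda>i. \<beta> i \<noteq> 0"] l m by (simp add: \<beta>_def)
  then obtain \<eta>'' where \<eta>'': "\<eta>'' \<in> admissible" "eta_equiv \<eta>' \<eta>''" "eta_support \<eta>'' = eta_support \<eta>'"
    "\<And>i j. i \<in> I7 \<Longrightarrow> j \<in> I7 \<Longrightarrow> i \<noteq> j \<Longrightarrow> \<eta>'' {i, j} = \<eta>' {i, j} * \<beta> (i \<star> j) / (\<beta> i * \<beta> j)"
    using normalize[OF \<eta>'(1), of \<beta>] by blast
  have "\<eta>'' = eta20 l m"
  proof (rule eq_on_T_list[OF n \<eta>''(1) _ eta_star_admissible(3) eta_support_eta20])
    show "eta_support \<eta>'' = T_set 20" using \<eta>''(3) \<eta>'(3) \<eta>(2) by simp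
    show "\<forall>p\<in>set (T_list 20). \<eta>'' (un p) = eta20 l m (un p)"
      using B l m by (simp add: T_list_def T_lists_def un_def eta20_def doubleton_eq_iff \<eta>''(4) star_eq_xo I7_def xo_def xtab_def \<beta>_def)
  qed (use l m in simp_all)
  with eta_equiv_trans[OF \<eta>'(2) \<eta>''(2)] l m show ?thesis by metis
qed

section \<open>Distinguishing the supports\<close>

definition deg :: "nat set set \<Rightarrow> nat \<Rightarrow> nat" where
  "deg T v = card {t \<in> T. v \<in> t}"

text \<open>Counts edges by the degree of their bracket; \<open>Min\<close> and \<open>Max\<close>
  recover the two ends of an unordered edge.\<close>

definition lab :: "nat set set \<Rightarrow> nat \<Rightarrow> nat" where
  "lab T v = card {t \<in> T. Min t \<star> Max t = v}"

lemma edgeE: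
  assumes "t \<in> edges" obtains i j where "t = {i, j}" "i \<in> I7" "j \<in> I7" "i \<noteq> j"
  using assms by (auto simp: edges_def)

lemma Min_Max_star: "i \<in> I7 \<Longrightarrow> j \<in> I7 \<Longrightarrow> i \<noteq> j \<Longrightarrow> Min {i, j} \<star> Max {i, j} = i \<star> j"
  using star_commute[of i j] by (cases "i < j") simp_all

lemma supp_iso_card:
  assumes iso: "supp_iso \<pi> T T'" and T: "T \<subseteq> edges" "T' \<subseteq> edges" and P: "\<And>t. t \<in> T \<Longrightarrow> P t \<longleftrightarrow> P' (\<pi> ` t)"
  shows "card {t \<in> T. P t} = card {t \<in> T'. P' t}"
proof -
  have bij: "bij_betw \<pi> I7 I7" and e: "\<And>i j. i \<in> I7 \<Longrightarrow> j \<in> I7 \<Longrightarrow> i \<noteq> j \<Longrightarrow> {i, j} \<in> T \<longleftrightarrow> {\<pi> i, \<pi> j} \<in> T'"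
    using iso by (auto simp: supp_iso_def)
  have inj: "inj_on \<pi> I7" using bij by (rule bij_betw_imp_inj_on)
  have sub: "t \<subseteq> I7" if "t \<in> edges" for t using that by (auto simp: edges_def)
  have "inj_on (\<lambda>t. \<pi> ` t) {t \<in> T. P t}"
    by (rule inj_onI) (use inj_on_image_eq_iff[OF inj] sub T(1) in blast)
  moreover have "(\<lambda>t. \<pi> ` t) ` {t \<in> T. P t} = {t \<in> T'. P' t}"
  proof (intro equalityI subsetI)
    fix s assume "s \<in> (\<lambda>t. \<pi> ` t) ` {t \<in> T. P t}"
    then obtain t where t: "t \<in> T" "P t" "s = \<pi> ` t" by blast
    obtain i j where ij: "t = {i, j}" "i \<in> I7" "j \<in> I7" "i \<noteq> j" using edgeE t(1) T(1) by blast
    then have "s \<in> T'" using e t by simp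
    then show "s \<in> {t \<in> T'. P' t}" using P[OF t(1)] t(2,3) by blast
  next
    fix s assume s: "s \<in> {t \<in> T'. P' t}"
    obtain a b where ab: "s = {a, b}" "a \<in> I7" "b \<in> I7" "a \<noteq> b" using edgeE s T(2) by blast
    obtain i j where ij: "i \<in> I7" "j \<in> I7" "\<pi> i = a" "\<pi> j = b"
      using ab(2,3) bij by (metis bij_betw_imp_surj_on imageE)
    then have t: "{i, j} \<in> T" "\<pi> ` {i, j} = s" using e[of i j] s ab by auto
    then show "s \<in> (\<lambda>t. \<pi> ` t) ` {t \<in> T. P t}" using P[OF t(1)] s by blast
  qed
  ultimately show ?thesis by (metis card_image)
qed

lemma supp_iso_deg:
  assumes iso: "supp_iso \<pi> T T'" and T: "T \<subseteq> edges" "T' \<subseteq> edges" and v: "v \<in> I7"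
  shows "deg T' (\<pi> v) = deg T v"
  unfolding deg_def
proof (rule supp_iso_card[OF assms(1-3), symmetric])
  fix t assume "t \<in> T"
  then have "t \<subseteq> I7" using T(1) by (auto simp: edges_def)
  moreover have "inj_on \<pi> I7" using iso by (auto simp: supp_iso_def bij_betw_def)
  ultimately show "v \<in> t \<longleftrightarrow> \<pi> v \<in> \<pi> ` t" using v by (auto simp: inj_on_def)
qed

lemma supp_iso_lab:
  assumes iso: "supp_iso \<pi> T T'" and T: "T \<subseteq> edges" "T' \<subseteq> edges" and v: "v \<in> I7"
  shows "lab T' (\<pi> v) = lab T v"
  unfolding lab_def
proof (rule supp_iso_card[OF assms(1-3), symmetric])
  fix t assume t: "t \<in> T"
  obtain i j where ij: "t = {i, j}" "i \<in> I7" "j \<in> I7" "i \<noteq> j" using edgeE t T(1) by blast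
  have bij: "bij_betw \<pi> I7 I7" and st: "\<pi> (i \<star> j) = \<pi> i \<star> \<pi> j"
    using iso ij t unfolding supp_iso_def by blast+
  have pij: "\<pi> i \<in> I7" "\<pi> j \<in> I7" "\<pi> i \<noteq> \<pi> j" using bij ij by (auto simp: bij_betw_def inj_on_def)
  have "Min (\<pi> ` t) \<star> Max (\<pi> ` t) = \<pi> (i \<star> j)" using Min_Max_star[OF pij] st ij(1) by simp
  moreover have "Min t \<star> Max t = i \<star> j" using Min_Max_star[OF ij(2-4)] ij(1) by simp
  moreover have "\<pi> (i \<star> j) = \<pi> v \<longleftrightarrow> i \<star> j = v"
    using bij star_I7[OF ij(2-4)] v by (auto simp: bij_betw_def inj_on_def)
  ultimately show "Min t \<star> Max t = v \<longleftrightarrow> Min (\<pi> ` t) \<star> Max (\<pi> ` t) = \<pi> v" by simp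
qed

definition deg_list :: "(nat \<times> nat) list \<Rightarrow> nat \<Rightarrow> nat" where
  "deg_list L v = length (filter (\<lambda>p. v = fst p \<or> v = snd p) L)"

definition lab_list :: "(nat \<times> nat) list \<Rightarrow> nat \<Rightarrow> nat" where
  "lab_list L v = length (filter (\<lambda>p. xo (fst p) (snd p) = v) L)"

lemma T_lists_sorted:
  "list_all (\<lambda>T. distinct T \<and> list_all (\<lambda>p. fst p < snd p \<and> fst p \<noteq> 0 \<and> snd p \<le> 7) T) T_lists"
  by code_simp

lemma deg_lab_list:
  assumes n: "n \<in> {1..24}"
  shows "deg (T_set n) v = deg_list (T_list n) v" "lab (T_set n) v = lab_list (T_list n) v"
proof -
  let ?L = "T_list n"
  have "?L \<in> set T_lists" using T_lists_nth[OF n] by (metis nth_mem)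
  then have d: "distinct ?L" and s: "\<And>p. p \<in> set ?L \<Longrightarrow> fst p < snd p \<and> fst p \<noteq> 0 \<and> snd p \<le> 7"
    using T_lists_sorted unfolding list_all_iff by blast+
  have inj: "inj_on un (set ?L)"
  proof (rule inj_onI)
    fix p q assume "p \<in> set ?L" "q \<in> set ?L" "un p = un q"
    then show "p = q" using s[of p] s[of q] by (cases p; cases q) (auto simp: un_def doubleton_eq_iff)
  qed
  have c: "card {t \<in> T_set n. P t} = length (filter (\<lambda>p. P (un p)) ?L)" for P
  proof -
    have "{t \<in> T_set n. P t} = un ` set (filter (\<lambda>p. P (un p)) ?L)" unfolding T_set_list[OF n] by auto
    moreover have "inj_on un (set (filter (\<lambda>p. P (un p)) ?L))" using inj by (rule inj_on_subset) auto
    ultimately have "card {t \<in> T_set n. P t} = card (set (filter (\<lambda>p. P (un p)) ?L))" by (simp only: card_image)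
    also have "\<dots> = length (filter (\<lambda>p. P (un p)) ?L)" using d by (intro distinct_card) simp
    finally show ?thesis .
  qed
  show "deg (T_set n) v = deg_list ?L v" unfolding deg_def c deg_list_def by (simp add: un_def)
  have "filter (\<lambda>p. Min (un p) \<star> Max (un p) = v) ?L = filter (\<lambda>p. xo (fst p) (snd p) = v) ?L"
  proof (rule filter_cong[OF refl])
    fix p assume p: "p \<in> set ?L"
    have "fst p \<in> I7" "snd p \<in> I7" "fst p \<noteq> snd p" using s[OF p] by (auto simp: I7_def)
    then show "(Min (un p) \<star> Max (un p) = v) = (xo (fst p) (snd p) = v)"
      using Min_Max_star[of "fst p" "snd p"] star_eq_xo[of "fst p" "snd p"] unfolding un_def by simp
  qed
  then show "lab (T_set n) v = lab_list ?L v" unfolding lab_def c lab_list_def by simp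
qed

text \<open>A numerical invariant that separates the supports, except \<open>T\<^sub>8\<close> from \<open>T\<^sub>1\<^sub>0\<close>.\<close>

definition hash :: "nat set set \<Rightarrow> int" where
  "hash T = (\<Sum>v\<in>I7. (2 * int (deg T v) + int (lab T v)) ^ 3)"

definition hash_values :: "int list" where
  "hash_values = [0, 17, 82, 118, 40, 375, 75, 243, 279,
    243, 195, 153, 584, 620, 362, 272, 1117, 577, 888, 1890, 756, 3350, 9507, 23625]"

lemma hash_T_set:
  assumes n: "n \<in> {1..24}"
  shows "hash (T_set n) = hash_values ! (n - 1)"
proof -
  have sum7: "(\<Sum>v\<in>I7. f v) = sum_list (map f [1,2,3,4,5,6,7])" for f :: "nat \<Rightarrow> int"
  proof -
    have I: "I7 = {1,2,3,4,5,6,7}" by (auto simp: I7_def)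
    show ?thesis unfolding I by simp
  qed
  have "map (\<lambda>T. sum_list (map (\<lambda>v. (2 * int (deg_list T v) + int (lab_list T v)) ^ 3) [1,2,3,4,5,6,7])) T_lists
    = hash_values" (is "map ?f T_lists = _") by code_simp
  moreover have "map ?f T_lists ! (n - 1) = ?f (T_lists ! (n - 1))"
    by (rule nth_map) (use T_lists_nth[OF n] in blast)
  ultimately have "?f (T_lists ! (n - 1)) = hash_values ! (n - 1)" by (simp only:)
  then show ?thesis using T_lists_nth[OF n] unfolding hash_def sum7 deg_lab_list[OF n] by simp
qed

text \<open>The value 243 belongs to both \<open>T_set 8\<close> and \<open>T_set 10\<close>, which
  carry equivalent maps; with 8 left out the tabulated values are pairwise distinct.\<close>

lemma hash_injective:
  assumes "m \<in> {1..24}" "n \<in> {1..24}" "m \<noteq> 8" "n \<noteq> 8" "hash (T_set m) = hash (T_set n)"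
  shows "m = n"
proof -
  have "list_all (\<lambda>m. list_all (\<lambda>n. m = 8 \<or> n = 8 \<or> m = n \<or> hash_values ! (m - 1) \<noteq> hash_values ! (n - 1)) [1..<25]) [1..<25]"
    by code_simp
  moreover have "m \<in> set [1..<25]" "n \<in> set [1..<25]" using assms by simp_all
  ultimately show ?thesis using assms(3-5) unfolding hash_T_set[OF assms(1)] hash_T_set[OF assms(2)] list_all_iff by blast
qed

lemma eta_equiv_support:
  assumes "eta_equiv \<eta> \<eta>'" "eta_support \<eta> = T_set m" "eta_support \<eta>' = T_set n" "m \<in> {1..24} - {8}" "n \<in> {1..24} - {8}"
  shows "m = n"
proof (rule gc_equivE[OF assms(1)[unfolded eta_equiv_def]])
  fix \<pi> \<phi>
  assume \<phi>: "bij_betw \<pi> I7 I7" "\<And>i. i \<in> I7 \<Longrightarrow> \<phi> ` Der_grade (gel i) = Der_grade (gel (\<pi> i))"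
    "bij_betw \<phi> Der Der" "\<And>x y. x \<in> Der \<Longrightarrow> y \<in> Der \<Longrightarrow> \<phi> (x + y) = \<phi> x + \<phi> y"
    "\<And>c x. x \<in> Der \<Longrightarrow> \<phi> (scaleE c x) = scaleE c (\<phi> x)"
    "\<And>x y. x \<in> Der \<Longrightarrow> y \<in> Der \<Longrightarrow> \<phi> (contr_bracket (eps \<eta>) x y) = contr_bracket (eps \<eta>') (\<phi> x) (\<phi> y)"
  have iso: "supp_iso \<pi> (T_set m) (T_set n)"
    using supp_isoI[OF \<phi>(1,2,3,5,6)] unfolding assms(2,3) .
  have e: "T_set m \<subseteq> edges" "T_set n \<subseteq> edges" using assms(4,5) T_set_edges by blast+
  have "hash (T_set n) = (\<Sum>v\<in>I7. (2 * int (deg (T_set n) (\<pi> v)) + int (lab (T_set n) (\<pi> v))) ^ 3)"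
    unfolding hash_def by (rule sum.reindex_bij_betw[OF \<phi>(1), symmetric])
  also have "\<dots> = hash (T_set m)"
    unfolding hash_def by (rule sum.cong) (simp_all add: supp_iso_deg[OF iso e] supp_iso_lab[OF iso e])
  finally show "m = n" using hash_injective[of m n] assms(4,5) by simp
qed

section \<open>The three families\<close>

text \<open>Keeps the numerical content of \<open>torus_invariant\<close> and drops the isomorphism,
  so that the families can be compared through \<open>\<pi>\<close> alone.\<close>

definition torus_compatible :: "(nat set \<Rightarrow> complex) \<Rightarrow> (nat set \<Rightarrow> complex) \<Rightarrow> (nat \<Rightarrow> nat) \<Rightarrow> bool" where
  "torus_compatible \<eta> \<eta>' \<pi> \<longleftrightarrow> (\<forall>i\<in>{2..7}. \<forall>j\<in>{2..7}. i \<noteq> j \<and> j \<noteq> xo 1 i \<and> \<pi> j \<noteq> xo 1 (\<pi> i) \<and>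
    lpar \<eta> i \<noteq> 0 \<and> lpar \<eta>' (\<pi> i) \<noteq> 0 \<longrightarrow> lpar \<eta> i * lpar \<eta>' (\<pi> j) = lpar \<eta> j * lpar \<eta>' (\<pi> i))"

lemma star_family_invariant:
  assumes eq: "eta_equiv \<eta> \<eta>'" and s: "eta_support \<eta> = T_set n" "eta_support \<eta>' = T_set n" and n: "n \<in> {14, 17, 20}"
  obtains \<pi> where "bij_betw \<pi> I7 I7" "\<pi> 1 = 1" "supp_iso \<pi> (T_set n) (T_set n)" "torus_compatible \<eta> \<eta>' \<pi>"
proof (rule gc_equivE[OF eq[unfolded eta_equiv_def]])
  fix \<pi> \<phi>
  assume \<phi>: "bij_betw \<pi> I7 I7" "\<And>i. i \<in> I7 \<Longrightarrow> \<phi> ` Der_grade (gel i) = Der_grade (gel (\<pi> i))"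
    "bij_betw \<phi> Der Der" "\<And>x y. x \<in> Der \<Longrightarrow> y \<in> Der \<Longrightarrow> \<phi> (x + y) = \<phi> x + \<phi> y"
    "\<And>c x. x \<in> Der \<Longrightarrow> \<phi> (scaleE c x) = scaleE c (\<phi> x)"
    "\<And>x y. x \<in> Der \<Longrightarrow> y \<in> Der \<Longrightarrow> \<phi> (contr_bracket (eps \<eta>) x y) = contr_bracket (eps \<eta>') (\<phi> x) (\<phi> y)"
  have iso: "supp_iso \<pi> (T_set n) (T_set n)"
    using supp_isoI[OF \<phi>(1,2,3,5,6)] unfolding s .
  have n24: "n \<in> {1..24}" using n by auto
  have I: "1 \<in> I7" by (simp add: I7_def)
  have d: "deg (T_set n) (\<pi> 1) = deg (T_set n) 1"
    by (rule supp_iso_deg[OF iso T_set_edges[OF n24] T_set_edges[OF n24] I])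
  have p: "\<pi> 1 \<in> I7" using \<phi>(1) I by (auto simp: bij_betw_def)
  \<comment> \<open>In each of the three supports the centre 1 of the star is the only vertex of its
    degree.\<close>
  have "\<forall>v\<in>I7. v \<noteq> 1 \<longrightarrow> deg (T_set n) v \<noteq> deg (T_set n) 1"
    unfolding ball_I7 deg_lab_list[OF n24] using n by (elim insertE emptyE) (simp_all add: deg_list_def T_list_def T_lists_def)
  then have \<pi>1: "\<pi> 1 = 1" using d p by metis
  have "torus_compatible \<eta> \<eta>' \<pi>"
    unfolding torus_compatible_def
    by (intro ballI impI, elim conjE) (rule torus_invariant[OF \<phi> \<pi>1])
  then show thesis by (rule that[OF \<phi>(1) \<pi>1 iso])
qed

lemma star_1: "j \<in> {2..7} \<Longrightarrow> 1 \<star> j = xo 1 j"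
  by (rule star_eq_xo) (auto simp: I7_def)

lemma lpar_eta14: "lpar (eta14 l) 2 = 1" "lpar (eta14 l) 5 = 1" "lpar (eta14 l) 3 = l" "lpar (eta14 l) 6 = l"
  by (simp_all add: lpar_def star_1 xo_def xtab_def eta14_def doubleton_eq_iff del: One_nat_def)

lemma lpar_eta17: "lpar (eta17 l) 2 = 1" "lpar (eta17 l) 5 = 1" "lpar (eta17 l) 3 = l\<^sup>2" "lpar (eta17 l) 6 = l\<^sup>2"
  by (simp_all add: lpar_def star_1 xo_def xtab_def eta17_def doubleton_eq_iff power2_eq_square del: One_nat_def)

lemma lpar_eta20: "lpar (eta20 l m) 2 = 1" "lpar (eta20 l m) 5 = 1" "lpar (eta20 l m) 3 = l\<^sup>2" "lpar (eta20 l m) 6 = l\<^sup>2"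
    "lpar (eta20 l m) 4 = m\<^sup>2" "lpar (eta20 l m) 7 = m\<^sup>2"
  by (simp_all add: lpar_def star_1 xo_def xtab_def eta20_def doubleton_eq_iff power2_eq_square del: One_nat_def)

text \<open>The vertices 2, 3, 5, 6 of the two lines through 1 that are fully present are exactly
  those with one edge and one label, so they are permuted. Since {1,2} is an edge, 5 = 1 * 2 goes to
  1 * \<open>\<pi> 2\<close>; hence the two lines are preserved or interchanged.\<close>

lemma two_line_perm:
  assumes bij: "bij_betw \<pi> I7 I7" and \<pi>1: "\<pi> 1 = 1" and iso: "supp_iso \<pi> (T_set n) (T_set n)" and n: "n \<in> {14, 17}"
  shows "\<pi> 3 \<noteq> xo 1 (\<pi> 2)" "\<pi> 2 \<in> {2,5} \<and> \<pi> 3 \<in> {3,6} \<or> \<pi> 2 \<in> {3,6} \<and> \<pi> 3 \<in> {2,5}"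
proof -
  have n24: "n \<in> {1..24}" using n by auto
  note E = T_set_edges[OF n24]
  have I: "1 \<in> I7" "2 \<in> I7" "3 \<in> I7" "5 \<in> I7" by (simp_all add: I7_def)
  have p: "\<pi> 2 \<in> I7" "\<pi> 3 \<in> I7" "\<pi> 5 \<in> I7" using bij I by (auto simp: bij_betw_def)
  have in7: "\<pi> i = \<pi> j \<longleftrightarrow> i = j" if "i \<in> I7" "j \<in> I7" for i j
    using bij that by (auto simp: bij_betw_def inj_on_def)
  have tab: "\<forall>v\<in>I7. deg (T_set n) v = 1 \<and> lab (T_set n) v = 1 \<longleftrightarrow> v \<in> {2,3,5,6}"
    unfolding ball_I7 deg_lab_list[OF n24] using n
    by (elim insertE emptyE) (simp_all add: deg_list_def lab_list_def T_list_def T_lists_def xo_def xtab_def)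
  have q: "\<pi> v \<in> {2,3,5,6}" if "v \<in> I7" "v \<in> {2,3,5,6}" for v
  proof -
    have "\<pi> v \<in> I7" using bij that(1) by (auto simp: bij_betw_def)
    then show ?thesis using tab that supp_iso_deg[OF iso E E that(1)] supp_iso_lab[OF iso E E that(1)] by metis
  qed
  have "{1, 2} \<in> T_set n" using n by (auto simp: T_set_def)
  then have "\<pi> (1 \<star> 2) = \<pi> 1 \<star> \<pi> 2" using iso I unfolding supp_iso_def by simp
  moreover have "1 \<star> 2 = 5" using star_1[of 2] by (simp add: xo_def xtab_def)
  moreover have "1 \<noteq> \<pi> 2" using in7[OF I(1,2)] \<pi>1 by simp
  ultimately have p5: "\<pi> 5 = xo 1 (\<pi> 2)" using \<pi>1 star_eq_xo[OF I(1) p(1)] by simp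
  show ne: "\<pi> 3 \<noteq> xo 1 (\<pi> 2)" unfolding p5[symmetric] using in7[OF I(3,4)] by simp
  have "\<pi> 2 \<in> {2,3,5,6}" "\<pi> 3 \<in> {2,3,5,6}" "\<pi> 3 \<noteq> \<pi> 2" using q I in7[OF I(3,2)] by auto
  then show "\<pi> 2 \<in> {2,5} \<and> \<pi> 3 \<in> {3,6} \<or> \<pi> 2 \<in> {3,6} \<and> \<pi> 3 \<in> {2,5}"
    using ne by (elim insertE emptyE) (simp_all add: xo_def xtab_def)
qed

text \<open>The two lines carry the multipliers 1 and l. Their ratio is kept or inverted according
  to whether \<open>\<pi>\<close> keeps or interchanges the lines.\<close>

lemma eta14_equivD:
  assumes "l \<noteq> 0" "l' \<noteq> 0" "eta_equiv (eta14 l) (eta14 l')" shows "l' \<in> {l, 1 / l}"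
proof -
  obtain \<pi> where \<pi>: "bij_betw \<pi> I7 I7" "\<pi> 1 = 1" "supp_iso \<pi> (T_set 14) (T_set 14)"
    and inv: "torus_compatible (eta14 l) (eta14 l') \<pi>"
    using star_family_invariant[OF assms(3) eta_support_eta14 eta_support_eta14] assms by blast
  note P = two_line_perm[OF \<pi>]
  have "lpar (eta14 l') (\<pi> 2) \<noteq> 0" using P(2) assms by (auto simp: lpar_eta14)
  then have "lpar (eta14 l) 2 * lpar (eta14 l') (\<pi> 3) = lpar (eta14 l) 3 * lpar (eta14 l') (\<pi> 2)"
    using inv[unfolded torus_compatible_def, rule_format, of 2 3] P(1) by (simp add: lpar_eta14 xo_def xtab_def)
  then show ?thesis using P(2) assms by (auto simp: lpar_eta14 field_simps)
qed

text \<open>The multipliers are now 1 and the square of l, so only that square, up to inversion, is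
  an invariant; this is where the signs come from.\<close>

lemma eta17_equivD:
  assumes "l \<noteq> 0" "l' \<noteq> 0" "eta_equiv (eta17 l) (eta17 l')" shows "l' \<in> {l, - l, 1 / l, - (1 / l)}"
proof -
  obtain \<pi> where \<pi>: "bij_betw \<pi> I7 I7" "\<pi> 1 = 1" "supp_iso \<pi> (T_set 17) (T_set 17)"
    and inv: "torus_compatible (eta17 l) (eta17 l') \<pi>"
    using star_family_invariant[OF assms(3) eta_support_eta17 eta_support_eta17] assms by blast
  note P = two_line_perm[OF \<pi>]
  have "lpar (eta17 l') (\<pi> 2) \<noteq> 0" using P(2) assms by (auto simp: lpar_eta17)
  then have "lpar (eta17 l) 2 * lpar (eta17 l') (\<pi> 3) = lpar (eta17 l) 3 * lpar (eta17 l') (\<pi> 2)"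
    using inv[unfolded torus_compatible_def, rule_format, of 2 3] P(1) by (simp add: lpar_eta17 xo_def xtab_def)
  then have "l'\<^sup>2 = l\<^sup>2 \<or> 1 = l\<^sup>2 * l'\<^sup>2" using P(2) by (auto simp: lpar_eta17)
  then have "l'\<^sup>2 = l\<^sup>2 \<or> l'\<^sup>2 = (1 / l)\<^sup>2" using assms by (auto simp: field_simps)
  then show ?thesis unfolding power2_eq_iff by auto
qed

text \<open>All three lines through 1 are present and \<open>\<pi>\<close> permutes them. Read in
  permuted order, (1, l'^2, m'^2) is proportional to (1, l^2, m^2): six orders, which pair off under
  exchange of l' and m'.\<close>

lemma eta20_equivD:
  assumes nz: "l \<noteq> 0" "m \<noteq> 0" "l' \<noteq> 0" "m' \<noteq> 0" and eq: "eta_equiv (eta20 l m) (eta20 l' m')"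
  shows "(\<exists>x y. (x, y) \<in> {(l, m), (1 / l, m / l), (l / m, 1 / m)} \<and>
    (l'\<^sup>2 = x\<^sup>2 \<and> m'\<^sup>2 = y\<^sup>2 \<or> l'\<^sup>2 = y\<^sup>2 \<and> m'\<^sup>2 = x\<^sup>2))"
proof -
  obtain \<pi> where \<pi>: "bij_betw \<pi> I7 I7" "\<pi> 1 = 1" "supp_iso \<pi> (T_set 20) (T_set 20)"
    and inv: "torus_compatible (eta20 l m) (eta20 l' m') \<pi>"
    using star_family_invariant[OF eq eta_support_eta20 eta_support_eta20] nz by blast
  have I: "1 \<in> I7" "2 \<in> I7" "3 \<in> I7" "4 \<in> I7" "5 \<in> I7" "6 \<in> I7" "7 \<in> I7" by (simp_all add: I7_def)
  have in7: "\<pi> i = \<pi> j \<longleftrightarrow> i = j" if "i \<in> I7" "j \<in> I7" for i j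
    using \<pi>(1) that by (auto simp: bij_betw_def inj_on_def)
  have line: "\<pi> (xo 1 j) = xo 1 (\<pi> j)" "\<pi> j \<in> {2,5} \<or> \<pi> j \<in> {3,6} \<or> \<pi> j \<in> {4,7}" if j: "j \<in> {2,3,4}" for j
  proof -
    have jI: "j \<in> I7" "j \<noteq> 1" "j \<in> {2..7}" using j by (auto simp: I7_def)
    have pj: "\<pi> j \<in> I7" "\<pi> j \<noteq> 1" using \<pi>(1) jI in7[OF jI(1) I(1)] \<pi>(2) by (auto simp: bij_betw_def)
    have "{1, j} \<in> T_set 20" unfolding T_set_20 using j by auto
    then have "\<pi> (1 \<star> j) = \<pi> 1 \<star> \<pi> j" using \<pi>(3) I(1) jI unfolding supp_iso_def by metis
    then show "\<pi> (xo 1 j) = xo 1 (\<pi> j)" using star_1[OF jI(3)] star_eq_xo[OF I(1) pj(1)] pj(2) \<pi>(2) by simp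
    have "\<pi> j \<in> {2,3,4,5,6,7}" using pj by (auto simp: I7_def)
    then show "\<pi> j \<in> {2,5} \<or> \<pi> j \<in> {3,6} \<or> \<pi> j \<in> {4,7}" by blast
  qed
  have x: "xo 1 2 = 5" "xo 1 3 = 6" "xo 1 4 = 7" by (simp_all add: xo_def xtab_def)
  have ne: "\<pi> i \<noteq> \<pi> j" "\<pi> j \<noteq> xo 1 (\<pi> i)" if "i \<in> {2,3,4}" "j \<in> {2,3,4}" "i \<noteq> j" for i j
  proof -
    have ij: "i \<in> I7" "j \<in> I7" "xo 1 i \<in> I7" "xo 1 i \<noteq> j" using that x I by auto
    show "\<pi> i \<noteq> \<pi> j" using in7[OF ij(1,2)] that by simp
    show "\<pi> j \<noteq> xo 1 (\<pi> i)" unfolding line(1)[OF that(1), symmetric] using in7[OF ij(2,3)] ij(4) by simp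
  qed
  have xs: "xo 1 5 = 2" "xo 1 6 = 3" "xo 1 7 = 4" by (simp_all add: xo_def xtab_def)
  define X where "X = lpar (eta20 l' m')"
  have X: "X 2 = 1" "X 5 = 1" "X 3 = l'\<^sup>2" "X 6 = l'\<^sup>2" "X 4 = m'\<^sup>2" "X 7 = m'\<^sup>2"
    unfolding X_def by (rule lpar_eta20)+
  have "X (\<pi> 2) \<noteq> 0" using line(2)[of 2] nz X by auto
  then have e: "X (\<pi> 3) = l\<^sup>2 * X (\<pi> 2)" "X (\<pi> 4) = m\<^sup>2 * X (\<pi> 2)"
    using inv[unfolded torus_compatible_def, rule_format, of 2 3]
      inv[unfolded torus_compatible_def, rule_format, of 2 4] ne(2)[of 2 3] ne(2)[of 2 4] x unfolding X_def
    by (simp_all add: lpar_eta20)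
  define on_line where "on_line a j \<longleftrightarrow> \<pi> j \<in> {a, xo 1 a}" for a j
  have same: "\<not> (on_line a i \<and> on_line a j)"
    if "i \<in> {2,3,4}" "j \<in> {2,3,4}" "i \<noteq> j" "a \<in> {2,3,4}" for i j a
    using ne[OF that(1-3)] that(4) x xs unfolding on_line_def by auto
  have s: "\<not> (on_line a 2 \<and> on_line a 3)" "\<not> (on_line a 2 \<and> on_line a 4)" "\<not> (on_line a 3 \<and> on_line a 4)"
    if "a \<in> {2,3,4}" for a using same[of 2 3 a] same[of 2 4 a] same[of 3 4 a] that by simp_all
  have v: "X (\<pi> j) = 1 \<and> on_line 2 j \<or> X (\<pi> j) = l'\<^sup>2 \<and> on_line 3 j \<or> X (\<pi> j) = m'\<^sup>2 \<and> on_line 4 j"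
    if "j \<in> {2,3,4}" for j using line(2)[OF that] X x unfolding on_line_def by auto
  \<comment> \<open>The images of 2, 3, 4 lie on three different lines, which leaves the six
    permutations of the multipliers.\<close>
  have "(X (\<pi> 2), X (\<pi> 3), X (\<pi> 4)) \<in> {(1, l'\<^sup>2, m'\<^sup>2), (1, m'\<^sup>2, l'\<^sup>2), (l'\<^sup>2, 1, m'\<^sup>2), (l'\<^sup>2, m'\<^sup>2, 1), (m'\<^sup>2, 1, l'\<^sup>2), (m'\<^sup>2, l'\<^sup>2, 1)}"
  proof -
    have "X (\<pi> 2) = 1 \<and> on_line 2 2 \<or> X (\<pi> 2) = l'\<^sup>2 \<and> on_line 3 2 \<or> X (\<pi> 2) = m'\<^sup>2 \<and> on_line 4 2"
      "X (\<pi> 3) = 1 \<and> on_line 2 3 \<or> X (\<pi> 3) = l'\<^sup>2 \<and> on_line 3 3 \<or> X (\<pi> 3) = m'\<^sup>2 \<and> on_line 4 3"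
      "X (\<pi> 4) = 1 \<and> on_line 2 4 \<or> X (\<pi> 4) = l'\<^sup>2 \<and> on_line 3 4 \<or> X (\<pi> 4) = m'\<^sup>2 \<and> on_line 4 4"
      using v[of 2] v[of 3] v[of 4] by simp_all
    then show ?thesis using s[of 2] s[of 3] s[of 4] by (elim disjE conjE) simp_all
  qed
  then have "l'\<^sup>2 = l\<^sup>2 \<and> m'\<^sup>2 = m\<^sup>2 \<or> m'\<^sup>2 = l\<^sup>2 \<and> l'\<^sup>2 = m\<^sup>2 \<or>
      1 = l\<^sup>2 * l'\<^sup>2 \<and> m'\<^sup>2 = m\<^sup>2 * l'\<^sup>2 \<or> m'\<^sup>2 = l\<^sup>2 * l'\<^sup>2 \<and> 1 = m\<^sup>2 * l'\<^sup>2 \<or>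
      1 = l\<^sup>2 * m'\<^sup>2 \<and> l'\<^sup>2 = m\<^sup>2 * m'\<^sup>2 \<or> l'\<^sup>2 = l\<^sup>2 * m'\<^sup>2 \<and> 1 = m\<^sup>2 * m'\<^sup>2"
    using e by auto
  moreover have "1 = a\<^sup>2 * b\<^sup>2 \<and> c\<^sup>2 = d\<^sup>2 * b\<^sup>2 \<Longrightarrow> b\<^sup>2 = (1 / a)\<^sup>2 \<and> c\<^sup>2 = (d / a)\<^sup>2" if "a \<noteq> 0" for a b c d :: complex
    using that by (simp add: power_divide field_simps)
  ultimately show ?thesis using nz by (simp add: conj_commute) metis
qed

section \<open>Explicit equivalences within the families\<close>

lemma star_equiv_normalize:
  assumes out: "\<And>t. t \<notin> T_set 20 \<Longrightarrow> \<eta> t = 0 \<and> \<eta>' t = 0" and nz: "\<And>i. i \<in> I7 \<Longrightarrow> \<alpha> i \<noteq> (0::complex)"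
    and eq: "\<And>j. j \<in> {2,3,4,5,6,7} \<Longrightarrow> \<eta> {1, j} * \<alpha> (xo 1 j) = \<eta>' {1, j} * \<alpha> 1 * \<alpha> j"
  shows "eta_equiv \<eta> \<eta>'"
proof (rule eta_equiv_normalize[OF nz])
  fix i j assume ij: "i \<in> I7" "j \<in> I7" "i \<noteq> j"
  have r: "k \<in> {2,3,4,5,6,7}" if "k \<in> I7" "k \<noteq> 1" for k using that by (auto simp: I7_def)
  consider "i = 1" | "j = 1" | "1 \<notin> {i, j}" by auto
  then show "\<eta> {i, j} * \<alpha> (i \<star> j) = \<eta>' {i, j} * \<alpha> i * \<alpha> j"
  proof cases
    case 1
    then show ?thesis using eq[OF r[of j]] star_eq_xo[OF ij] ij by simp
  next
    case 2
    then have "\<eta> {1, i} * \<alpha> (1 \<star> i) = \<eta>' {1, i} * \<alpha> 1 * \<alpha> i"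
      using eq[OF r[of i]] star_eq_xo[of 1 i] ij by simp
    then show ?thesis unfolding 2 insert_commute[of i 1] star_commute[OF ij(1) ij(2)[unfolded 2] ij(3)[unfolded 2]]
      by (simp only: mult_ac)
  next
    case 3
    have "{i, j} \<notin> T_set 20" unfolding T_set_20 using 3 by (auto simp: doubleton_eq_iff)
    then show ?thesis using out by simp
  qed
qed

lemma star_equiv_coll:
  assumes \<pi>: "coll \<pi>" "\<pi> 1 = 1" and out: "\<And>t. t \<notin> T_set 20 \<Longrightarrow> \<eta> t = 0 \<and> \<eta>' t = 0"
    and eq: "\<And>j. j \<in> {2,3,4,5,6,7} \<Longrightarrow> \<eta>' {1, \<pi> j} = \<eta> {1, j}"
  shows "eta_equiv \<eta> \<eta>'"
proof (rule coll_equiv[OF \<pi>(1)])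
  fix i j assume ij: "i \<in> I7" "j \<in> I7" "i \<noteq> j"
  have r: "k \<in> {2,3,4,5,6,7}" if "k \<in> I7" "k \<noteq> 1" for k using that by (auto simp: I7_def)
  have I1: "1 \<in> I7" by (simp add: I7_def)
  consider "i = 1" | "j = 1" | "1 \<notin> {i, j}" by auto
  then show "\<eta>' {\<pi> i, \<pi> j} = \<eta> {i, j}"
  proof cases
    case 1
    then show ?thesis using eq[OF r[of j]] \<pi>(2) ij by simp
  next
    case 2
    then show ?thesis using eq[OF r[of i]] \<pi>(2) ij by (simp add: insert_commute)
  next
    case 3
    have "\<pi> i \<noteq> 1" "\<pi> j \<noteq> 1" using 3 collD(2)[OF \<pi>(1) ij(1) I1] collD(2)[OF \<pi>(1) ij(2) I1] \<pi>(2) by auto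
    then have "{i, j} \<notin> T_set 20" "{\<pi> i, \<pi> j} \<notin> T_set 20"
      unfolding T_set_20 using 3 by (auto simp: doubleton_eq_iff)
    then show ?thesis using out by simp
  qed
qed

text \<open>A common form for the three families: a collineation fixing 1 permutes the six entries,
  and a rescaling changes them by one equation per entry.\<close>

definition star_map :: "complex list \<Rightarrow> nat set \<Rightarrow> complex" where
  "star_map a = (\<lambda>_. 0)({1,2} := a ! 0, {1,3} := a ! 1, {1,4} := a ! 2, {1,5} := a ! 3, {1,6} := a ! 4, {1,7} := a ! 5)"

lemma star_map_simps:
  "star_map a {1, 2} = a ! 0" "star_map a {1, 3} = a ! 1" "star_map a {1, 4} = a ! 2"
  "star_map a {1, 5} = a ! 3" "star_map a {1, 6} = a ! 4" "star_map a {1, 7} = a ! 5"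
  by (simp_all add: star_map_def doubleton_eq_iff)

lemma star_map_outside: "t \<notin> T_set 20 \<Longrightarrow> star_map a t = 0"
  by (simp add: T_set_20 star_map_def)

lemma eta_star_map:
  "eta14 l = star_map [1, 1, 0, 1, l, 0]" "eta17 l = star_map [1, l, 1, 1, l, 0]"
  "eta20 l m = star_map [1, l, m, 1, l, m]"
proof -
  have eq: "f = star_map a"
    if "\<And>t. t \<notin> T_set 20 \<Longrightarrow> f t = 0" "f {1,2} = a ! 0" "f {1,3} = a ! 1" "f {1,4} = a ! 2"
      "f {1,5} = a ! 3" "f {1,6} = a ! 4" "f {1,7} = a ! 5" for f :: "nat set \<Rightarrow> complex" and a
  proof
    fix t show "f t = star_map a t"
    proof (cases "t \<in> T_set 20")
      case True
      then show ?thesis unfolding T_set_20 using that(2-7)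
        by (elim insertE emptyE) (simp_all only: star_map_simps)
    qed (use that(1) star_map_outside in simp)
  qed
  show "eta14 l = star_map [1, 1, 0, 1, l, 0]"
    by (rule eq) (simp_all add: T_set_20 eta14_def doubleton_eq_iff)
  show "eta17 l = star_map [1, l, 1, 1, l, 0]"
    by (rule eq) (simp_all add: T_set_20 eta17_def doubleton_eq_iff)
  show "eta20 l m = star_map [1, l, m, 1, l, m]"
    by (rule eq) (simp_all add: T_set_20 eta20_def doubleton_eq_iff)
qed

lemma star_map_normalize:
  assumes "\<forall>i\<in>I7. \<alpha> ! i \<noteq> (0::complex)"
    and "a ! 0 * \<alpha> ! 5 = b ! 0 * \<alpha> ! 1 * \<alpha> ! 2" "a ! 1 * \<alpha> ! 6 = b ! 1 * \<alpha> ! 1 * \<alpha> ! 3"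
    "a ! 2 * \<alpha> ! 7 = b ! 2 * \<alpha> ! 1 * \<alpha> ! 4" "a ! 3 * \<alpha> ! 2 = b ! 3 * \<alpha> ! 1 * \<alpha> ! 5"
    "a ! 4 * \<alpha> ! 3 = b ! 4 * \<alpha> ! 1 * \<alpha> ! 6" "a ! 5 * \<alpha> ! 4 = b ! 5 * \<alpha> ! 1 * \<alpha> ! 7"
  shows "eta_equiv (star_map a) (star_map b)"
proof (rule star_equiv_normalize[where \<alpha> = "\<lambda>i. \<alpha> ! i"])
  fix j :: nat assume "j \<in> {2,3,4,5,6,7}"
  moreover have "xo 1 2 = 5" "xo 1 3 = 6" "xo 1 4 = 7" "xo 1 5 = 2" "xo 1 6 = 3" "xo 1 7 = 4"
    by (simp_all add: xo_def xtab_def)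
  ultimately show "star_map a {1, j} * \<alpha> ! xo 1 j = star_map b {1, j} * \<alpha> ! 1 * \<alpha> ! j"
    using assms(2-7) by (elim insertE emptyE) (simp_all only: star_map_simps)
qed (use assms(1) star_map_outside in auto)

lemma star_map_swap_23: "eta_equiv (star_map a) (star_map [a ! 1, a ! 0, a ! 2, a ! 4, a ! 3, a ! 5])"
proof (rule star_equiv_coll[of "col_fun 1 3 2"])
  show "coll (col_fun 1 3 2)" by (rule coll_col_fun) code_simp
  fix j :: nat assume "j \<in> {2,3,4,5,6,7}"
  moreover have "col_fun 1 3 2 2 = 3" "col_fun 1 3 2 3 = 2" "col_fun 1 3 2 4 = 4" "col_fun 1 3 2 5 = 6"
    "col_fun 1 3 2 6 = 5" "col_fun 1 3 2 7 = 7" by code_simp+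
  ultimately show "star_map [a ! 1, a ! 0, a ! 2, a ! 4, a ! 3, a ! 5] {1, col_fun 1 3 2 j} = star_map a {1, j}"
    by (elim insertE emptyE) (simp_all only: star_map_simps, simp_all)
qed (use star_map_outside in \<open>simp_all add: col_fun_def col_list_def\<close>)

lemma star_map_swap_34: "eta_equiv (star_map a) (star_map [a ! 0, a ! 2, a ! 1, a ! 3, a ! 5, a ! 4])"
proof (rule star_equiv_coll[of "col_fun 1 2 4"])
  show "coll (col_fun 1 2 4)" by (rule coll_col_fun) code_simp
  fix j :: nat assume "j \<in> {2,3,4,5,6,7}"
  moreover have "col_fun 1 2 4 2 = 2" "col_fun 1 2 4 3 = 4" "col_fun 1 2 4 4 = 3" "col_fun 1 2 4 5 = 5"
    "col_fun 1 2 4 6 = 7" "col_fun 1 2 4 7 = 6" by code_simp+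
  ultimately show "star_map [a ! 0, a ! 2, a ! 1, a ! 3, a ! 5, a ! 4] {1, col_fun 1 2 4 j} = star_map a {1, j}"
    by (elim insertE emptyE) (simp_all only: star_map_simps, simp_all)
qed (use star_map_outside in \<open>simp_all add: col_fun_def col_list_def\<close>)

lemma eta14_equivI:
  assumes "l \<noteq> 0" "l' \<in> {l, 1 / l}" shows "eta_equiv (eta14 l) (eta14 l')"
proof (cases "l' = l")
  case True
  then show ?thesis by (simp add: eta_equiv_def gc_equiv_refl)
next
  case False
  then have l': "l' = 1 / l" using assms by simp
  obtain r where r: "l = r * r" "r \<noteq> 0" using square_root_nonzero[OF assms(1)] by blast
  \<comment> \<open>After the exchange of the lines l sits at {1,5}. Scaling the components of
    degrees g_1, g_5, g_6 by r moves it to {1,6} as 1/l.\<close>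
  have "eta_equiv (star_map [1, 1, 0, l, 1, 0]) (star_map [1, 1, 0, 1, 1 / l, 0])"
    by (rule star_map_normalize[of "[1, r, 1, 1, 1, r, r, 1]"]) (use r in \<open>simp_all add: ball_I7\<close>)
  then show ?thesis unfolding eta_star_map l'
    using eta_equiv_trans[OF star_map_swap_23[of "[1, 1, 0, 1, l, 0]"]] by simp
qed

lemma eta17_equivI:
  assumes l: "l \<noteq> 0" "l' \<in> {l, - l, 1 / l, - (1 / l)}" shows "eta_equiv (eta17 l) (eta17 l')"
proof -
  \<comment> \<open>A sign on the component of degree g_6 changes both values on the line through 1
    and 3.\<close>
  have sgn: "eta_equiv (eta17 k) (eta17 (- k))" for k
    unfolding eta_star_map by (rule star_map_normalize[of "[1, 1, 1, 1, 1, 1, - 1, 1]"]) (simp_all add: ball_I7)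
  \<comment> \<open>Scaling the component of degree g_1 by l divides by the value on the first line;
    the component of degree g_7 absorbs the effect on the edge {1,4}.\<close>
  have "eta_equiv (star_map [l, 1, 1, l, 1, 0]) (star_map [1, 1 / l, 1, 1, 1 / l, 0])"
    by (rule star_map_normalize[of "[1, l, 1, 1, 1, 1, 1, l]"]) (use l in \<open>simp_all add: ball_I7\<close>)
  then have inv: "eta_equiv (eta17 l) (eta17 (1 / l))" unfolding eta_star_map
    using eta_equiv_trans[OF star_map_swap_23[of "[1, l, 1, 1, l, 0]"]] by simp
  have "eta_equiv (eta17 l) (eta17 l)" by (simp add: eta_equiv_def gc_equiv_refl)
  then show ?thesis using l(2) sgn inv eta_equiv_trans[OF inv sgn] by blast
qed

text \<open>Generated by independent sign changes of l and m, the exchange of the lines of 3 and 4,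
  and the exchange of the lines of 2 and 3 followed by division by l.\<close>

lemma eta20_equivI:
  assumes nz: "l \<noteq> 0" "m \<noteq> 0" "l' \<noteq> 0" "m' \<noteq> 0"
    and xy: "(x, y) \<in> {(l, m), (1 / l, m / l), (l / m, 1 / m)}"
    and sq: "l'\<^sup>2 = x\<^sup>2 \<and> m'\<^sup>2 = y\<^sup>2 \<or> l'\<^sup>2 = y\<^sup>2 \<and> m'\<^sup>2 = x\<^sup>2"
  shows "eta_equiv (eta20 l m) (eta20 l' m')"
proof -
  have same: "eta_equiv (eta20 a b) (eta20 a' b')"
    if "a \<noteq> 0" "b \<noteq> 0" "a' \<noteq> 0" "b' \<noteq> 0" "a'\<^sup>2 = a\<^sup>2" "b'\<^sup>2 = b\<^sup>2" for a b a' b'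
    unfolding eta_star_map
    by (rule star_map_normalize[of "[1, 1, 1, 1, 1, 1, a' / a, b' / b]"])
      (use that in \<open>simp_all add: ball_I7 power2_eq_square field_simps\<close>)
  have swap: "eta_equiv (eta20 a b) (eta20 b a)" for a b
    unfolding eta_star_map using star_map_swap_34[of "[1, a, b, 1, a, b]"] by simp
  have inv: "eta_equiv (eta20 a b) (eta20 (1 / a) (b / a))" if "a \<noteq> 0" for a b
  proof -
    have "eta_equiv (star_map [a, 1, b, a, 1, b]) (star_map [1, 1 / a, b / a, 1, 1 / a, b / a])"
      by (rule star_map_normalize[of "[1, a, 1, 1, 1, 1, 1, 1]"]) (use that in \<open>simp_all add: ball_I7\<close>)
    then show ?thesis unfolding eta_star_map
      using eta_equiv_trans[OF star_map_swap_23[of "[1, a, b, 1, a, b]"]] by simp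
  qed
  have refl: "eta_equiv (eta20 l m) (eta20 l m)" by (simp add: eta_equiv_def gc_equiv_refl)
  \<comment> \<open>The path is (l, m), (m, l), (1/m, l/m), (l/m, 1/m).\<close>
  have "eta_equiv (eta20 l m) (eta20 (l / m) (1 / m))"
    using eta_equiv_trans[OF swap eta_equiv_trans[OF inv[OF nz(2)] swap]] .
  then have e: "eta_equiv (eta20 l m) (eta20 x y)" using xy refl inv[OF nz(1), of m] by blast
  have xn: "x \<noteq> 0" "y \<noteq> 0" using xy nz by auto
  from sq show ?thesis
  proof
    assume "l'\<^sup>2 = x\<^sup>2 \<and> m'\<^sup>2 = y\<^sup>2"
    then show ?thesis using eta_equiv_trans[OF e same] xn nz by blast
  next
    assume "l'\<^sup>2 = y\<^sup>2 \<and> m'\<^sup>2 = x\<^sup>2"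
    then show ?thesis using eta_equiv_trans[OF e eta_equiv_trans[OF swap same]] xn nz by blast
  qed
qed

text \<open>A set closed under negation is determined by the squares of its elements, so the sets in
  the classification translate into equations between squares.\<close>

lemma pm_set_eq_iff:
  fixes l m x y :: complex
  shows "{l, - l, m, - m} = {x, - x, y, - y} \<longleftrightarrow> l\<^sup>2 = x\<^sup>2 \<and> m\<^sup>2 = y\<^sup>2 \<or> l\<^sup>2 = y\<^sup>2 \<and> m\<^sup>2 = x\<^sup>2" (is "?L \<longleftrightarrow> ?R")
proof
  assume e: ?L
  have sq: "z\<^sup>2 = a\<^sup>2 \<or> z\<^sup>2 = b\<^sup>2" if "z \<in> {a, - a, b, - b}" for z a b :: complex using that by auto
  have "l \<in> {x, - x, y, - y}" "m \<in> {x, - x, y, - y}" "x \<in> {l, - l, m, - m}" "y \<in> {l, - l, m, - m}"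
    using e by blast+
  then have "l\<^sup>2 = x\<^sup>2 \<or> l\<^sup>2 = y\<^sup>2" "m\<^sup>2 = x\<^sup>2 \<or> m\<^sup>2 = y\<^sup>2" "x\<^sup>2 = l\<^sup>2 \<or> x\<^sup>2 = m\<^sup>2" "y\<^sup>2 = l\<^sup>2 \<or> y\<^sup>2 = m\<^sup>2"
    using sq by blast+
  then show ?R by metis
next
  assume ?R
  then show ?L unfolding power2_eq_iff by auto
qed

section \<open>The classification\<close>

lemma rep_item_simps:
  "rep_item 1 = {eta_ind (T_set i) | i. 1 \<le> i \<and> i \<le> 24 \<and> i \<notin> {8, 14, 17, 20}}"
  "rep_item 2 = {eta14 l | l. l \<noteq> 0}" "rep_item 3 = {eta17 l | l. l \<noteq> 0}"
  "rep_item 4 = {eta20 l m | l m. l \<noteq> 0 \<and> m \<noteq> 0}"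
  unfolding rep_item_def by simp_all

text \<open>Indices of the supports that occur in each item. The index 8 occurs in none of them, so
  supports separate the items.\<close>

definition item_indices :: "nat \<Rightarrow> nat set" where
  "item_indices n = (if n = 1 then {1..24} - {8, 14, 17, 20} else if n = 2 then {14} else if n = 3 then {17} else {20})"

lemma rep_item_support:
  assumes "n \<in> {1..4}" "\<eta> \<in> rep_item n"
  shows "\<eta> \<in> admissible" "\<exists>i\<in>item_indices n. eta_support \<eta> = T_set i"
proof -
  have "n = 1 \<or> n = 2 \<or> n = 3 \<or> n = 4" using assms(1) by auto
  then have "\<eta> \<in> admissible \<and> (\<exists>i\<in>item_indices n. eta_support \<eta> = T_set i)"
  proof (elim disjE)
    assume n: "n = 1"
    then obtain i where "i \<in> item_indices 1" "i \<in> {1..24}" "\<eta> = eta_ind (T_set i)"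
      using assms(2) unfolding n rep_item_simps item_indices_def by auto
    then show ?thesis using eta_ind_admissible eta_ind_support n by blast
  next
    assume n: "n = 2"
    then show ?thesis using assms(2) eta_star_admissible eta_support_eta14
      unfolding n rep_item_simps item_indices_def by auto
  next
    assume n: "n = 3"
    then show ?thesis using assms(2) eta_star_admissible eta_support_eta17
      unfolding n rep_item_simps item_indices_def by auto
  next
    assume n: "n = 4"
    then show ?thesis using assms(2) eta_star_admissible eta_support_eta20
      unfolding n rep_item_simps item_indices_def by auto
  qed
  then show "\<eta> \<in> admissible" "\<exists>i\<in>item_indices n. eta_support \<eta> = T_set i" by blast+
qed

lemma item_indices_range: "item_indices n \<subseteq> {1..24} - {8}"
  by (auto simp: item_indices_def)

lemma item_indices_disjoint:
  "m \<in> {1..4} \<Longrightarrow> n \<in> {1..4} \<Longrightarrow> m \<noteq> n \<Longrightarrow> item_indices m \<inter> item_indices n = {}"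
  by (auto simp: item_indices_def)

lemma admissible_equiv_rep:
  assumes \<eta>: "\<eta> \<in> admissible"
  shows "\<exists>n\<in>{1..4}. \<exists>\<eta>'\<in>rep_item n. eta_equiv \<eta> \<eta>'"
proof -
  obtain i \<zeta> where i: "i \<in> {1..24}" "\<zeta> \<in> admissible" "eta_equiv \<eta> \<zeta>" "eta_support \<zeta> = T_set i"
    by (rule exact_support[OF \<eta>])
  have rep: "\<exists>n\<in>{1..4}. \<exists>\<eta>'\<in>rep_item n. eta_equiv \<zeta> \<eta>'"
    if "eta_equiv \<zeta> \<eta>'" "\<eta>' \<in> rep_item n" "n \<in> {1..4}" for \<eta>' n using that by blast
  have ind: "\<exists>n\<in>{1..4}. \<exists>\<eta>'\<in>rep_item n. eta_equiv \<zeta> \<eta>'"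
    if "eta_equiv \<zeta> (eta_ind (T_set j))" "j \<in> {1..24}" "j \<notin> {8,14,17,20}" for j
    by (rule rep[OF that(1), of 1]) (use that(2,3) in \<open>auto simp: rep_item_simps(1)[unfolded One_nat_def]\<close>)
  have "\<exists>n\<in>{1..4}. \<exists>\<eta>'\<in>rep_item n. eta_equiv \<zeta> \<eta>'"
  proof (cases "i \<in> {8,14,17,20}")
    case False
    then have "eta_equiv \<zeta> (eta_ind (T_set i))" using normal_form_ind[OF i(1) _ i(2,4)] by blast
    then show ?thesis using ind i(1) False by blast
  next
    case True
    then consider "i = 8" | "i = 14" | "i = 17" | "i = 20" by blast
    then show ?thesis
    proof cases
      \<comment> \<open>Maps supported on \<open>T_set 8\<close> are represented by the indicator
        map of \<open>T_set 10\<close>.\<close>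
      case 1
      have "eta_equiv \<zeta> (eta_ind (T_set 8))" using normal_form_ind[OF i(1) _ i(2,4)] 1 by simp
      then have "eta_equiv \<zeta> (eta_ind (T_set 10))" using eta_equiv_trans T8_equiv_T10 by blast
      then show ?thesis by (rule ind) simp_all
    next
      case 2
      then obtain l where "l \<noteq> 0" "eta_equiv \<zeta> (eta14 l)" using normal_form_14[OF i(2)] i(4) by auto
      then show ?thesis by (intro rep[of "eta14 l" 2]) (auto simp: rep_item_simps)
    next
      case 3
      then obtain l where "l \<noteq> 0" "eta_equiv \<zeta> (eta17 l)" using normal_form_17[OF i(2)] i(4) by auto
      then show ?thesis by (intro rep[of "eta17 l" 3]) (auto simp: rep_item_simps)
    next
      case 4
      then obtain l m where "l \<noteq> 0" "m \<noteq> 0" "eta_equiv \<zeta> (eta20 l m)" using normal_form_20[OF i(2)] i(4) by auto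
      then show ?thesis by (intro rep[of "eta20 l m" 4]) (auto simp: rep_item_simps)
    qed
  qed
  then show ?thesis using eta_equiv_trans[OF i(3)] by blast
qed

theorem theorem4p13:
  shows
    "(\<forall>n\<in>{1..4}. \<forall>\<eta>\<in>rep_item n. \<eta> \<in> admissible \<and> graded_contraction (eps \<eta>)) \<and>
     (\<forall>\<epsilon>. graded_contraction \<epsilon> \<longrightarrow> (\<exists>n\<in>{1..4}. \<exists>\<eta>\<in>rep_item n. gc_equiv \<epsilon> (eps \<eta>))) \<and>
     (\<forall>m\<in>{1..4}. \<forall>n\<in>{1..4}. m \<noteq> n \<longrightarrow>
        (\<forall>\<eta>\<in>rep_item m. \<forall>\<eta>'\<in>rep_item n. \<not> eta_equiv \<eta> \<eta>')) \<and>
     (\<forall>\<eta>\<in>rep_item 1. \<forall>\<eta>'\<in>rep_item 1. \<eta> \<noteq> \<eta>' \<longrightarrow> \<not> eta_equiv \<eta> \<eta>') \<and>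
     (\<forall>l l'. l \<noteq> 0 \<and> l' \<noteq> 0 \<longrightarrow>
        (eta_equiv (eta14 l) (eta14 l') \<longleftrightarrow> l' \<in> {l, 1 / l})) \<and>
     (\<forall>l l'. l \<noteq> 0 \<and> l' \<noteq> 0 \<longrightarrow>
        (eta_equiv (eta17 l) (eta17 l') \<longleftrightarrow> l' \<in> {l, - l, 1 / l, - (1 / l)})) \<and>
     (\<forall>l m l' m'. l \<noteq> 0 \<and> m \<noteq> 0 \<and> l' \<noteq> 0 \<and> m' \<noteq> 0 \<longrightarrow>
        (eta_equiv (eta20 l m) (eta20 l' m') \<longleftrightarrow>
           {l', - l', m', - m'} = {l, - l, m, - m} \<or>
           {l', - l', m', - m'} = {1 / l, - (1 / l), m / l, - (m / l)} \<or>
           {l', - l', m', - m'} = {l / m, - (l / m), 1 / m, - (1 / m)}))"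
proof (intro conjI ballI allI impI)
  fix n \<eta> assume "n \<in> {1..4}" "\<eta> \<in> rep_item n"
  then show "\<eta> \<in> admissible" by (rule rep_item_support)
  then show "graded_contraction (eps \<eta>)" by (rule graded_contraction_eps)
next
  fix \<epsilon> assume "graded_contraction \<epsilon>"
  then obtain \<eta> where \<eta>: "\<eta> \<in> admissible" "gc_equiv \<epsilon> (eps \<eta>)" by (rule graded_contraction_equiv_eps)
  then show "\<exists>n\<in>{1..4}. \<exists>\<eta>\<in>rep_item n. gc_equiv \<epsilon> (eps \<eta>)"
    using admissible_equiv_rep[OF \<eta>(1)] gc_equiv_trans[OF \<eta>(2)] unfolding eta_equiv_def by blast
next
  fix m n \<eta> \<eta>' assume *: "m \<in> {1..4}" "n \<in> {1..4}" "m \<noteq> n" "\<eta> \<in> rep_item m" "\<eta>' \<in> rep_item n"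
  obtain i where i: "i \<in> item_indices m" "eta_support \<eta> = T_set i" using rep_item_support(2)[OF *(1,4)] by blast
  obtain j where j: "j \<in> item_indices n" "eta_support \<eta>' = T_set j" using rep_item_support(2)[OF *(2,5)] by blast
  have "i \<noteq> j" using item_indices_disjoint[OF *(1-3)] i(1) j(1) by blast
  moreover have "i \<in> {1..24} - {8}" "j \<in> {1..24} - {8}" using i(1) j(1) item_indices_range by blast+
  ultimately show "\<not> eta_equiv \<eta> \<eta>'" using eta_equiv_support[OF _ i(2) j(2)] by blast
next
  fix \<eta> \<eta>' assume *: "\<eta> \<in> rep_item 1" "\<eta>' \<in> rep_item 1" "\<eta> \<noteq> \<eta>'"
  obtain i where i: "i \<in> {1..24} - {8}" "\<eta> = eta_ind (T_set i)" using *(1) unfolding rep_item_simps by auto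
  obtain j where j: "j \<in> {1..24} - {8}" "\<eta>' = eta_ind (T_set j)" using *(2) unfolding rep_item_simps by auto
  have "i \<noteq> j" using * i j by blast
  moreover have "eta_support \<eta> = T_set i" "eta_support \<eta>' = T_set j" using i j eta_ind_support by blast+
  ultimately show "\<not> eta_equiv \<eta> \<eta>'" using eta_equiv_support i(1) j(1) by blast
next
  fix l l' :: complex assume "l \<noteq> 0 \<and> l' \<noteq> 0"
  then show "eta_equiv (eta14 l) (eta14 l') \<longleftrightarrow> l' \<in> {l, 1 / l}" using eta14_equivD eta14_equivI by blast
next
  fix l l' :: complex assume "l \<noteq> 0 \<and> l' \<noteq> 0"
  then show "eta_equiv (eta17 l) (eta17 l') \<longleftrightarrow> l' \<in> {l, - l, 1 / l, - (1 / l)}"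
    using eta17_equivD eta17_equivI by blast
next
  fix l m l' m' :: complex assume nz: "l \<noteq> 0 \<and> m \<noteq> 0 \<and> l' \<noteq> 0 \<and> m' \<noteq> 0"
  have "eta_equiv (eta20 l m) (eta20 l' m') \<longleftrightarrow> (\<exists>x y. (x, y) \<in> {(l, m), (1 / l, m / l), (l / m, 1 / m)} \<and>
    (l'\<^sup>2 = x\<^sup>2 \<and> m'\<^sup>2 = y\<^sup>2 \<or> l'\<^sup>2 = y\<^sup>2 \<and> m'\<^sup>2 = x\<^sup>2))"
    using nz eta20_equivD[of l m l' m'] eta20_equivI[of l m l' m'] by blast
  then show "eta_equiv (eta20 l m) (eta20 l' m') \<longleftrightarrow>
           {l', - l', m', - m'} = {l, - l, m, - m} \<or>
           {l', - l', m', - m'} = {1 / l, - (1 / l), m / l, - (m / l)} \<or>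
           {l', - l', m', - m'} = {l / m, - (l / m), 1 / m, - (1 / m)}"
    unfolding pm_set_eq_iff by auto
qed

end
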